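(* Let $K$ be an infinite field, let $t \ge 1$ be an integer, let $R = K[w,x,y,z]$ be the standard graded polynomial ring, let \[ \overline{I_t} := \left(\prod_{i=0}^{t}(x-iw),\ \prod_{i=0}^{t}(y-iw),\ \prod_{i=0}^{t}(z-iw),\ xyz\right) \subset R, \] and set $A = R/\overline{I_t}$. Then: (i) If the characteristic of $K$ is zero or greater than $t$, then the ideal $\overline{I_t}$ defines a set of $3(t+1)t+1$ points in $\mathbb{P}^3_K$ that is level of type three. (ii) If $\ell \in [R]_1$ is a general linear form, then $A/\ell A$ has the weak Lefschetz property. (iii) If $\ell = w$, then the Artinian algebra $A/\ell A$ has the weak Lefschetz property if and only if $t$ is odd and $\operatorname{char} K \neq 2$.
   Context: For a graded module $B$, $[B]_d$ denotes its degree $d$ component. A standard graded Artinian $K$-algebra $B$ has the weak Lefschetz property if there is a linear form $\ell \in [B]_1$ (a weak Lefschetz element of $B$) such that for all integers $d$ the multiplication map $\times \ell : [B]_d \to [B]_{d+1}$ has maximal rank, i.e. is injective or surjective. A graded Artinian quotient $B$ of a standard graded polynomial ring is level of type $s$ if its socle has dimension $s$ over $K$ and is concentrated in one degree. A reduced finite set of points in $\mathbb{P}^3_K$ with saturated homogeneous ideal $I \subset R$ is level of type $s$ if its Artinian reductions $R/(I,h)$, where $h$ is a linear form that is a non-zero-divisor on $R/I$, are level of type $s$. "General linear form" means: for all $\ell$ in some nonempty Zariski open subset of the $K$-vector space $[R]_1$. *)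

theory Defs
  imports
    "HOL-Library.Poly_Mapping"
    "HOL-Algebra.Algebra"
    "HOL-Computational_Algebra.Computational_Algebra"
    "HOL-Decision_Procs.Algebra_Aux"
begin

section \<open>The polynomial ring $K[w,x,y,z]$\<close>

text \<open>A polynomial is a finitely supported map from monomials to coefficients, a monomial a
  finitely supported map from indeterminates to exponents; multiplication is the convolution
  product of \<^theory>\<open>HOL-Library.Poly_Mapping\<close>.\<close>

datatype letter = Lw | Lx | Ly | Lz

type_synonym 'k poly4 = "(letter \<Rightarrow>\<^sub>0 nat) \<Rightarrow>\<^sub>0 'k"

definition const :: "'k::field \<Rightarrow> 'k poly4" where
  "const c = Poly_Mapping.single 0 c"

definition indet :: "letter \<Rightarrow> 'k::field poly4" where
  "indet v = Poly_Mapping.single (Poly_Mapping.single v 1) 1"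

definition mdeg :: "(letter \<Rightarrow>\<^sub>0 nat) \<Rightarrow> nat" where
  "mdeg m = (\<Sum>v\<in>Poly_Mapping.keys m. Poly_Mapping.lookup m v)"

text \<open>The component $[R]_d$, including the zero polynomial.\<close>

definition forms :: "nat \<Rightarrow> 'k::field poly4 set" where
  "forms d = {p. \<forall>m\<in>Poly_Mapping.keys p. mdeg m = d}"

definition evalp :: "'k::field poly4 \<Rightarrow> (letter \<Rightarrow> 'k) \<Rightarrow> 'k" where
  "evalp p a = (\<Sum>m\<in>Poly_Mapping.keys p.
      Poly_Mapping.lookup p m * (\<Prod>v\<in>Poly_Mapping.keys m. a v ^ Poly_Mapping.lookup m v))"

abbreviation polyring :: "'k::field poly4 ring" where
  "polyring \<equiv> cring_class_ops"

abbreviation ideal_of :: "'k::field poly4 set \<Rightarrow> 'k poly4 set" where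
  "ideal_of S \<equiv> Idl\<^bsub>polyring\<^esub> S"

abbreviation quotient_ring :: "'k::field poly4 set \<Rightarrow> 'k poly4 set ring" where
  "quotient_ring J \<equiv> polyring Quot J"

abbreviation residue :: "'k::field poly4 set \<Rightarrow> 'k poly4 \<Rightarrow> 'k poly4 set" where
  "residue J p \<equiv> J +>\<^bsub>polyring\<^esub> p"


section \<open>Graded quotients\<close>

text \<open>Throughout, a standard graded algebra $B = R/J$ is given by a homogeneous ideal $J$.
  Since $[B]_d = 0$ for $d < 0$, degrees are natural numbers.\<close>

definition component :: "'k::field poly4 set \<Rightarrow> nat \<Rightarrow> 'k poly4 set set" where
  "component J d = residue J ` forms d"

definition artinian_ring :: "('a, 'b) ring_scheme \<Rightarrow> bool" where
  "artinian_ring B \<longleftrightarrow>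
     (\<forall>f :: nat \<Rightarrow> 'a set. (\<forall>n. ideal (f n) B \<and> f (Suc n) \<subseteq> f n)
        \<longrightarrow> (\<exists>N. \<forall>n\<ge>N. f n = f N))"

definition weak_Lefschetz_element :: "'k::field poly4 set \<Rightarrow> 'k poly4 set \<Rightarrow> bool" where
  "weak_Lefschetz_element J l \<longleftrightarrow> l \<in> component J 1 \<and>
     (\<forall>d. inj_on (\<lambda>b. l \<otimes>\<^bsub>quotient_ring J\<^esub> b) (component J d) \<or>
          (\<lambda>b. l \<otimes>\<^bsub>quotient_ring J\<^esub> b) ` component J d = component J (d + 1))"

definition weak_Lefschetz :: "'k::field poly4 set \<Rightarrow> bool" where
  "weak_Lefschetz J \<longleftrightarrow>
     artinian_ring (quotient_ring J) \<and> (\<exists>l. weak_Lefschetz_element J l)"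

text \<open>The annihilator of the homogeneous maximal ideal $(w,x,y,z)$ in $R/J$.\<close>

definition socle :: "'k::field poly4 set \<Rightarrow> 'k poly4 set set" where
  "socle J = {b \<in> carrier (quotient_ring J). \<forall>p \<in> ideal_of (range indet).
     residue J p \<otimes>\<^bsub>quotient_ring J\<^esub> b = \<zero>\<^bsub>quotient_ring J\<^esub>}"

text \<open>The scalars act on $R/J$ through the residues of the constant polynomials.\<close>

definition level_of_type :: "nat \<Rightarrow> 'k::field poly4 set \<Rightarrow> bool" where
  "level_of_type s J \<longleftrightarrow>
     artinian_ring (quotient_ring J) \<and>
     ring.dimension (quotient_ring J) s (residue J ` range const) (socle J) \<and>
     (\<exists>d. socle J \<subseteq> component J d)"

definition nonzerodivisor_mod :: "'k::field poly4 set \<Rightarrow> 'k poly4 \<Rightarrow> bool" where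
  "nonzerodivisor_mod J h \<longleftrightarrow>
     (\<forall>b \<in> carrier (quotient_ring J).
        residue J h \<otimes>\<^bsub>quotient_ring J\<^esub> b = \<zero>\<^bsub>quotient_ring J\<^esub>
          \<longrightarrow> b = \<zero>\<^bsub>quotient_ring J\<^esub>)"

text \<open>With $A = R/J$, the quotient of $R$ by the ideal below is $A/hA$.\<close>

definition add_generator :: "'k::field poly4 set \<Rightarrow> 'k poly4 \<Rightarrow> 'k poly4 set" where
  "add_generator J h = ideal_of (insert h J)"


section \<open>Points in projective space\<close>

definition proportional :: "((letter \<Rightarrow> 'k::field) \<times> (letter \<Rightarrow> 'k)) set" where
  "proportional = {(a, b). a \<noteq> (\<lambda>_. 0) \<and> b \<noteq> (\<lambda>_. 0) \<and> (\<exists>c. c \<noteq> 0 \<and> b = (\<lambda>v. c * a v))}"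

definition proj3 :: "(letter \<Rightarrow> 'k::field) set set" where
  "proj3 = (UNIV - {\<lambda>_. 0}) // proportional"

definition vanishes_at :: "'k::field poly4 \<Rightarrow> (letter \<Rightarrow> 'k) set \<Rightarrow> bool" where
  "vanishes_at f P \<longleftrightarrow> (\<forall>a\<in>P. evalp f a = 0)"

definition zero_locus :: "'k::field poly4 set \<Rightarrow> (letter \<Rightarrow> 'k) set set" where
  "zero_locus J = {P \<in> proj3. \<forall>f \<in> J \<inter> (\<Union>d. forms d). vanishes_at f P}"

text \<open>The saturated homogeneous ideal of a reduced set of points.\<close>

definition vanishing_ideal :: "(letter \<Rightarrow> 'k::field) set set \<Rightarrow> 'k poly4 set" where
  "vanishing_ideal S = ideal_of {f \<in> (\<Union>d. forms d). \<forall>P\<in>S. vanishes_at f P}"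

text \<open>An ideal defines a reduced set of points \<open>S\<close> if its projective zero locus is \<open>S\<close> and
  it is the saturated homogeneous ideal of \<open>S\<close>.\<close>

definition defines_points :: "'k::field poly4 set \<Rightarrow> (letter \<Rightarrow> 'k) set set \<Rightarrow> bool" where
  "defines_points J S \<longleftrightarrow> finite S \<and> zero_locus J = S \<and> vanishing_ideal S = J"

definition level_points :: "nat \<Rightarrow> (letter \<Rightarrow> 'k::field) set set \<Rightarrow> bool" where
  "level_points s S \<longleftrightarrow>
     (\<forall>h \<in> forms 1. nonzerodivisor_mod (vanishing_ideal S) h
        \<longrightarrow> level_of_type s (add_generator (vanishing_ideal S) h))"


section \<open>General linear forms\<close>

text \<open>The coordinates of a linear form with respect to the basis $w, x, y, z$ of $[R]_1$.\<close>

definition coords :: "'k::field poly4 \<Rightarrow> letter \<Rightarrow> 'k" where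
  "coords l v = Poly_Mapping.lookup l (Poly_Mapping.single v 1)"

text \<open>Elements of \<^typ>\<open>'k poly4\<close> here serve as polynomial functions on the
  four-dimensional space $[R]_1$; they need not be homogeneous.\<close>

definition zariski_open_forms :: "'k::field poly4 set \<Rightarrow> bool" where
  "zariski_open_forms U \<longleftrightarrow>
     (\<exists>F :: 'k poly4 set. U = forms 1 - {l \<in> forms 1. \<forall>f\<in>F. evalp f (coords l) = 0})"

definition for_general_linear_form :: "('k::field poly4 \<Rightarrow> bool) \<Rightarrow> bool" where
  "for_general_linear_form Q \<longleftrightarrow>
     (\<exists>U. zariski_open_forms U \<and> U \<noteq> {} \<and> (\<forall>l\<in>U. Q l))"


section \<open>The ideal of the statement\<close>

definition lifted_ideal :: "nat \<Rightarrow> 'k::field poly4 set" where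
  "lifted_ideal t = ideal_of
     {\<Prod>i=0..t. (indet Lx - of_nat i * indet Lw),
      \<Prod>i=0..t. (indet Ly - of_nat i * indet Lw),
      \<Prod>i=0..t. (indet Lz - of_nat i * indet Lw),
      indet Lx * indet Ly * indet Lz}"

end

theory Submission
  imports Defs
begin

text \<open>Let \<open>I\<close> be the ideal, \<open>l\<close> and \<open>L\<close> linear forms. Multiplication by \<open>L\<close> on \<open>R/(I, l)\<close> is injective in degrees below \<open>t\<close>,
  since up to degree \<open>t\<close> only the generators \<open>xyz\<close> and \<open>l\<close> matter and \<open>L\<close> is a nonzerodivisor modulo
  \<open>xyz\<close>. It is surjective from degree \<open>t\<close> on as soon as \<open>(I, l, L)\<close> contains all forms of degree
  \<open>t + 1\<close>; on the line \<open>l = L = 0\<close> such forms are determined modulo \<open>xyz\<close> by their values at the three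
  points where \<open>xyz\<close> vanishes, so that this amounts to the nonvanishing of a 3 by 3 determinant with
  zero diagonal, a polynomial in the coefficients of \<open>l\<close> that does not vanish at \<open>l = w - x - q y\<close> for
  suitable \<open>q\<close> and \<open>L\<close>. For \<open>l = w\<close> and \<open>L = x + y + z\<close> the determinant is \<open>1 + (-1)\<^sup>t\<^sup>+\<^sup>1\<close>.

  In the points case, the products of the \<open>x - iw\<close>, \<open>y - jw\<close>, \<open>z - kw\<close> form a Newton basis modulo \<open>I\<close>,
  triangular with respect to evaluation at the points. Hence \<open>I\<close> is the vanishing ideal and \<open>w\<close> is a
  nonzerodivisor, and the socle of any Artinian reduction is isomorphic to that of the monomial
  algebra \<open>R/(I, w)\<close>.\<close>

text \<open>The critical step is from degree t to t + 1. Modulo w both components have dimension 3t,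
  so maximal rank there means bijectivity; to refute it for l = w, a kernel element and an
  unreachable form are constructed for every L, whichever of its coefficients vanish. The diagonal
  of the determinant is zero because the generator in x has the factor x - 0w, which vanishes where
  the line meets x = 0, and likewise for y and z; two triple products remain. The form w - x - q y
  is chosen so that one of them contains the factor 1 - 1 = 0, while q, \<alpha> and \<beta> avoid
  the finitely many values at which a factor of the other is zero. This also works when the integers
  0, ..., t collide in K. For the points they must be distinct. Artinian reductions by an arbitrary
  h are not monomial, and the comparison with w avoids computing in them.\<close>

primrec letter_rank :: "letter \<Rightarrow> nat" where
  "letter_rank Lw = 0" | "letter_rank Lx = 1" | "letter_rank Ly = 2" | "letter_rank Lz = 3"

lemma letter_rank_inject: "letter_rank u = letter_rank v \<longleftrightarrow> u = v"
  by (cases u; cases v) simp_all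

text \<open>An arbitrary linear order on the letters makes the monomials linearly ordered, and this
  provides the type class instance of integral domain for polynomials, on which the cancellation of
  variables relies.\<close>

instantiation letter :: linorder
begin
definition "less_eq_letter u v \<longleftrightarrow> letter_rank u \<le> letter_rank v"
definition "less_letter u v \<longleftrightarrow> letter_rank u < letter_rank v"
instance
  by standard (auto simp: less_eq_letter_def less_letter_def letter_rank_inject)
end

lemma UNIV_letter: "(UNIV :: letter set) = {Lw, Lx, Ly, Lz}"
  by (auto intro: letter.exhaust)

lemma finite_letters [simp]: "finite (A :: letter set)"
proof -
  have "finite (UNIV :: letter set)"
    by (simp add: UNIV_letter)
  then show ?thesis
    by (rule finite_subset[OF subset_UNIV])
qed

section \<open>Ideals of the polynomial ring\<close>

lemma ideal_polyring_iff:
  "ideal J polyring \<longleftrightarrow>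
     (0::'k::field poly4) \<in> J \<and> (\<forall>a\<in>J. \<forall>b\<in>J. a + b \<in> J) \<and> (\<forall>r. \<forall>a\<in>J. r * a \<in> J)"
    (is "_ \<longleftrightarrow> ?R")
proof
  assume "ideal J polyring"
  then interpret ideal J "polyring :: 'k poly4 ring" .
  show ?R
    using zero_closed a_closed I_l_closed by (auto simp: class_simps)
next
  assume R: ?R
  have neg: "- a \<in> J" if "a \<in> J" for a
    using R that by (metis mult_minus1)
  have right: "a * r \<in> J" if "a \<in> J" for a r
    using R that by (metis mult.commute)
  show "ideal J polyring"
  proof (rule idealI)
    show "ring (polyring :: 'k poly4 ring)"
      by (rule cring_class.ring_axioms)
    show "subgroup J (add_monoid polyring)"
    proof (rule subgroup.intro)
      show "inv\<^bsub>add_monoid polyring\<^esub> a \<in> J" if "a \<in> J" for a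
        using neg[OF that] uminus_class[of a] unfolding a_inv_def by argo
    qed (use R in \<open>auto simp: class_simps\<close>)
  qed (use R right in \<open>auto simp: class_simps\<close>)
qed

lemma ideal_polyringI:
  assumes "(0::'k::field poly4) \<in> J" "\<And>a b. a \<in> J \<Longrightarrow> b \<in> J \<Longrightarrow> a + b \<in> J"
    and "\<And>r a. a \<in> J \<Longrightarrow> r * a \<in> J"
  shows "ideal J polyring"
  using assms by (auto simp: ideal_polyring_iff)

context
  fixes J :: "'k::field poly4 set"
  assumes J: "ideal J polyring"
begin

lemma ideal_zero: "0 \<in> J"
  using J by (auto simp: ideal_polyring_iff)

lemma ideal_add: "a \<in> J \<Longrightarrow> b \<in> J \<Longrightarrow> a + b \<in> J"
  using J by (auto simp: ideal_polyring_iff)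

lemma ideal_mult: "a \<in> J \<Longrightarrow> r * a \<in> J"
  using J by (auto simp: ideal_polyring_iff)

lemma ideal_mult_right: "a \<in> J \<Longrightarrow> a * r \<in> J"
  using ideal_mult[of a r] by (simp add: mult.commute)

lemma ideal_uminus: "a \<in> J \<Longrightarrow> - a \<in> J"
  using ideal_mult[of a "-1"] by simp

lemma ideal_diff: "a \<in> J \<Longrightarrow> b \<in> J \<Longrightarrow> a - b \<in> J"
  using ideal_add[of a "- b"] ideal_uminus[of b] by simp

lemma ideal_sum: "(\<And>i. i \<in> A \<Longrightarrow> f i \<in> J) \<Longrightarrow> sum f A \<in> J"
  by (induction A rule: infinite_finite_induct) (auto intro: ideal_zero ideal_add)

lemma ideal_diff_commute: "a - b \<in> J \<Longrightarrow> b - a \<in> J"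
  using ideal_uminus[of "a - b"] by simp

lemma ideal_diff_mem: "a - b \<in> J \<Longrightarrow> b \<in> J \<Longrightarrow> a \<in> J"
  using ideal_add[of "a - b" b] by simp

lemma ideal_power_diff: "a - b \<in> J \<Longrightarrow> a ^ n - b ^ n \<in> J"
  unfolding power_diff_sumr2 by (rule ideal_mult_right)

lemma ideal_mult_diff:
  assumes "a - b \<in> J" "c - d \<in> J"
  shows "a * c - b * d \<in> J"
proof -
  have "a * c - b * d = c * (a - b) + b * (c - d)"
    by (simp add: algebra_simps)
  then show ?thesis
    using assms by (simp add: ideal_add ideal_mult)
qed

end

lemma ideal_ideal_of: "ideal (ideal_of S) (polyring :: 'k::field poly4 ring)"
  by (rule ring.genideal_ideal[OF cring_class.ring_axioms]) (auto simp: class_simps)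

lemma subset_ideal_of: "S \<subseteq> ideal_of (S :: 'k::field poly4 set)"
  by (rule ring.genideal_self[OF cring_class.ring_axioms]) (auto simp: class_simps)

lemma mem_ideal_of: "s \<in> S \<Longrightarrow> s \<in> ideal_of (S :: 'k::field poly4 set)"
  using subset_ideal_of by blast

lemma ideal_of_least:
  "ideal J polyring \<Longrightarrow> S \<subseteq> J \<Longrightarrow> ideal_of (S :: 'k::field poly4 set) \<subseteq> J"
  by (rule ring.genideal_minimal[OF cring_class.ring_axioms])

lemma ideal_of_mono: "S \<subseteq> T \<Longrightarrow> ideal_of (S :: 'k::field poly4 set) \<subseteq> ideal_of T"
  using subset_ideal_of by (intro ideal_of_least ideal_ideal_of) blast

lemma ideal_add_generator: "ideal (add_generator J h) (polyring :: 'k::field poly4 ring)"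
  unfolding add_generator_def by (rule ideal_ideal_of)

lemma add_generator_ideal_of:
  "add_generator (ideal_of S) h = ideal_of (insert h (S :: 'k::field poly4 set))"
  unfolding add_generator_def
proof (intro equalityI ideal_of_least ideal_ideal_of)
  show "insert h (ideal_of S) \<subseteq> ideal_of (insert h S)"
    using mem_ideal_of[of h "insert h S"] ideal_of_mono[of S "insert h S"] by blast
  show "insert h S \<subseteq> ideal_of (insert h (ideal_of S))"
    using subset_ideal_of[of "insert h (ideal_of S)"] subset_ideal_of[of S] by blast
qed

lemma add_generator_iff:
  assumes J: "ideal J (polyring :: 'k::field poly4 ring)"
  shows "p \<in> add_generator J h \<longleftrightarrow> (\<exists>j\<in>J. \<exists>r. p = j + r * h)"
proof
  let ?A = "{p. \<exists>j\<in>J. \<exists>r. p = j + r * h}"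
  have I: "j + r * h \<in> ?A" if "j \<in> J" for j r
    using that by blast
  have "ideal ?A polyring"
  proof (rule ideal_polyringI)
    show "0 \<in> ?A"
      using I[OF ideal_zero[OF J], of 0] by simp
  next
    fix a b
    assume "a \<in> ?A" "b \<in> ?A"
    then obtain i r j s where *: "i \<in> J" "j \<in> J" "a = i + r * h" "b = j + s * h"
      by blast
    then have "a + b = (i + j) + (r + s) * h"
      by (simp add: algebra_simps)
    then show "a + b \<in> ?A"
      using I[OF ideal_add[OF J *(1,2)], of "r + s"] by argo
  next
    fix q a
    assume "a \<in> ?A"
    then obtain i r where *: "i \<in> J" "a = i + r * h"
      by blast
    then have "q * a = q * i + (q * r) * h"
      by (simp add: algebra_simps)
    then show "q * a \<in> ?A"
      using I[OF ideal_mult[OF J *(1), of q], of "q * r"] by argo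
  qed
  moreover have "insert h J \<subseteq> ?A"
  proof
    fix p
    assume "p \<in> insert h J"
    then show "p \<in> ?A"
      using I[OF ideal_zero[OF J], of 1] I[of p 0] by auto
  qed
  ultimately have "add_generator J h \<subseteq> ?A"
    unfolding add_generator_def by (rule ideal_of_least)
  then show "p \<in> add_generator J h \<Longrightarrow> \<exists>j\<in>J. \<exists>r. p = j + r * h"
    by blast
next
  assume "\<exists>j\<in>J. \<exists>r. p = j + r * h"
  then show "p \<in> add_generator J h"
    using ideal_add[OF ideal_ideal_of] ideal_mult[OF ideal_ideal_of]
      mem_ideal_of[of _ "insert h J"] unfolding add_generator_def
    by (metis insertCI)
qed

lemma subset_add_generator: "J \<subseteq> add_generator J (h :: 'k::field poly4)"
  and mem_add_generator: "h \<in> add_generator J h"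
  unfolding add_generator_def using subset_ideal_of[of "insert h J"] by auto

section \<open>Monomials and forms\<close>

lemma const_hom [simp]:
  "const 0 = (0 :: 'k::field poly4)" "const 1 = (1 :: 'k::field poly4)"
  by (simp_all add: const_def)

lemma const_add: "const (a + b) = (const a + const b :: 'k::field poly4)"
  and const_diff: "const (a - b) = (const a - const b :: 'k::field poly4)"
  and const_uminus: "const (- a) = (- const a :: 'k::field poly4)"
  and const_mult: "const (a * b) = (const a * const b :: 'k::field poly4)"
  by (simp_all add: const_def single_add single_diff single_uminus mult_single)

lemma const_of_nat: "const (of_nat n) = (of_nat n :: 'k::field poly4)"
  by (induction n) (simp_all add: const_add)

lemma const_power: "const (a ^ n) = (const a ^ n :: 'k::field poly4)"
  by (induction n) (simp_all add: const_mult)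

lemma const_prod: "const (prod f A) = (\<Prod>i\<in>A. const (f i) :: 'k::field poly4)"
  by (induction A rule: infinite_finite_induct) (simp_all add: const_mult)

lemma const_inverse_mult: "c \<noteq> 0 \<Longrightarrow> const (inverse c) * (const c * p) = (p :: 'k::field poly4)"
  using const_mult[of "inverse c" c] by (simp add: mult.assoc[symmetric])

lemma lookup_const_mult:
  "Poly_Mapping.lookup (const c * p :: 'k::field poly4) m = c * Poly_Mapping.lookup p m"
proof -
  have "const c * p = Poly_Mapping.map ((*) c) p"
    unfolding const_def by (rule mult_map_scale_conv_mult[symmetric])
  then show ?thesis
    by (simp add: Poly_Mapping.map.rep_eq when_def)
qed

lemma ideal_const_cancel:
  assumes "ideal J polyring" "c \<noteq> 0" "const c * p \<in> J"
  shows "(p :: 'k::field poly4) \<in> J"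
  using ideal_mult[OF assms(1,3), of "const (inverse c)"] const_inverse_mult[OF assms(2)] by simp

lemma poly_sum_single:
  "p = (\<Sum>m\<in>Poly_Mapping.keys p. Poly_Mapping.single m (Poly_Mapping.lookup p m))"
  by (rule poly_mapping_eqI)
     (auto simp: lookup_sum lookup_single when_def in_keys_iff if_distrib cong: if_cong)

lemma poly_single_induct [case_names zero single add]:
  assumes "P 0" "\<And>m c. P (Poly_Mapping.single m c)" "\<And>p q. P p \<Longrightarrow> P q \<Longrightarrow> P (p + q)"
  shows "P (p :: 'a \<Rightarrow>\<^sub>0 'b::comm_monoid_add)"
proof -
  have "P (\<Sum>m\<in>A. Poly_Mapping.single m (Poly_Mapping.lookup p m))" for A
    by (induction A rule: infinite_finite_induct) (simp_all add: assms)
  from this[of "Poly_Mapping.keys p"] show ?thesis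
    using poly_sum_single[of p] by simp
qed

lemma mdeg_UNIV: "mdeg m = (\<Sum>v\<in>UNIV. Poly_Mapping.lookup m v)"
  unfolding mdeg_def by (rule sum.mono_neutral_left) (auto simp: in_keys_iff)

lemma mdeg_add: "mdeg (m + n) = mdeg m + mdeg n"
  by (simp add: mdeg_UNIV lookup_add sum.distrib)

lemma mdeg_zero [simp]: "mdeg 0 = 0"
  by (simp add: mdeg_def)

lemma mdeg_single [simp]: "mdeg (Poly_Mapping.single v n) = n"
  by (simp add: mdeg_UNIV lookup_single when_def)

lemma mdeg_eq_0_iff: "mdeg m = 0 \<longleftrightarrow> m = 0"
  by (auto simp: mdeg_UNIV intro: poly_mapping_eqI)

lemma forms_iff:
  "p \<in> forms d \<longleftrightarrow> (\<forall>m. Poly_Mapping.lookup p m \<noteq> 0 \<longrightarrow> mdeg m = d)"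
  by (auto simp: forms_def in_keys_iff)

lemma forms_zero [simp]: "0 \<in> forms d"
  by (simp add: forms_iff)

lemma forms_add: "p \<in> forms d \<Longrightarrow> q \<in> forms d \<Longrightarrow> p + q \<in> forms d"
  by (auto simp: forms_iff lookup_add) (metis add.right_neutral)

lemma forms_uminus: "p \<in> forms d \<Longrightarrow> - p \<in> forms d"
  by (auto simp: forms_iff)

lemma forms_diff: "p \<in> forms d \<Longrightarrow> q \<in> forms d \<Longrightarrow> p - q \<in> forms d"
  using forms_add[of p d "- q"] forms_uminus by force

lemma forms_sum: "(\<And>i. i \<in> A \<Longrightarrow> f i \<in> forms d) \<Longrightarrow> sum f A \<in> forms d"
  by (induction A rule: infinite_finite_induct) (auto intro: forms_add)

lemma forms_mult: "p \<in> forms d \<Longrightarrow> q \<in> forms e \<Longrightarrow> p * q \<in> forms (d + e)"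
  unfolding forms_def using keys_mult[of p q] by (fastforce simp: mdeg_add)

lemma forms_const [simp]: "const c \<in> forms 0"
  by (auto simp: forms_def const_def)

lemma forms_const_mult: "p \<in> forms d \<Longrightarrow> const c * p \<in> forms d"
  using forms_mult[OF forms_const] by fastforce

lemma forms_of_nat_mult: "p \<in> forms d \<Longrightarrow> of_nat n * p \<in> forms d"
  using forms_const_mult[of p d "of_nat n"] by (simp add: const_of_nat)

lemma forms_indet [simp]: "indet v \<in> forms 1"
  by (auto simp: forms_def indet_def)

lemma forms_indet_mult: "p \<in> forms d \<Longrightarrow> indet v * p \<in> forms (Suc d)"
  using forms_mult[OF forms_indet] by fastforce

lemma forms_power: "p \<in> forms d \<Longrightarrow> p ^ n \<in> forms (n * d)"
  by (induction n) (use forms_const[of 1] in \<open>auto intro: forms_mult\<close>)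

lemma forms_prod:
  "(\<And>i. i \<in> A \<Longrightarrow> f i \<in> forms (g i)) \<Longrightarrow> prod f A \<in> forms (sum g A)"
  by (induction A rule: infinite_finite_induct) (use forms_const[of 1] in \<open>auto intro: forms_mult\<close>)

lemma indet_mult_single:
  "indet v * Poly_Mapping.single m c = Poly_Mapping.single (Poly_Mapping.single v 1 + m) (c :: 'k::field)"
  by (simp add: indet_def mult_single)

lemma indet_power: "indet v ^ n = Poly_Mapping.single (Poly_Mapping.single v n) (1 :: 'k::field)"
proof (induction n)
  case (Suc n)
  then show ?case
    by (simp add: indet_def mult_single single_add[symmetric])
qed simp

lemma single_eq_indet_power_mult:
  assumes "n \<le> Poly_Mapping.lookup m v"
  shows "Poly_Mapping.single m (c :: 'k::field) =
    indet v ^ n * Poly_Mapping.single (m - Poly_Mapping.single v n) c"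
proof -
  have "m = Poly_Mapping.single v n + (m - Poly_Mapping.single v n)"
    by (rule poly_mapping_eqI) (use assms in \<open>auto simp: lookup_add lookup_minus lookup_single when_def\<close>)
  then show ?thesis
    by (simp add: indet_power mult_single)
qed

lemma monomial_induct [case_names zero step]:
  assumes "P 0" "\<And>v m. P m \<Longrightarrow> P (Poly_Mapping.single v 1 + m)"
  shows "P (m :: letter \<Rightarrow>\<^sub>0 nat)"
proof (induction "mdeg m" arbitrary: m)
  case 0
  then show ?case
    using assms(1) mdeg_eq_0_iff by metis
next
  case (Suc d)
  then have "m \<noteq> 0"
    by auto
  then obtain v where v: "Poly_Mapping.lookup m v \<noteq> 0"
    by (metis lookup_zero poly_mapping_eqI)
  have m: "m = Poly_Mapping.single v 1 + (m - Poly_Mapping.single v 1)"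
    by (rule poly_mapping_eqI) (use v in \<open>auto simp: lookup_add lookup_minus lookup_single when_def\<close>)
  then have "mdeg m = Suc (mdeg (m - Poly_Mapping.single v 1))"
    by (metis mdeg_add mdeg_single plus_1_eq_Suc)
  then show ?case
    using Suc assms(2) m by (metis Suc_inject)
qed

lemma lookup_indet_mult:
  "Poly_Mapping.lookup (indet v * f) (Poly_Mapping.single v 1 + m) = Poly_Mapping.lookup (f :: 'k::field poly4) m"
proof (induction f rule: poly_single_induct)
  case (single n c)
  show ?case
    by (simp add: indet_mult_single lookup_single when_def)
qed (simp_all add: algebra_simps lookup_add)

lemma poly_induct_ring [case_names const indet add mult]:
  assumes "\<And>c. P (const c)" "\<And>v. P (indet v)"
    and "\<And>p q. P p \<Longrightarrow> P q \<Longrightarrow> P (p + q)" "\<And>p q. P p \<Longrightarrow> P q \<Longrightarrow> P (p * q)"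
  shows "P (p :: 'k::field poly4)"
proof (induction p rule: poly_single_induct)
  case zero
  then show ?case
    using assms(1)[of 0] by simp
next
  case (single m c)
  show ?case
  proof (induction m rule: monomial_induct)
    case zero
    then show ?case
      using assms(1)[of c] by (simp add: const_def)
  next
    case (step v m)
    then show ?case
      using assms(4)[OF assms(2)[of v] step] by (simp add: indet_mult_single)
  qed
qed (use assms in auto)

text \<open>The degree is an argument of \<open>P\<close> because the step raises it. The step also
  supplies that \<open>p\<close> is a form, so that a claim valid only from some degree on can treat
  its first degree separately.\<close>

lemma forms_induct [consumes 1, case_names zero add const step]:
  assumes p: "p \<in> forms d"
    and zero: "\<And>d. P d 0"
    and add: "\<And>d p q. P d p \<Longrightarrow> P d q \<Longrightarrow> P d (p + q)"
    and const: "\<And>c. P 0 (const c)"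
    and step: "\<And>d v p. p \<in> forms d \<Longrightarrow> P d p \<Longrightarrow> P (Suc d) (indet v * p)"
  shows "P d (p :: 'k::field poly4)"
proof -
  have *: "P (mdeg m) (Poly_Mapping.single m c)" for m c
  proof (induction m rule: monomial_induct)
    case zero
    then show ?case
      using const[of c] by (simp add: const_def)
  next
    case (step v m)
    then show ?case
      using assms(5)[of "Poly_Mapping.single m c" "mdeg m" v]
      by (simp add: indet_mult_single mdeg_add forms_def)
  qed
  have "P d (\<Sum>m\<in>A. Poly_Mapping.single m (Poly_Mapping.lookup p m))"
    if "\<forall>m\<in>A. mdeg m = d" for A
    using that * by (induction A rule: infinite_finite_induct) (auto intro: zero add)
  from this[of "Poly_Mapping.keys p"] show ?thesis
    using poly_sum_single[of p] p by (simp add: forms_def)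
qed

lemma forms_1_expand:
  assumes "l \<in> forms 1"
  shows "l = (\<Sum>v\<in>UNIV. const (coords l v) * indet v :: 'k::field poly4)"
proof (rule poly_mapping_eqI)
  fix m
  have eq: "Poly_Mapping.lookup (\<Sum>v\<in>UNIV. const (coords l v) * indet v) m =
      (\<Sum>v\<in>UNIV. coords l v when m = Poly_Mapping.single v 1)"
    by (simp add: lookup_sum lookup_const_mult indet_def lookup_single when_def eq_commute
        if_distrib cong: if_cong)
  show "Poly_Mapping.lookup l m =
      Poly_Mapping.lookup (\<Sum>v\<in>UNIV. const (coords l v) * indet v) m"
  proof (cases "\<exists>v. m = Poly_Mapping.single v 1")
    case True
    then obtain u where "m = Poly_Mapping.single u (1::nat)"
      by blast
    moreover have "Poly_Mapping.single u (1::nat) = Poly_Mapping.single v 1 \<longleftrightarrow> v = u" for v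
      by (metis lookup_single_eq lookup_single_not_eq zero_neq_one)
    ultimately show ?thesis
      unfolding eq by (simp add: when_def coords_def)
  next
    case False
    have "mdeg m \<noteq> 1"
    proof
      assume "mdeg m = 1"
      moreover have "mdeg m = 1 \<longrightarrow> (\<exists>v. m = Poly_Mapping.single v 1)" for m
        by (induction m rule: monomial_induct) (auto simp: mdeg_add mdeg_eq_0_iff)
      ultimately show False
        using False by blast
    qed
    then have "Poly_Mapping.lookup l m = 0"
      using assms by (auto simp: forms_iff)
    then show ?thesis
      unfolding eq using False by (auto simp: when_def intro!: sum.neutral[symmetric])
  qed
qed

section \<open>Substitution homomorphisms\<close>

text \<open>One construction for three targets: evaluation at a point, substitution inside the
  polynomial ring, and restriction to a line with values in univariate polynomials.\<close>

locale coeff_hom =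
  fixes \<phi> :: "'k::field \<Rightarrow> 'r::comm_ring_1"
  assumes hom_one: "\<phi> 1 = 1"
    and hom_add: "\<phi> (a + b) = \<phi> a + \<phi> b"
    and hom_mult: "\<phi> (a * b) = \<phi> a * \<phi> b"
begin

definition insertion :: "(letter \<Rightarrow> 'r) \<Rightarrow> 'k poly4 \<Rightarrow> 'r" where
  "insertion g p = (\<Sum>m\<in>Poly_Mapping.keys p.
     \<phi> (Poly_Mapping.lookup p m) * (\<Prod>v\<in>UNIV. g v ^ Poly_Mapping.lookup m v))"

lemma hom_zero: "\<phi> 0 = 0"
  using hom_add[of 0 0] by simp

lemma insertion_superset:
  assumes "finite A" "Poly_Mapping.keys p \<subseteq> A"
  shows "insertion g p =
    (\<Sum>m\<in>A. \<phi> (Poly_Mapping.lookup p m) * (\<Prod>v\<in>UNIV. g v ^ Poly_Mapping.lookup m v))"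
  unfolding insertion_def
  by (rule sum.mono_neutral_left) (use assms in \<open>auto simp: in_keys_iff hom_zero\<close>)

lemma insertion_zero [simp]: "insertion g 0 = 0"
  by (simp add: insertion_def)

lemma insertion_add [simp]: "insertion g (p + q) = insertion g p + insertion g q"
proof -
  let ?A = "Poly_Mapping.keys p \<union> Poly_Mapping.keys q"
  have "Poly_Mapping.keys (p + q) \<subseteq> ?A"
    by (rule keys_add)
  then show ?thesis
    using insertion_superset[of ?A p g] insertion_superset[of ?A q g]
      insertion_superset[of ?A "p + q" g]
    by (simp add: lookup_add hom_add algebra_simps sum.distrib)
qed

lemma insertion_single:
  "insertion g (Poly_Mapping.single m c) = \<phi> c * (\<Prod>v\<in>UNIV. g v ^ Poly_Mapping.lookup m v)"
  using insertion_superset[of "{m}" "Poly_Mapping.single m c"] by simp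

lemma insertion_mult [simp]: "insertion g (p * q) = insertion g p * insertion g q"
proof (induction p rule: poly_single_induct)
  case (single m c)
  show ?case
    by (induction q rule: poly_single_induct)
       (simp_all add: mult_single insertion_single hom_mult lookup_add power_add prod.distrib
         algebra_simps)
qed (simp_all add: algebra_simps)

lemma insertion_const [simp]: "insertion g (const c) = \<phi> c"
  by (simp add: const_def insertion_single)

lemma insertion_one [simp]: "insertion g 1 = 1"
  using insertion_const[of g 1] by (simp add: hom_one)

lemma insertion_indet [simp]: "insertion g (indet v) = g v"
proof -
  have "(\<Prod>u\<in>UNIV. g u ^ Poly_Mapping.lookup (Poly_Mapping.single v 1) u) =
      (\<Prod>u\<in>UNIV. if u = v then g u else 1)"
    by (rule prod.cong) (auto simp: lookup_single when_def)
  then show ?thesis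
    by (simp add: indet_def insertion_single hom_one)
qed

lemma insertion_uminus [simp]: "insertion g (- p) = - insertion g p"
  using insertion_add[of g p "- p"] by (simp add: eq_neg_iff_add_eq_0 add.commute)

lemma insertion_diff [simp]: "insertion g (p - q) = insertion g p - insertion g q"
  using insertion_add[of g p "- q"] by simp

lemma insertion_power [simp]: "insertion g (p ^ n) = insertion g p ^ n"
  by (induction n) simp_all

lemma insertion_of_nat [simp]: "insertion g (of_nat n) = of_nat n"
  by (induction n) simp_all

lemma insertion_sum [simp]: "insertion g (sum f A) = (\<Sum>i\<in>A. insertion g (f i))"
  by (induction A rule: infinite_finite_induct) simp_all

lemma insertion_prod [simp]: "insertion g (prod f A) = (\<Prod>i\<in>A. insertion g (f i))"
  by (induction A rule: infinite_finite_induct) simp_all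

end

interpretation eval: coeff_hom "\<lambda>c. c :: 'k::field"
  rewrites "eval.insertion a p = evalp p a"
proof -
  show *: "coeff_hom (\<lambda>c. c :: 'k)"
    by standard simp_all
  have "(\<Prod>v\<in>Poly_Mapping.keys m. a v ^ Poly_Mapping.lookup m v) =
      (\<Prod>v\<in>UNIV. a v ^ Poly_Mapping.lookup m v)" for m and a :: "letter \<Rightarrow> 'k"
    by (rule prod.mono_neutral_left) (auto simp: in_keys_iff)
  then show "coeff_hom.insertion (\<lambda>c. c) a p = evalp p a"
    by (simp add: coeff_hom.insertion_def[OF *] evalp_def)
qed

interpretation subst: coeff_hom "const :: 'k::field \<Rightarrow> 'k poly4"
  by standard (simp_all add: const_add const_mult)

text \<open>Congruence modulo an ideal respects sums and products, so it suffices to have it on the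
  variables. With the multiples of v - i w as \<open>J\<close> this is the factor theorem; with l in
  \<open>J\<close> it eliminates w.\<close>

lemma subst_congruent:
  assumes "ideal J polyring" "\<And>v. indet v - g v \<in> J"
  shows "p - subst.insertion g p \<in> (J :: 'k::field poly4 set)"
proof (induction p rule: poly_induct_ring)
  case (add p q)
  then show ?case
    using ideal_add[OF assms(1) add] by (simp add: algebra_simps)
next
  case (mult p q)
  then show ?case
    using ideal_mult_diff[OF assms(1) mult] by simp
qed (use assms ideal_zero in auto)

lemma evalp_ideal_of:
  assumes "p \<in> ideal_of S" "\<And>s. s \<in> S \<Longrightarrow> evalp s a = (0::'k::field)"
  shows "evalp p a = 0"
proof -
  have "ideal {p. evalp p a = 0} polyring"
    by (rule ideal_polyringI) auto
  then show ?thesis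
    using ideal_of_least[of "{p. evalp p a = 0}" S] assms by blast
qed

section \<open>Homogeneous components\<close>

definition hcomp :: "nat \<Rightarrow> 'k::field poly4 \<Rightarrow> 'k poly4" where
  "hcomp d p = Poly_Mapping.mapp (\<lambda>m c. c when mdeg m = d) p"

lemma lookup_hcomp: "Poly_Mapping.lookup (hcomp d p) m = (Poly_Mapping.lookup p m when mdeg m = d)"
  by (simp add: hcomp_def lookup_mapp when_def in_keys_iff)

lemma hcomp_zero [simp]: "hcomp d 0 = 0"
  by (rule poly_mapping_eqI) (simp add: lookup_hcomp)

lemma hcomp_add: "hcomp d (p + q) = hcomp d p + hcomp d q"
  by (rule poly_mapping_eqI) (simp add: lookup_hcomp lookup_add when_def)

lemma hcomp_diff: "hcomp d (p - q) = hcomp d p - hcomp d q"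
  by (rule poly_mapping_eqI) (simp add: lookup_hcomp lookup_minus when_def)

lemma hcomp_in_forms: "hcomp d p \<in> forms d"
  by (auto simp: forms_iff lookup_hcomp)

lemma hcomp_form: "p \<in> forms e \<Longrightarrow> hcomp d p = (if d = e then p else 0)"
  by (rule poly_mapping_eqI) (auto simp: forms_iff lookup_hcomp when_def)

lemma poly_forms_induct [case_names form add]:
  assumes "\<And>d p. p \<in> forms d \<Longrightarrow> P p" "\<And>p q. P p \<Longrightarrow> P q \<Longrightarrow> P (p + q)"
  shows "P (p :: 'k::field poly4)"
proof (induction p rule: poly_single_induct)
  case (single m c)
  then show ?case
    using assms(1)[of "Poly_Mapping.single m c" "mdeg m"] by (simp add: forms_def)
qed (use assms(1)[of 0] assms(2) in auto)

lemma hcomp_form_mult: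
  assumes q: "q \<in> forms e"
  shows "hcomp d (q * p) = (if e \<le> d then q * hcomp (d - e) p else 0)"
proof (induction p rule: poly_forms_induct)
  case (form n p)
  then show ?case
    using hcomp_form[OF forms_mult[OF q form], of d] hcomp_form[OF form, of "d - e"] by auto
qed (simp add: algebra_simps hcomp_add)

lemma mem_ideal_if_hcomps:
  assumes "ideal J polyring" "\<And>d. hcomp d p \<in> J"
  shows "(p :: 'k::field poly4) \<in> J"
proof -
  obtain N where N: "\<forall>n\<in>mdeg ` Poly_Mapping.keys p. n < N"
    using finite_nat_set_iff_bounded[of "mdeg ` Poly_Mapping.keys p"] by auto
  have "p = (\<Sum>d<N. hcomp d p)"
    by (rule poly_mapping_eqI)
       (use N in \<open>auto simp: lookup_sum lookup_hcomp when_def in_keys_iff\<close>)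
  then show ?thesis
    using assms ideal_sum by metis
qed

text \<open>In degree \<open>d\<close> the product \<open>r * a\<close> involves only components of
  \<open>a\<close> of degree at most \<open>d\<close>, hence the downward closed \<open>D\<close>.
  With \<open>D = UNIV\<close> this gives homogeneity; with \<open>D = {..t}\<close> it makes
  generators of degree t + 1 invisible.\<close>

lemma hcomp_ideal_of:
  assumes Q: "ideal Q polyring" and D: "\<And>d e. d \<in> D \<Longrightarrow> e \<le> d \<Longrightarrow> e \<in> D"
    and S: "\<And>s d. s \<in> S \<Longrightarrow> d \<in> D \<Longrightarrow> hcomp d s \<in> Q"
    and p: "p \<in> ideal_of S" "d \<in> D"
  shows "hcomp d p \<in> (Q :: 'k::field poly4 set)"
proof -
  let ?A = "{p. \<forall>d\<in>D. hcomp d p \<in> Q}"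
  have "ideal ?A polyring"
  proof (rule ideal_polyringI)
    fix r a
    assume "a \<in> ?A"
    then show "r * a \<in> ?A"
    proof (induction r rule: poly_forms_induct)
      case (form e r)
      then show ?case
        using D by (auto simp: hcomp_form_mult ideal_zero[OF Q] intro: ideal_mult[OF Q])
    qed (auto simp: algebra_simps hcomp_add intro: ideal_add[OF Q])
  qed (auto simp: hcomp_add ideal_zero[OF Q] intro: ideal_add[OF Q])
  then have "ideal_of S \<subseteq> ?A"
    by (rule ideal_of_least) (use S in auto)
  then show ?thesis
    using p by blast
qed

definition homogeneous_ideal :: "'k::field poly4 set \<Rightarrow> bool" where
  "homogeneous_ideal J \<longleftrightarrow> ideal J polyring \<and> (\<forall>p\<in>J. \<forall>d. hcomp d p \<in> J)"

lemma homogeneous_ideal_of: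
  assumes "S \<subseteq> (\<Union>d. forms d)"
  shows "homogeneous_ideal (ideal_of (S :: 'k::field poly4 set))"
  unfolding homogeneous_ideal_def
proof (intro conjI ideal_ideal_of ballI allI)
  fix p d
  assume p: "p \<in> ideal_of S"
  show "hcomp d p \<in> ideal_of S"
    by (rule hcomp_ideal_of[OF ideal_ideal_of _ _ p, where D = UNIV])
       (use assms in \<open>auto simp: hcomp_form mem_ideal_of ideal_zero[OF ideal_ideal_of] subset_iff\<close>)
qed

section \<open>Graded quotients\<close>

context
  fixes J :: "'k::field poly4 set"
  assumes J: "ideal J polyring"
begin

lemma residue_eq_iff: "residue J p = residue J q \<longleftrightarrow> p - q \<in> J"
proof -
  have eq: "residue J p = (\<lambda>j. j + p) ` J" for p
    by (auto simp: a_r_coset_def r_coset_def class_simps)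
  show ?thesis
  proof
    assume "residue J p = residue J q"
    then have "0 + p \<in> (\<lambda>j. j + q) ` J"
      unfolding eq using ideal_zero[OF J] by blast
    then show "p - q \<in> J"
      by auto
  next
    have *: "residue J p \<subseteq> residue J q" if "p - q \<in> J" for p q
    proof
      fix r
      assume "r \<in> residue J p"
      then obtain j where "j \<in> J" "r = j + p"
        unfolding eq by blast
      then have "r = (j + (p - q)) + q" "j + (p - q) \<in> J"
        using ideal_add[OF J _ that] by auto
      then show "r \<in> residue J q"
        unfolding eq by blast
    qed
    assume "p - q \<in> J"
    then show "residue J p = residue J q"
      using *[of p q] *[of q p] ideal_diff_commute[OF J] by blast
  qed
qed

lemma carrier_quotient_ring: "carrier (quotient_ring J) = range (residue J)"
  by (auto simp: FactRing_def A_RCOSETS_def RCOSETS_def a_r_coset_def class_simps)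

lemma quotient_mult:
  "residue J p \<otimes>\<^bsub>quotient_ring J\<^esub> residue J q = residue J (p * q)"
  using ideal.rcoset_mult_add[OF J, of p q] by (simp add: FactRing_def class_simps)

lemma quotient_add:
  "residue J p \<oplus>\<^bsub>quotient_ring J\<^esub> residue J q = residue J (p + q)"
  using ideal.a_rcos_sum[OF J, of p q] by (simp add: FactRing_def class_simps)

lemma quotient_zero: "\<zero>\<^bsub>quotient_ring J\<^esub> = residue J 0"
  by (auto simp: FactRing_def a_r_coset_def r_coset_def class_simps)

lemma ring_quotient_ring: "ring (quotient_ring J)"
  by (rule ideal.quotient_is_ring[OF J])

lemma weak_Lefschetz_element_iff:
  assumes "l \<in> forms 1"
  shows "weak_Lefschetz_element J (residue J l) \<longleftrightarrow>
    (\<forall>d. (\<forall>f\<in>forms d. l * f \<in> J \<longrightarrow> f \<in> J) \<or>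
         (\<forall>g\<in>forms (d + 1). \<exists>f\<in>forms d. g - l * f \<in> J))"
proof -
  let ?m = "\<lambda>b. residue J l \<otimes>\<^bsub>quotient_ring J\<^esub> b"
  have inj: "inj_on ?m (component J d) \<longleftrightarrow> (\<forall>f\<in>forms d. l * f \<in> J \<longrightarrow> f \<in> J)" for d
  proof
    assume inj: "inj_on ?m (component J d)"
    show "\<forall>f\<in>forms d. l * f \<in> J \<longrightarrow> f \<in> J"
    proof (intro ballI impI)
      fix f
      assume f: "f \<in> forms d" "l * f \<in> J"
      then have "?m (residue J f) = ?m (residue J 0)"
        by (simp add: quotient_mult residue_eq_iff)
      moreover have "residue J f \<in> component J d" "residue J 0 \<in> component J d"
        using f forms_zero unfolding component_def by blast+
      ultimately have "residue J f = residue J 0"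
        using inj by (meson inj_onD)
      then show "f \<in> J"
        by (simp add: residue_eq_iff)
    qed
  next
    assume *: "\<forall>f\<in>forms d. l * f \<in> J \<longrightarrow> f \<in> J"
    show "inj_on ?m (component J d)"
      unfolding component_def
    proof (rule inj_onI, elim imageE)
      fix a b f g
      assume "?m a = ?m b" "a = residue J f" "f \<in> forms d" "b = residue J g" "g \<in> forms d"
      then show "a = b"
        using * forms_diff[of f d g]
        by (simp add: quotient_mult residue_eq_iff right_diff_distrib[symmetric])
    qed
  qed
  have surj: "?m ` component J d = component J (d + 1) \<longleftrightarrow>
      (\<forall>g\<in>forms (d + 1). \<exists>f\<in>forms d. g - l * f \<in> J)" for d
  proof -
    have "l * f \<in> forms (d + 1)" if "f \<in> forms d" for f
      using forms_mult[OF assms that] by simp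
    then have "?m ` component J d \<subseteq> component J (d + 1)"
      unfolding component_def by (auto simp: quotient_mult)
    then have "?m ` component J d = component J (d + 1) \<longleftrightarrow>
        component J (d + 1) \<subseteq> ?m ` component J d"
      by blast
    also have "\<dots> \<longleftrightarrow> (\<forall>g\<in>forms (d + 1). \<exists>f\<in>forms d. residue J g = residue J (l * f))"
      unfolding component_def by (auto simp: image_subset_iff image_iff quotient_mult)
    finally show ?thesis
      by (simp add: residue_eq_iff)
  qed
  have "residue J l \<in> component J 1"
    using assms unfolding component_def by blast
  then show ?thesis
    unfolding weak_Lefschetz_element_def inj surj by blast
qed

lemma weak_Lefschetz_iff:
  "weak_Lefschetz J \<longleftrightarrow> artinian_ring (quotient_ring J) \<and>
    (\<exists>l\<in>forms 1. \<forall>d. (\<forall>f\<in>forms d. l * f \<in> J \<longrightarrow> f \<in> J) \<or>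
         (\<forall>g\<in>forms (d + 1). \<exists>f\<in>forms d. g - l * f \<in> J))"
proof -
  have "(\<exists>l. weak_Lefschetz_element J l) \<longleftrightarrow>
      (\<exists>l\<in>forms 1. weak_Lefschetz_element J (residue J l))"
    unfolding weak_Lefschetz_element_def component_def by blast
  then show ?thesis
    unfolding weak_Lefschetz_def by (simp add: weak_Lefschetz_element_iff cong: bex_cong)
qed

lemma nonzerodivisor_mod_iff: "nonzerodivisor_mod J h \<longleftrightarrow> (\<forall>f. h * f \<in> J \<longrightarrow> f \<in> J)"
  unfolding nonzerodivisor_mod_def carrier_quotient_ring quotient_zero
  by (simp add: quotient_mult residue_eq_iff)

text \<open>The polynomials that multiply \<open>f\<close> into \<open>J\<close> form an ideal, so
  annihilation by the four variables gives annihilation by the whole maximal ideal.\<close>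

lemma socle_eq: "socle J = residue J ` {f. \<forall>v. indet v * f \<in> J}"
proof -
  have "(\<forall>p\<in>ideal_of (range indet). p * f \<in> J) \<longleftrightarrow> (\<forall>v. indet v * f \<in> J)" for f
  proof
    assume *: "\<forall>v. indet v * f \<in> J"
    have "ideal {p. p * f \<in> J} polyring"
      by (rule ideal_polyringI)
         (auto simp: ideal_zero[OF J] distrib_right mult.assoc intro: ideal_add[OF J] ideal_mult[OF J])
    then have "ideal_of (range indet) \<subseteq> {p. p * f \<in> J}"
      by (rule ideal_of_least) (use * in auto)
    then show "\<forall>p\<in>ideal_of (range indet). p * f \<in> J"
      by blast
  qed (auto intro: mem_ideal_of)
  moreover have "residue J p \<otimes>\<^bsub>quotient_ring J\<^esub> residue J f = residue J 0 \<longleftrightarrow> p * f \<in> J" for p f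
    by (simp add: quotient_mult residue_eq_iff)
  ultimately show ?thesis
    unfolding socle_def carrier_quotient_ring quotient_zero by blast
qed

lemma line_extension_quotient:
  "ring.line_extension (quotient_ring J) (residue J ` range const) (residue J f) (residue J ` V) =
    residue J ` {const c * f + g | c g. g \<in> V}"
proof (rule Set.set_eqI)
  fix u
  have "u \<in> ring.line_extension (quotient_ring J) (residue J ` range const) (residue J f) (residue J ` V)
      \<longleftrightarrow> (\<exists>c. \<exists>g\<in>V. u = residue J (const c * f + g))"
    unfolding ring.line_extension_mem_iff[OF ring_quotient_ring]
    by (auto simp: quotient_mult quotient_add)
  then show "u \<in> ring.line_extension (quotient_ring J) (residue J ` range const) (residue J f) (residue J ` V)
      \<longleftrightarrow> u \<in> residue J ` {const c * f + g | c g. g \<in> V}"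
    by blast
qed

text \<open>Dimension is defined by successive line extensions of the zero space. The three
  extensions are computed from the inside out, \<open>f3\<close> first, and \<open>indep\<close>
  shows that each new vector lies outside the previous extension.\<close>

lemma level_of_type_3I:
  assumes art: "artinian_ring (quotient_ring J)"
    and forms: "f1 \<in> forms d" "f2 \<in> forms d" "f3 \<in> forms d"
    and ann: "\<And>v. indet v * f1 \<in> J" "\<And>v. indet v * f2 \<in> J" "\<And>v. indet v * f3 \<in> J"
    and span: "\<And>f. (\<And>v. indet v * f \<in> J) \<Longrightarrow>
      \<exists>a b c. f - (const a * f1 + const b * f2 + const c * f3) \<in> J"
    and indep: "\<And>a b c. const a * f1 + const b * f2 + const c * f3 \<in> J \<Longrightarrow> a = 0 \<and> b = 0 \<and> c = 0"
  shows "level_of_type 3 J"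
proof -
  let ?Q = "quotient_ring J" and ?K = "residue J ` range const"
  let ?E = "ring.line_extension ?Q ?K"
  have mem: "residue J f \<in> carrier ?Q" for f
    by (simp add: carrier_quotient_ring)
  have E0: "{\<zero>\<^bsub>?Q\<^esub>} = residue J ` {0}"
    by (simp add: quotient_zero)
  have E1: "?E (residue J f3) {\<zero>\<^bsub>?Q\<^esub>} = residue J ` {const c * f3 | c. True}"
    unfolding E0 line_extension_quotient by simp
  have E2: "?E (residue J f2) (?E (residue J f3) {\<zero>\<^bsub>?Q\<^esub>}) =
      residue J ` {const b * f2 + const c * f3 | b c. True}"
    unfolding E1 line_extension_quotient by (rule arg_cong[of _ _ "(`) (residue J)"]) blast
  have E3: "?E (residue J f1) (?E (residue J f2) (?E (residue J f3) {\<zero>\<^bsub>?Q\<^esub>})) =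
      residue J ` {const a * f1 + (const b * f2 + const c * f3) | a b c. True}"
    unfolding E2 line_extension_quotient by (rule arg_cong[of _ _ "(`) (residue J)"]) blast
  have n3: "residue J f3 \<notin> {\<zero>\<^bsub>?Q\<^esub>}"
    using indep[of 0 0 1] by (auto simp: quotient_zero residue_eq_iff)
  have n2: "residue J f2 \<notin> ?E (residue J f3) {\<zero>\<^bsub>?Q\<^esub>}"
  proof
    assume "residue J f2 \<in> ?E (residue J f3) {\<zero>\<^bsub>?Q\<^esub>}"
    then obtain c where "residue J f2 = residue J (const c * f3)"
      unfolding E1 by blast
    then have "const 0 * f1 + const 1 * f2 + const (- c) * f3 \<in> J"
      unfolding residue_eq_iff by (simp add: const_uminus)
    from indep[OF this] show False
      by simp
  qed
  have n1: "residue J f1 \<notin> ?E (residue J f2) (?E (residue J f3) {\<zero>\<^bsub>?Q\<^esub>})"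
  proof
    assume "residue J f1 \<in> ?E (residue J f2) (?E (residue J f3) {\<zero>\<^bsub>?Q\<^esub>})"
    then obtain b c where "residue J f1 = residue J (const b * f2 + const c * f3)"
      unfolding E2 by blast
    then have "const 1 * f1 + const (- b) * f2 + const (- c) * f3 \<in> J"
      unfolding residue_eq_iff by (simp add: const_uminus algebra_simps)
    from indep[OF this] show False
      by simp
  qed
  have dim: "ring.dimension ?Q 3 ?K
      (?E (residue J f1) (?E (residue J f2) (?E (residue J f3) {\<zero>\<^bsub>?Q\<^esub>})))"
    using ring.Suc_dim[OF ring_quotient_ring mem n1 ring.Suc_dim[OF ring_quotient_ring mem n2
      ring.Suc_dim[OF ring_quotient_ring mem n3 ring.zero_dim[OF ring_quotient_ring]]]]
    by (simp add: numeral_3_eq_3)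
  have socle: "socle J = residue J ` {const a * f1 + (const b * f2 + const c * f3) | a b c. True}"
  proof (intro equalityI subsetI)
    fix u
    assume "u \<in> socle J"
    then obtain f where f: "u = residue J f" "\<And>v. indet v * f \<in> J"
      unfolding socle_eq by blast
    obtain a b c where "f - (const a * f1 + const b * f2 + const c * f3) \<in> J"
      using span[OF f(2)] by blast
    then have "u = residue J (const a * f1 + (const b * f2 + const c * f3))"
      unfolding f(1) residue_eq_iff by (simp add: algebra_simps)
    then show "u \<in> residue J ` {const a * f1 + (const b * f2 + const c * f3) | a b c. True}"
      by blast
  next
    fix u
    assume "u \<in> residue J ` {const a * f1 + (const b * f2 + const c * f3) | a b c. True}"
    then obtain a b c where u: "u = residue J (const a * f1 + (const b * f2 + const c * f3))"
      by blast
    have "indet v * (const a * f1 + (const b * f2 + const c * f3)) \<in> J" for v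
    proof -
      have "indet v * (const a * f1 + (const b * f2 + const c * f3)) =
          const a * (indet v * f1) + (const b * (indet v * f2) + const c * (indet v * f3))"
        by (simp add: algebra_simps)
      then show ?thesis
        using ann by (simp add: ideal_add[OF J] ideal_mult[OF J])
    qed
    then show "u \<in> socle J"
      unfolding socle_eq u by blast
  qed
  have "const a * f1 + (const b * f2 + const c * f3) \<in> forms d" for a b c
    using forms by (intro forms_add forms_const_mult)
  then have "socle J \<subseteq> residue J ` forms d"
    unfolding socle by blast
  moreover have "ring.dimension ?Q 3 ?K (socle J)"
    using dim unfolding E3 socle .
  ultimately show ?thesis
    unfolding level_of_type_def component_def using art by blast
qed

end

section \<open>Artinian quotients\<close>

text \<open>Induction on the finite set of monomials that some member of the chain may miss: if both
  the chain of sums with a line and the chain of intersections with it become stationary, then so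
  does the chain itself.\<close>

lemma subspace_chain_stationary:
  fixes V :: "nat \<Rightarrow> 'k::field poly4 set"
  assumes "finite B"
    and "\<And>n p q. p \<in> V n \<Longrightarrow> q \<in> V n \<Longrightarrow> p + q \<in> V n"
    and "\<And>n c p. p \<in> V n \<Longrightarrow> const c * p \<in> V n"
    and "\<And>n. V (Suc n) \<subseteq> V n"
    and "\<And>n m c. m \<notin> B \<Longrightarrow> Poly_Mapping.single m c \<in> V n"
    and "\<And>n. 0 \<in> V n"
  shows "\<exists>N. \<forall>n\<ge>N. V n = V N"
  using assms
proof (induction B arbitrary: V rule: finite_induct)
  case empty
  have "p \<in> V n" for p n
    by (induction p rule: poly_single_induct) (use empty in auto)
  then show ?case
    by blast
next
  case (insert b B)
  note add = insert.prems(1) and scale = insert.prems(2) and dec = insert.prems(3)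
    and mono = insert.prems(4) and zero = insert.prems(5)
  define e :: "'k poly4" where "e = Poly_Mapping.single b 1"
  \<comment> \<open>Adding the line through \<open>e\<close> absorbs the monomial \<open>b\<close>,
    so the chain \<open>W\<close> can miss only monomials of \<open>B\<close> and the induction
    hypothesis applies.\<close>
  define W where "W n = {p + const c * e | p c. p \<in> V n}" for n
  have W: "p + const c * e \<in> W n" if "p \<in> V n" for p c n
    using that unfolding W_def by blast
  have antimono: "V n \<subseteq> V m" if "m \<le> n" for m n
    using that dec by (rule lift_Suc_antimono_le[rotated])
  have "\<exists>N. \<forall>n\<ge>N. W n = W N"
  proof (rule insert.IH)
    fix n p q
    assume "p \<in> W n" "q \<in> W n"
    then obtain p' c q' d where *: "p' \<in> V n" "p = p' + const c * e" "q' \<in> V n" "q = q' + const d * e"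
      unfolding W_def by blast
    then have "p + q = (p' + q') + const (c + d) * e"
      by (simp add: const_add algebra_simps)
    then show "p + q \<in> W n"
      using W[OF add[OF *(1,3)], of "c + d"] by argo
  next
    fix n c p
    assume "p \<in> W n"
    then obtain p' d where *: "p' \<in> V n" "p = p' + const d * e"
      unfolding W_def by blast
    then have "const c * p = const c * p' + const (c * d) * e"
      by (simp add: const_mult algebra_simps)
    then show "const c * p \<in> W n"
      using W[OF scale[OF *(1), of c], of "c * d"] by argo
  next
    fix n m c
    assume "m \<notin> B"
    show "Poly_Mapping.single m c \<in> W n"
    proof (cases "m = b")
      case True
      then have "Poly_Mapping.single m c = 0 + const c * e"
        by (simp add: e_def const_def mult_single)
      then show ?thesis
        using W[OF zero, of c n] by argo
    next
      case False
      then show ?thesis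
        using W[of "Poly_Mapping.single m c" n 0] mono[of m c n] \<open>m \<notin> B\<close> by simp
    qed
  next
    show "W (Suc n) \<subseteq> W n" for n
      unfolding W_def using dec by blast
    show "0 \<in> W n" for n
      using W[OF zero, of 0 n] by simp
  qed
  then obtain N where N: "\<And>n. n \<ge> N \<Longrightarrow> W n = W N"
    by blast
  obtain M where M: "\<And>n. n \<ge> M \<Longrightarrow> e \<in> V n \<longleftrightarrow> e \<in> V M"
  proof (cases "\<forall>n. e \<in> V n")
    case True
    then show ?thesis
      using that by blast
  next
    case False
    then obtain M where "e \<notin> V M"
      by blast
    then show ?thesis
      using that[of M] antimono by blast
  qed
  let ?N = "max N M"
  have "V n = V ?N" if n: "n \<ge> ?N" for n
  proof
    show "V n \<subseteq> V ?N"
      using antimono n by blast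
    show "V ?N \<subseteq> V n"
    proof
      fix p
      assume p: "p \<in> V ?N"
      have "W ?N = W n"
        using N[of n] N[of ?N] n by simp
      then have "p \<in> W n"
        using W[OF p, of 0] by simp
      then obtain q c where q: "q \<in> V n" "p = q + const c * e"
        unfolding W_def by blast
      show "p \<in> V n"
      proof (cases "c = 0")
        case True
        then show ?thesis
          using q by simp
      next
        case False
        have "q \<in> V ?N"
          using q(1) antimono n by blast
        then have "p + const (-1) * q \<in> V ?N"
          using p add scale by blast
        then have "const c * e \<in> V ?N"
          using q(2) by (simp add: const_uminus)
        then have "e \<in> V ?N"
          using scale[of "const c * e" ?N "inverse c"] const_inverse_mult[OF False, of e] by simp
        then have "e \<in> V n"
          using M[of n] M[of ?N] n by simp
        then show ?thesis
          using q add scale by blast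
      qed
    qed
  qed
  then show ?case
    by blast
qed

text \<open>Ideals of the quotient pull back to subspaces of the polynomial ring containing
  \<open>J\<close>, hence containing all monomials outside the finite box \<open>B\<close> of
  exponents below \<open>M\<close>.\<close>

lemma artinian_quotient_ring:
  assumes J: "ideal J (polyring :: 'k::field poly4 ring)"
    and nil: "\<And>v. indet v ^ M \<in> J"
  shows "artinian_ring (quotient_ring J)"
  unfolding artinian_ring_def
proof (intro allI impI)
  fix f :: "nat \<Rightarrow> 'k poly4 set set"
  assume f: "\<forall>n. ideal (f n) (quotient_ring J) \<and> f (Suc n) \<subseteq> f n"
  define V where "V n = {p. residue J p \<in> f n}" for n
  define B :: "(letter \<Rightarrow>\<^sub>0 nat) set" where "B = {m. \<forall>v. Poly_Mapping.lookup m v < M}"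
  have image: "f n = residue J ` V n" for n
  proof -
    have "f n \<subseteq> range (residue J)"
      using f ideal.Icarr[of "f n" "quotient_ring J"] carrier_quotient_ring[OF J] by blast
    then show ?thesis
      unfolding V_def by blast
  qed
  have "finite B"
  proof -
    have "Poly_Mapping.lookup ` B \<subseteq> Pi\<^sub>E UNIV (\<lambda>_. {..<M})"
      by (auto simp: B_def PiE_def)
    moreover have "finite (Pi\<^sub>E (UNIV :: letter set) (\<lambda>_. {..<M}))"
      by (rule finite_PiE) simp_all
    ultimately have "finite (Poly_Mapping.lookup ` B)"
      by (rule finite_subset)
    then show ?thesis
      by (rule finite_imageD) (auto intro: inj_onI poly_mapping_eqI)
  qed
  then have "\<exists>N. \<forall>n\<ge>N. V n = V N"
  proof (rule subspace_chain_stationary)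
    fix n
    interpret f: ideal "f n" "quotient_ring J"
      using f by blast
    show "p + q \<in> V n" if "p \<in> V n" "q \<in> V n" for p q
      using that additive_subgroup.a_closed[OF f.additive_subgroup_axioms, of "residue J p" "residue J q"]
      by (simp add: V_def quotient_add[OF J])
    show "const c * p \<in> V n" if "p \<in> V n" for c p
      using that f.I_l_closed[of "residue J p" "residue J (const c)"]
      by (simp add: V_def quotient_mult[OF J] carrier_quotient_ring[OF J])
    have zero: "residue J 0 \<in> f n"
      using additive_subgroup.zero_closed[OF f.additive_subgroup_axioms] by (simp add: quotient_zero[OF J])
    then show "0 \<in> V n"
      by (simp add: V_def)
    show "V (Suc n) \<subseteq> V n"
      using f by (auto simp: V_def)
    show "Poly_Mapping.single m c \<in> V n" if m: "m \<notin> B" for m c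
    proof -
      obtain v where v: "M \<le> Poly_Mapping.lookup m v"
        using m by (auto simp: B_def not_less)
      have "Poly_Mapping.single m c = indet v ^ M * Poly_Mapping.single (m - Poly_Mapping.single v M) c"
        by (rule single_eq_indet_power_mult[OF v])
      then have "Poly_Mapping.single m c \<in> J"
        using ideal_mult_right[OF J nil] by simp
      then have "residue J (Poly_Mapping.single m c) = residue J 0"
        by (simp add: residue_eq_iff[OF J])
      then show ?thesis
        using zero by (simp add: V_def)
    qed
  qed
  then show "\<exists>N. \<forall>n\<ge>N. f n = f N"
    using image by metis
qed

section \<open>Restriction to a line\<close>

abbreviation Xw :: "'k::field poly4" where "Xw \<equiv> indet Lw"
abbreviation Xx :: "'k::field poly4" where "Xx \<equiv> indet Lx"
abbreviation Xy :: "'k::field poly4" where "Xy \<equiv> indet Ly"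
abbreviation Xz :: "'k::field poly4" where "Xz \<equiv> indet Lz"

text \<open>A homogeneous falling factorial, congruent to the power of \<open>v\<close> modulo w.
  The exponent is free: n = t + 1 gives the generators of the ideal, n = 1 a variable, and all n
  together the factors of the Newton basis.\<close>

definition lift_power :: "nat \<Rightarrow> letter \<Rightarrow> 'k::field poly4" where
  "lift_power n v = (\<Prod>i<n. (indet v - of_nat i * Xw))"

definition lifted_gens :: "nat \<Rightarrow> 'k::field poly4 set" where
  "lifted_gens t = {lift_power (Suc t) Lx, lift_power (Suc t) Ly, lift_power (Suc t) Lz, Xx * Xy * Xz}"

lemma lifted_ideal_eq: "lifted_ideal t = ideal_of (lifted_gens t :: 'k::field poly4 set)"
proof -
  have "{0..t} = {..<Suc t}"
    by auto
  then show ?thesis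
    unfolding lifted_ideal_def lifted_gens_def lift_power_def by simp
qed

lemma lift_power_forms: "(lift_power n v :: 'k::field poly4) \<in> forms n"
proof -
  have "(indet v - of_nat i * Xw :: 'k poly4) \<in> forms 1" for i
    by (intro forms_diff forms_of_nat_mult forms_indet)
  then have "(\<Prod>i<n. indet v - of_nat i * Xw :: 'k poly4) \<in> forms (\<Sum>i<n. 1)"
    by (intro forms_prod)
  then show ?thesis
    by (simp add: lift_power_def)
qed

lemma xyz_forms: "Xx * Xy * Xz \<in> forms 3"
  using forms_mult[OF forms_mult[OF forms_indet forms_indet] forms_indet, of Lx Ly Lz]
  by (simp add: numeral_3_eq_3)

lemma evalp_lift_power: "evalp (lift_power n v) a = (\<Prod>i<n. (a v - of_nat i * a Lw))"
  by (simp add: lift_power_def)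

lemma lifted_gens_forms: "lifted_gens t \<subseteq> (\<Union>d. forms d)"
  unfolding lifted_gens_def using lift_power_forms xyz_forms by blast

lemma homogeneous_lifted:
  assumes "l \<in> forms 1"
  shows "homogeneous_ideal (add_generator (lifted_ideal t) l)"
  unfolding lifted_ideal_eq add_generator_ideal_of
  by (rule homogeneous_ideal_of) (use assms lifted_gens_forms in blast)

section \<open>Primality of the variables and two algebraic identities\<close>

lemma indet_dvd_iff: "indet v dvd p \<longleftrightarrow> subst.insertion (indet(v := 0)) p = (0 :: 'k::field poly4)"
proof
  assume "subst.insertion (indet(v := 0)) p = 0"
  moreover have "p - subst.insertion (indet(v := 0)) p \<in> {p. indet v dvd p}"
    by (rule subst_congruent) (auto intro: ideal_polyringI dvd_add)
  ultimately show "indet v dvd p"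
    by simp
qed (auto simp: dvd_def)

text \<open>A variable is prime: setting it to zero is a homomorphism into an integral
  domain.\<close>

lemma indet_dvd_multD:
  "indet v dvd p * q \<Longrightarrow> \<not> indet v dvd p \<Longrightarrow> indet v dvd (q :: 'k::field poly4)"
  by (simp add: indet_dvd_iff)

lemma sum_letters: "(\<Sum>v\<in>UNIV. f v) = f Lw + f Lx + f Ly + (f Lz :: 'a::comm_monoid_add)"
  by (simp add: UNIV_letter add.assoc)

lemma linear_form_eq:
  assumes "l \<in> forms 1"
  shows "l = const (coords l Lw) * Xw + const (coords l Lx) * Xx + const (coords l Ly) * Xy
    + const (coords l Lz) * Xz"
  using forms_1_expand[OF assms] by (simp add: sum_letters)

text \<open>After clearing \<open>c\<close>, multiplication by \<open>v\<close> agrees on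
  \<open>g\<close> with multiplication by \<open>p * s\<close>, up to two terms. In the applications
  the first lies in the ideal of the line by a linear congruence for \<open>v\<close>, and the
  second is a multiple of xyz, if necessary modulo \<open>L\<close>.\<close>

lemma rescale_step:
  fixes c :: "'a::comm_ring_1"
  assumes "c * s = y"
  shows "c * (v * g - p * s * g) = (c * v - (r + p * y)) * g + r * g"
  unfolding assms[symmetric] by (simp add: algebra_simps)

lemma cramer_zero_diagonal:
  fixes p q r s u v :: "'k::field"
  assumes "p * s * u + q * r * v \<noteq> 0"
  shows "\<exists>a b c. b * p + c * q = x \<and> a * r + c * s = y \<and> a * u + b * v = z"
proof -
  \<comment> \<open>The determinant of the matrix with rows (0, p, q), (r, 0, s), (u, v, 0); the
    numerators below are Cramer's rule.\<close>
  define D where "D = p * s * u + q * r * v"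
  have D: "D \<noteq> 0"
    using assms by (simp add: D_def)
  have 1: "(s * u * x + q * r * z - q * u * y) * p + (r * v * x - p * r * z + p * u * y) * q = D * x"
    and 2: "(p * s * z + q * v * y - s * v * x) * r + (r * v * x - p * r * z + p * u * y) * s = D * y"
    and 3: "(p * s * z + q * v * y - s * v * x) * u + (s * u * x + q * r * z - q * u * y) * v = D * z"
    by (simp_all add: D_def algebra_simps)
  have "(s * u * x + q * r * z - q * u * y) / D * p + (r * v * x - p * r * z + p * u * y) / D * q = x"
    "(p * s * z + q * v * y - s * v * x) / D * r + (r * v * x - p * r * z + p * u * y) / D * s = y"
    "(p * s * z + q * v * y - s * v * x) / D * u + (s * u * x + q * r * z - q * u * y) / D * v = z"
    using 1 2 3 D by (simp_all add: add_divide_distrib[symmetric])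
  then show ?thesis
    by blast
qed

text \<open>The linear forms \<open>l\<close> and \<open>z - \<alpha>x - \<beta>y\<close> cut out a line; \<open>P1\<close>, \<open>P2\<close> and \<open>P3\<close> are the points
  where it meets the planes \<open>x = 0\<close>, \<open>y = 0\<close> and \<open>z = 0\<close>. Modulo \<open>l\<close>, \<open>z - \<alpha>x - \<beta>y\<close> and \<open>xyz\<close>, a
  form of degree at least two is determined by its values at these points.\<close>

locale line =
  fixes l :: "'k::field poly4" and \<alpha> \<beta> :: 'k
  assumes l: "l \<in> forms 1" and cw: "coords l Lw \<noteq> 0" and \<alpha>: "\<alpha> \<noteq> 0" and \<beta>: "\<beta> \<noteq> 0"
begin

definition L :: "'k poly4" where "L = Xz - const \<alpha> * Xx - const \<beta> * Xy"

text \<open>The points are scaled so that no division occurs: their coordinates are polynomials in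
  the coefficients of \<open>l\<close>, which makes the determinant one as well.\<close>

definition P1 :: "letter \<Rightarrow> 'k" where
  "P1 = (\<lambda>v. case v of Lw \<Rightarrow> - (coords l Ly + \<beta> * coords l Lz) | Lx \<Rightarrow> 0
    | Ly \<Rightarrow> coords l Lw | Lz \<Rightarrow> \<beta> * coords l Lw)"

definition P2 :: "letter \<Rightarrow> 'k" where
  "P2 = (\<lambda>v. case v of Lw \<Rightarrow> - (coords l Lx + \<alpha> * coords l Lz) | Lx \<Rightarrow> coords l Lw
    | Ly \<Rightarrow> 0 | Lz \<Rightarrow> \<alpha> * coords l Lw)"

definition P3 :: "letter \<Rightarrow> 'k" where
  "P3 = (\<lambda>v. case v of Lw \<Rightarrow> \<alpha> * coords l Ly - \<beta> * coords l Lx | Lx \<Rightarrow> \<beta> * coords l Lw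
    | Ly \<Rightarrow> - \<alpha> * coords l Lw | Lz \<Rightarrow> 0)"

lemmas P_simps [simp] = P1_def P2_def P3_def

lemma P3_eq: "P3 v = \<beta> * P2 v - \<alpha> * P1 v"
  by (cases v) (simp_all add: algebra_simps)

abbreviation Q :: "'k poly4 set" where "Q \<equiv> ideal_of {l, L, Xx * Xy * Xz}"

lemma Q: "ideal Q polyring"
  by (rule ideal_ideal_of)

lemma Q_gens: "l \<in> Q" "L \<in> Q" "Xx * Xy * Xz \<in> Q"
  by (auto intro: mem_ideal_of)

lemma L_forms: "L \<in> forms 1"
  unfolding L_def by (intro forms_diff forms_const_mult forms_indet)

lemma evalp_l: "evalp l a = coords l Lw * a Lw + coords l Lx * a Lx + coords l Ly * a Ly + coords l Lz * a Lz"
  using arg_cong[OF linear_form_eq[OF l], of "\<lambda>p. evalp p a"] by simp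

lemma evalp_L: "evalp L a = a Lz - \<alpha> * a Lx - \<beta> * a Ly"
  by (simp add: L_def)

lemma evalp_Q:
  assumes "f \<in> Q"
  shows "evalp f P1 = 0" "evalp f P2 = 0" "evalp f P3 = 0"
  by (rule evalp_ideal_of[OF assms]; elim insertE emptyE; simp add: evalp_l evalp_L algebra_simps)+

text \<open>On the line, x and y are coordinates and a linear form is determined by its values at
  \<open>P2\<close> and \<open>P1\<close>, where (x, y) is (c, 0) and (0, c) with c =
  \<open>coords l Lw\<close>.\<close>

lemma indet_congruent:
  "const (coords l Lw) * indet v - (const (P2 v) * Xx + const (P1 v) * Xy) \<in> Q"
proof (cases v)
  case Lw
  have "const (coords l Lw) * indet v - (const (P2 v) * Xx + const (P1 v) * Xy) =
      (const (coords l Lw) * Xw + const (coords l Lx) * Xx + const (coords l Ly) * Xy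
        + const (coords l Lz) * Xz) - const (coords l Lz) * L"
    by (simp add: Lw L_def const_add const_diff const_uminus const_mult algebra_simps)
  also have "\<dots> = l - const (coords l Lz) * L"
    using linear_form_eq[OF l] by simp
  finally show ?thesis
    using Q_gens by (simp add: ideal_diff[OF Q] ideal_mult[OF Q])
next
  case Lz
  then have "const (coords l Lw) * indet v - (const (P2 v) * Xx + const (P1 v) * Xy) =
      const (coords l Lw) * L"
    by (simp add: L_def const_mult algebra_simps)
  then show ?thesis
    using Q_gens by (simp add: ideal_mult[OF Q])
qed (simp_all add: ideal_zero[OF Q])

text \<open>The forms \<open>s\<^sub>1\<^sup>d yz\<close>, \<open>s\<^sub>2\<^sup>d xz\<close>, \<open>s\<^sub>3\<^sup>d xy\<close> form, up to scalars, the dual basis of the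
  evaluations at \<open>P1\<close>, \<open>P2\<close>, \<open>P3\<close>.\<close>

definition s1 :: "'k poly4" where "s1 = const (inverse (coords l Lw)) * Xy"
definition s2 :: "'k poly4" where "s2 = const (inverse (coords l Lw)) * Xx"
definition s3 :: "'k poly4" where "s3 = const (inverse (\<beta> * coords l Lw)) * Xx"

text \<open>Times yz, the x part of \<open>v\<close> is absorbed by xyz, so only the value of
  \<open>v\<close> at \<open>P1\<close> remains. Multiplication by \<open>v\<close> is thus diagonal
  on the three families that start with yz, xz and xy.\<close>

lemma yz_step: "indet v * (Xy * Xz) - const (P1 v) * s1 * (Xy * Xz) \<in> Q"
proof (rule ideal_const_cancel[OF Q cw])
  have "const (coords l Lw) * s1 = Xy"
    using const_inverse_mult[OF cw, of Xy] by (simp add: s1_def mult.left_commute)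
  then have "const (coords l Lw) * (indet v * (Xy * Xz) - const (P1 v) * s1 * (Xy * Xz)) =
      (const (coords l Lw) * indet v - (const (P2 v) * Xx + const (P1 v) * Xy)) * (Xy * Xz)
        + const (P2 v) * (Xx * Xy * Xz)"
    using rescale_step[of "const (coords l Lw)" s1 Xy "indet v" "Xy * Xz" "const (P1 v)" "const (P2 v) * Xx"]
    by (simp add: algebra_simps del: P_simps)
  then show "const (coords l Lw) * (indet v * (Xy * Xz) - const (P1 v) * s1 * (Xy * Xz)) \<in> Q"
    using indet_congruent[of v] Q_gens
    by (simp only: ideal_add[OF Q] ideal_mult[OF Q] ideal_mult_right[OF Q])
qed

lemma xz_step: "indet v * (Xx * Xz) - const (P2 v) * s2 * (Xx * Xz) \<in> Q"
proof (rule ideal_const_cancel[OF Q cw])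
  have "const (coords l Lw) * s2 = Xx"
    using const_inverse_mult[OF cw, of Xx] by (simp add: s2_def mult.left_commute)
  then have "const (coords l Lw) * (indet v * (Xx * Xz) - const (P2 v) * s2 * (Xx * Xz)) =
      (const (coords l Lw) * indet v - (const (P2 v) * Xx + const (P1 v) * Xy)) * (Xx * Xz)
        + const (P1 v) * (Xx * Xy * Xz)"
    using rescale_step[of "const (coords l Lw)" s2 Xx "indet v" "Xx * Xz" "const (P2 v)" "const (P1 v) * Xy"]
    by (simp add: algebra_simps del: P_simps)
  then show "const (coords l Lw) * (indet v * (Xx * Xz) - const (P2 v) * s2 * (Xx * Xz)) \<in> Q"
    using indet_congruent[of v] Q_gens
    by (simp only: ideal_add[OF Q] ideal_mult[OF Q] ideal_mult_right[OF Q])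
qed

text \<open>Neither part of \<open>v\<close> is absorbed by xyz directly here. The relation
  \<open>L\<close> times xy gives \<beta> y * xy = - \<alpha> x * xy modulo \<open>Q\<close>, which
  turns the values at \<open>P2\<close> and \<open>P1\<close> into the one at
  \<open>P3\<close>.\<close>

lemma xy_step: "indet v * (Xx * Xy) - const (P3 v) * s3 * (Xx * Xy) \<in> Q"
proof (rule ideal_const_cancel[OF Q])
  show ne: "\<beta> * coords l Lw \<noteq> 0"
    using cw \<beta> by simp
  have s3: "const (\<beta> * coords l Lw) * s3 = Xx"
    using const_inverse_mult[OF ne, of Xx] by (simp add: s3_def mult.left_commute)
  have P3: "const (P3 v) = const \<beta> * const (P2 v) - const \<alpha> * const (P1 v)"
    by (simp only: P3_eq const_diff const_mult)
  have "const (\<beta> * coords l Lw) * (indet v * (Xx * Xy) - const (P3 v) * s3 * (Xx * Xy)) =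
      (const (coords l Lw) * indet v - (const (P2 v) * Xx + const (P1 v) * Xy)) * (const \<beta> * Xx * Xy)
        + const (P1 v) * (Xx * Xy * Xz) - (const (P1 v) * Xx * Xy) * L"
    using rescale_step[OF s3, of "indet v" "Xx * Xy" "const (P3 v)" "const \<alpha> * const (P1 v) * Xx + const \<beta> * const (P1 v) * Xy"]
    unfolding P3 by (simp add: L_def const_mult algebra_simps del: P_simps)
  then show "const (\<beta> * coords l Lw) * (indet v * (Xx * Xy) - const (P3 v) * s3 * (Xx * Xy)) \<in> Q"
    using indet_congruent[of v] Q_gens
    by (simp only: ideal_add[OF Q] ideal_diff[OF Q] ideal_mult[OF Q] ideal_mult_right[OF Q])
qed

definition dual_comb :: "nat \<Rightarrow> 'k \<Rightarrow> 'k \<Rightarrow> 'k \<Rightarrow> 'k poly4" where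
  "dual_comb d a b c = const a * (s1 ^ d * (Xy * Xz)) + const b * (s2 ^ d * (Xx * Xz))
    + const c * (s3 ^ d * (Xx * Xy))"

definition dual_span :: "nat \<Rightarrow> 'k poly4 set" where
  "dual_span d = {f. \<exists>a b c. f - dual_comb d a b c \<in> Q}"

lemma dual_spanI: "f - dual_comb d a b c \<in> Q \<Longrightarrow> f \<in> dual_span d"
  unfolding dual_span_def by blast

lemma dual_span_Q: "f \<in> Q \<Longrightarrow> f \<in> dual_span d"
  by (rule dual_spanI[of _ _ 0 0 0]) (simp add: dual_comb_def)

lemma dual_span_add:
  assumes "f \<in> dual_span d" "g \<in> dual_span d"
  shows "f + g \<in> dual_span d"
proof -
  obtain a b c a' b' c' where *: "f - dual_comb d a b c \<in> Q" "g - dual_comb d a' b' c' \<in> Q"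
    using assms unfolding dual_span_def by blast
  have "(f + g) - dual_comb d (a + a') (b + b') (c + c') =
      (f - dual_comb d a b c) + (g - dual_comb d a' b' c')"
    by (simp add: dual_comb_def const_add algebra_simps)
  then show ?thesis
    using ideal_add[OF Q *] by (metis dual_spanI)
qed

lemma dual_span_const:
  assumes "f \<in> dual_span d"
  shows "const k * f \<in> dual_span d"
proof -
  obtain a b c where *: "f - dual_comb d a b c \<in> Q"
    using assms unfolding dual_span_def by blast
  have "const k * f - dual_comb d (k * a) (k * b) (k * c) = const k * (f - dual_comb d a b c)"
    by (simp add: dual_comb_def const_mult algebra_simps)
  then show ?thesis
    using ideal_mult[OF Q *] by (metis dual_spanI)
qed

lemma dual_span_const_cancel:
  assumes "k \<noteq> 0" "const k * f \<in> dual_span d"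
  shows "f \<in> dual_span d"
  using dual_span_const[OF assms(2), of "inverse k"] const_inverse_mult[OF assms(1)] by simp

lemma dual_span_cong: "f - g \<in> Q \<Longrightarrow> g \<in> dual_span d \<Longrightarrow> f \<in> dual_span d"
  using dual_span_add[OF dual_span_Q] by fastforce

lemma dual_span_step:
  assumes "f \<in> dual_span d"
  shows "indet v * f \<in> dual_span (Suc d)"
proof -
  obtain a b c where *: "f - dual_comb d a b c \<in> Q"
    using assms unfolding dual_span_def by blast
  let ?A = "indet v * (Xy * Xz) - const (P1 v) * s1 * (Xy * Xz)"
  let ?B = "indet v * (Xx * Xz) - const (P2 v) * s2 * (Xx * Xz)"
  let ?C = "indet v * (Xx * Xy) - const (P3 v) * s3 * (Xx * Xy)"
  have "indet v * f - dual_comb (Suc d) (a * P1 v) (b * P2 v) (c * P3 v) =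
      indet v * (f - dual_comb d a b c) + const a * s1 ^ d * ?A + const b * s2 ^ d * ?B
        + const c * s3 ^ d * ?C"
    by (simp add: dual_comb_def const_mult algebra_simps del: P_simps)
  moreover have "indet v * (f - dual_comb d a b c) + const a * s1 ^ d * ?A + const b * s2 ^ d * ?B
        + const c * s3 ^ d * ?C \<in> Q"
    by (intro ideal_add[OF Q] ideal_mult[OF Q] * yz_step xz_step xy_step)
  ultimately show ?thesis
    by (metis dual_spanI)
qed

text \<open>The squares are recovered from x * \<open>L\<close> and y * \<open>L\<close>, which
  express \<alpha> x^2 and \<beta> y^2 through xz, yz and xy. Any other product reduces to x^2, xy
  and y^2 on the line.\<close>

lemma dual_span_quadratic: "indet v * indet u \<in> dual_span 0"
proof -
  have yz: "Xy * Xz \<in> dual_span 0"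
    by (rule dual_spanI[of _ _ 1 0 0]) (simp add: dual_comb_def ideal_zero[OF Q])
  have xz: "Xx * Xz \<in> dual_span 0"
    by (rule dual_spanI[of _ _ 0 1 0]) (simp add: dual_comb_def ideal_zero[OF Q])
  have xy: "Xx * Xy \<in> dual_span 0"
    by (rule dual_spanI[of _ _ 0 0 1]) (simp add: dual_comb_def ideal_zero[OF Q])
  have xx: "Xx * Xx \<in> dual_span 0"
  proof (rule dual_span_const_cancel[OF \<alpha> dual_span_cong])
    have "const \<alpha> * (Xx * Xx) - (Xx * Xz + const (- \<beta>) * (Xx * Xy)) = - Xx * L"
      by (simp add: L_def const_uminus algebra_simps)
    then show "const \<alpha> * (Xx * Xx) - (Xx * Xz + const (- \<beta>) * (Xx * Xy)) \<in> Q"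
      using ideal_uminus[OF Q ideal_mult[OF Q Q_gens(2)]] by simp
  qed (intro dual_span_add dual_span_const xz xy)
  have yy: "Xy * Xy \<in> dual_span 0"
  proof (rule dual_span_const_cancel[OF \<beta> dual_span_cong])
    have "const \<beta> * (Xy * Xy) - (Xy * Xz + const (- \<alpha>) * (Xx * Xy)) = - Xy * L"
      by (simp add: L_def const_uminus algebra_simps)
    then show "const \<beta> * (Xy * Xy) - (Xy * Xz + const (- \<alpha>) * (Xx * Xy)) \<in> Q"
      using ideal_uminus[OF Q ideal_mult[OF Q Q_gens(2)]] by simp
  qed (intro dual_span_add dual_span_const yz xy)
  show ?thesis
  proof (rule dual_span_const_cancel[OF _ dual_span_cong])
    show "coords l Lw * coords l Lw \<noteq> 0"
      using cw by simp
    show "const (coords l Lw * coords l Lw) * (indet v * indet u) -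
        (const (P2 v * P2 u) * (Xx * Xx) + const (P2 v * P1 u + P1 v * P2 u) * (Xx * Xy)
          + const (P1 v * P1 u) * (Xy * Xy)) \<in> Q"
      using ideal_mult_diff[OF Q indet_congruent[of v] indet_congruent[of u]]
      by (simp only: const_mult const_add algebra_simps)
  qed (intro dual_span_add dual_span_const xx xy yy)
qed

text \<open>Degree two is the base, since the dual families start there; linear forms have only two
  dimensions on a line, too few for three independent values.\<close>

lemma forms_dual_span:
  assumes "f \<in> forms (Suc (Suc d))"
  shows "f \<in> dual_span d"
proof -
  have "\<forall>d. n = Suc (Suc d) \<longrightarrow> f \<in> dual_span d" if "f \<in> forms n" for n
    using that
  proof (induction rule: forms_induct)
    case (zero d)
    then show ?case
      using dual_span_Q ideal_zero[OF Q] by blast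
  next
    case (step n v p)
    show ?case
    proof (intro allI impI)
      fix d
      assume n: "Suc n = Suc (Suc d)"
      show "indet v * p \<in> dual_span d"
      proof (cases d)
        case 0
        then have p: "p \<in> forms 1"
          using step n by simp
        have "indet v * p = const (coords p Lw) * (indet v * Xw) + const (coords p Lx) * (indet v * Xx)
            + const (coords p Ly) * (indet v * Xy) + const (coords p Lz) * (indet v * Xz)"
          by (subst linear_form_eq[OF p]) (simp add: algebra_simps)
        moreover have "\<dots> \<in> dual_span 0"
          by (intro dual_span_add dual_span_const dual_span_quadratic)
        ultimately show ?thesis
          using 0 by simp
      next
        case (Suc e)
        then show ?thesis
          using step n dual_span_step[of p e v] by simp
      qed
    qed
  qed (auto intro: dual_span_add)
  then show ?thesis
    using assms by blast
qed

text \<open>Each of yz, xz, xy is nonzero at just one of the three points, so the values read off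
  the three coefficients.\<close>

lemma vanishing_on_line:
  assumes f: "f \<in> forms (Suc (Suc d))" and "evalp f P1 = 0" "evalp f P2 = 0" "evalp f P3 = 0"
  shows "f \<in> Q"
proof -
  obtain a b c where abc: "f - dual_comb d a b c \<in> Q"
    using forms_dual_span[OF f] unfolding dual_span_def by blast
  note ev = evalp_Q[OF abc]
  have "evalp s1 P1 = 1" "evalp s2 P2 = 1" "evalp s3 P3 = 1"
    using cw \<beta> by (simp_all add: s1_def s2_def s3_def field_simps)
  then have "a = 0" "b = 0" "c = 0"
    using ev assms(2-4) cw \<alpha> \<beta> by (simp_all add: dual_comb_def del: P_simps) (simp_all add: P_simps)
  then show ?thesis
    using abc by (simp add: dual_comb_def)
qed

text \<open>Invertibility of the matrix of values of the three generators at the three points lets a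
  combination of them match any form of degree t + 1; the difference vanishes at the points. The
  assumption t \<ge> 1 brings t + 1 into the range of degrees at least two. Higher degrees follow by
  multiplying with variables.\<close>

lemma forms_in_cut:
  assumes t: "t \<ge> 1"
    and det: "evalp (lift_power (Suc t) Ly) P1 * evalp (lift_power (Suc t) Lz) P2 * evalp (lift_power (Suc t) Lx) P3
      + evalp (lift_power (Suc t) Lz) P1 * evalp (lift_power (Suc t) Lx) P2 * evalp (lift_power (Suc t) Ly) P3 \<noteq> 0"
    and g: "g \<in> forms d" "d \<ge> Suc t"
  shows "g \<in> add_generator (add_generator (lifted_ideal t) l) L"
proof -
  let ?N = "add_generator (add_generator (lifted_ideal t) l) L"
  have N: "ideal ?N polyring"
    by (rule ideal_add_generator)
  have N_eq: "?N = ideal_of (insert L (insert l (lifted_gens t)))"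
    by (simp add: lifted_ideal_eq add_generator_ideal_of)
  have F: "lift_power (Suc t) v \<in> ?N" if "v \<noteq> Lw" for v
    unfolding N_eq by (rule mem_ideal_of) (use that in \<open>cases v; simp add: lifted_gens_def\<close>)
  have QN: "Q \<subseteq> ?N"
    unfolding N_eq by (rule ideal_of_mono) (auto simp: lifted_gens_def)
  have base: "g \<in> ?N" if g: "g \<in> forms (Suc t)" for g
  proof -
    have zero: "evalp (lift_power (Suc t) v) P = 0" if "P v = 0" for P v
      using that by (simp add: evalp_lift_power prod.lessThan_Suc_shift del: prod.lessThan_Suc)
    have zeros: "evalp (lift_power (Suc t) Lx) P1 = 0" "evalp (lift_power (Suc t) Ly) P2 = 0"
      "evalp (lift_power (Suc t) Lz) P3 = 0"
      by (rule zero, simp)+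
    obtain a b c where
      "b * evalp (lift_power (Suc t) Ly) P1 + c * evalp (lift_power (Suc t) Lz) P1 = evalp g P1"
      "a * evalp (lift_power (Suc t) Lx) P2 + c * evalp (lift_power (Suc t) Lz) P2 = evalp g P2"
      "a * evalp (lift_power (Suc t) Lx) P3 + b * evalp (lift_power (Suc t) Ly) P3 = evalp g P3"
      using cramer_zero_diagonal[OF det] by blast
    note abc = this
    define h where "h = const a * lift_power (Suc t) Lx + const b * lift_power (Suc t) Ly
      + const c * lift_power (Suc t) Lz"
    have "g - h \<in> Q"
    proof (rule vanishing_on_line)
      show "g - h \<in> forms (Suc (Suc (t - 1)))"
        unfolding h_def using t g
        by (auto intro!: forms_diff forms_add forms_const_mult lift_power_forms)
      show "evalp (g - h) P1 = 0" "evalp (g - h) P2 = 0" "evalp (g - h) P3 = 0"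
        using abc zeros by (simp_all add: h_def del: P_simps)
    qed
    moreover have "h \<in> ?N"
      unfolding h_def by (intro ideal_add[OF N] ideal_mult[OF N] F) simp_all
    ultimately show ?thesis
      using QN ideal_diff_mem[OF N] by blast
  qed
  have "d \<ge> Suc t \<longrightarrow> g \<in> ?N"
    using g(1)
  proof (induction rule: forms_induct)
    case (step d v p)
    show ?case
    proof
      assume "Suc t \<le> Suc d"
      then consider "d = t" | "Suc t \<le> d"
        by linarith
      then show "indet v * p \<in> ?N"
      proof cases
        case 1
        then show ?thesis
          using base forms_indet_mult[OF step(1)] by blast
      next
        case 2
        then show ?thesis
          using step ideal_mult[OF N] by blast
      qed
    qed
  qed (auto simp: ideal_zero[OF N] intro: ideal_add[OF N])
  then show ?thesis
    using g(2) by blast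
qed

lemma xyz_dvd_cancel:
  assumes "Xx * Xy * Xz dvd L * g"
  shows "Xx * Xy * Xz dvd g"
proof -
  have nz: "indet v \<noteq> (0 :: 'k poly4)" for v
  proof
    assume "indet v = (0 :: 'k poly4)"
    then have "evalp (indet v :: 'k poly4) (\<lambda>_. 1) = evalp 0 (\<lambda>_. 1)"
      by simp
    then show False
      by simp
  qed
  have L: "\<not> indet v dvd L" if "v \<noteq> Lw" for v
  proof
    assume "indet v dvd L"
    then obtain q where "L = indet v * q"
      by (auto simp: dvd_def)
    then have "evalp L a = 0" if "a v = 0" for a
      using that by simp
    \<comment> \<open>A point with \<open>v\<close> = 0 at which \<open>L\<close> is not zero: the
      unit vector of x, or of y if \<open>v\<close> is x, with value - \<alpha> or -
      \<beta>.\<close>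
    from this[of "\<lambda>u. if u = (if v = Lx then Ly else Lx) then 1 else 0"] show False
      using that \<alpha> \<beta> by (cases v) (simp_all add: L_def)
  qed
  have "Xx dvd L * g"
    using assms by (metis dvd_mult_left)
  then obtain g1 where g1: "g = Xx * g1"
    using indet_dvd_multD L[of Lx] by (meson dvdE letter.distinct)
  have "Xx * (Xy * Xz) dvd Xx * (L * g1)"
    using assms g1 by (simp add: mult.assoc mult.left_commute)
  then have d1: "Xy * Xz dvd L * g1"
    using nz by (simp only: dvd_mult_cancel_left) simp
  then have "Xy dvd L * g1"
    by (metis dvd_mult_left)
  then obtain g2 where g2: "g1 = Xy * g2"
    using indet_dvd_multD L[of Ly] by (meson dvdE letter.distinct)
  have "Xy * Xz dvd Xy * (L * g2)"
    using d1 g2 by (simp add: mult.left_commute)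
  then have "Xz dvd L * g2"
    using nz by (simp only: dvd_mult_cancel_left) simp
  then have "Xz dvd g2"
    using indet_dvd_multD L[of Lz] by blast
  then show ?thesis
    unfolding g1 g2 by (simp add: mult.assoc)
qed

lemma injective_below:
  assumes f: "f \<in> forms d" "d < t" and Lf: "L * f \<in> add_generator (lifted_ideal t) l"
  shows "f \<in> add_generator (lifted_ideal t) l"
proof -
  let ?J = "ideal_of {l, Xx * Xy * Xz}"
  have J: "ideal ?J polyring"
    by (rule ideal_ideal_of)
  have "L * f \<in> forms (Suc d)"
    using forms_mult[OF L_forms f(1)] by simp
  then have "L * f = hcomp (Suc d) (L * f)"
    by (simp add: hcomp_form)
  also have "\<dots> \<in> ?J"
  proof (rule hcomp_ideal_of[OF J, where D = "{..t}" and S = "insert l (lifted_gens t)"])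
    show "L * f \<in> ideal_of (insert l (lifted_gens t))"
      using Lf by (simp add: lifted_ideal_eq add_generator_ideal_of)
    fix s e
    assume s: "s \<in> insert l (lifted_gens t)" and e: "e \<in> {..t}"
    show "hcomp e s \<in> ?J"
    proof (cases "s \<in> {l, Xx * Xy * Xz}")
      case True
      have xyz: "(Xx * Xy * Xz :: 'k poly4) \<in> forms 3"
        by (rule xyz_forms)
      from True show ?thesis
        using hcomp_form[OF l, of e] hcomp_form[OF xyz, of e] ideal_zero[OF J]
        by (auto simp: mem_ideal_of)
    next
      case False
      then obtain v where "s = lift_power (Suc t) v"
        using s by (auto simp: lifted_gens_def)
      then have "hcomp e s = 0"
        using e hcomp_form[OF lift_power_forms[of "Suc t" v], of e] by auto
      then show ?thesis
        by (simp add: ideal_zero[OF J])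
    qed
  qed (use f in auto)
  finally have LJ: "L * f \<in> ?J" .
  \<comment> \<open>\<open>\<sigma>\<close> solves \<open>l\<close> = 0 for w and fixes x, y, z, so
    it kills \<open>l\<close> and leaves \<open>L\<close> and xyz unchanged. Membership becomes
    divisibility by xyz.\<close>
  define \<sigma> where "\<sigma> = indet(Lw := const (- inverse (coords l Lw)) *
    (const (coords l Lx) * Xx + const (coords l Ly) * Xy + const (coords l Lz) * Xz))"
  have \<sigma>: "\<sigma> Lw = const (- inverse (coords l Lw)) *
    (const (coords l Lx) * Xx + const (coords l Ly) * Xy + const (coords l Lz) * Xz)"
    "\<sigma> Lx = Xx" "\<sigma> Ly = Xy" "\<sigma> Lz = Xz"
    by (simp_all add: \<sigma>_def)
  have inv: "const (inverse (coords l Lw)) * const (coords l Lw) = 1"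
    using const_mult[of "inverse (coords l Lw)" "coords l Lw"] cw by simp
  have "indet v - \<sigma> v \<in> ?J" for v
  proof (cases v)
    case Lw
    have "indet v - \<sigma> v = const (inverse (coords l Lw)) * (const (coords l Lw) * Xw
        + const (coords l Lx) * Xx + const (coords l Ly) * Xy + const (coords l Lz) * Xz)"
      using inv by (simp add: Lw \<sigma> const_uminus distrib_left mult.assoc[symmetric])
    also have "\<dots> = const (inverse (coords l Lw)) * l"
      using linear_form_eq[OF l] by simp
    finally show ?thesis
      by (simp add: ideal_mult[OF J] mem_ideal_of)
  qed (simp_all add: \<sigma>_def ideal_zero[OF J])
  then have cong: "p - subst.insertion \<sigma> p \<in> ?J" for p
    by (rule subst_congruent[OF J])
  have \<sigma>l: "subst.insertion \<sigma> l = 0"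
  proof -
    have "subst.insertion \<sigma> l = const (coords l Lw) * \<sigma> Lw + const (coords l Lx) * Xx
        + const (coords l Ly) * Xy + const (coords l Lz) * Xz"
      using arg_cong[OF linear_form_eq[OF l], of "subst.insertion \<sigma>"] by (simp add: \<sigma>)
    moreover have "const (coords l Lw) * \<sigma> Lw = - (const (inverse (coords l Lw)) * const (coords l Lw)) *
        (const (coords l Lx) * Xx + const (coords l Ly) * Xy + const (coords l Lz) * Xz)"
      unfolding \<sigma> const_uminus by (simp add: mult.left_commute[of "const (coords l Lw)"] mult.assoc)
    ultimately show ?thesis
      unfolding inv by simp
  qed
  have "ideal {p. Xx * Xy * Xz dvd subst.insertion \<sigma> p} polyring"
    by (rule ideal_polyringI) (auto intro: dvd_add)
  then have "?J \<subseteq> {p. Xx * Xy * Xz dvd subst.insertion \<sigma> p}"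
    by (rule ideal_of_least) (simp add: \<sigma>l, simp add: \<sigma>)
  then have "Xx * Xy * Xz dvd L * subst.insertion \<sigma> f"
    using LJ by (auto simp: L_def \<sigma>)
  then have "Xx * Xy * Xz dvd subst.insertion \<sigma> f"
    by (rule xyz_dvd_cancel)
  then have "subst.insertion \<sigma> f \<in> ?J"
    using ideal_mult_right[OF J mem_ideal_of] by (metis dvdE insertCI)
  then have "f \<in> ?J"
    using ideal_diff_mem[OF J cong] by blast
  also have "?J \<subseteq> ideal_of (insert l (lifted_gens t))"
    by (rule ideal_of_mono) (auto simp: lifted_gens_def)
  finally show ?thesis
    by (simp add: lifted_ideal_eq add_generator_ideal_of)
qed

lemma weak_Lefschetz_cut:
  assumes t: "t \<ge> 1"
    and det: "evalp (lift_power (Suc t) Ly) P1 * evalp (lift_power (Suc t) Lz) P2 * evalp (lift_power (Suc t) Lx) P3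
      + evalp (lift_power (Suc t) Lz) P1 * evalp (lift_power (Suc t) Lx) P2 * evalp (lift_power (Suc t) Ly) P3 \<noteq> 0"
    and art: "artinian_ring (quotient_ring (add_generator (lifted_ideal t) l))"
  shows "weak_Lefschetz (add_generator (lifted_ideal t) l)"
proof -
  let ?J = "add_generator (lifted_ideal t) l"
  have J: "ideal ?J polyring"
    by (rule ideal_add_generator)
  have surj: "\<exists>f\<in>forms d. g - L * f \<in> ?J" if g: "g \<in> forms (d + 1)" and d: "t \<le> d" for g d
  proof -
    have "g \<in> add_generator ?J L"
      using forms_in_cut[OF t det g] d by simp
    then obtain j r where jr: "j \<in> ?J" "g = j + r * L"
      unfolding add_generator_iff[OF J] by blast
    have "g = hcomp (d + 1) (j + L * r)"
      using hcomp_form[OF g] jr by (simp add: mult.commute)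
    also have "\<dots> = hcomp (d + 1) j + L * hcomp d r"
      by (simp add: hcomp_add hcomp_form_mult[OF L_forms])
    finally have "g - L * hcomp d r = hcomp (d + 1) j"
      by simp
    also have "\<dots> \<in> ?J"
      using homogeneous_lifted[OF l, of t] jr(1) unfolding homogeneous_ideal_def by blast
    finally show ?thesis
      using hcomp_in_forms by blast
  qed
  show ?thesis
    unfolding weak_Lefschetz_iff[OF J]
  proof (intro conjI art bexI[of _ L] allI L_forms)
    fix d
    show "(\<forall>f\<in>forms d. L * f \<in> ?J \<longrightarrow> f \<in> ?J) \<or> (\<forall>g\<in>forms (d + 1). \<exists>f\<in>forms d. g - L * f \<in> ?J)"
      using injective_below[of _ d t] surj[of _ d] by (cases "d < t") auto
  qed
qed

end

section \<open>Artinian hyperplane sections\<close>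

lemma ideal_prod_diff:
  assumes J: "ideal J polyring" and "\<And>i. i \<in> A \<Longrightarrow> f i - g i \<in> J"
  shows "prod f A - prod g A \<in> (J :: 'k::field poly4 set)"
  using assms(2)
  by (induction A rule: infinite_finite_induct) (auto simp: ideal_zero[OF J] intro: ideal_mult_diff[OF J])

text \<open>By the factor theorem each substituted value differs from \<open>g\<close> by a multiple
  of v - i w. Modulo \<open>J\<close> the product is therefore a multiple of all these factors
  together, that is of \<open>lift_power n v\<close>.\<close>

lemma prod_substitutions_mem:
  assumes J: "ideal J polyring" and g: "g \<in> J" and v: "lift_power n v \<in> (J :: 'k::field poly4 set)"
  shows "(\<Prod>i<n. subst.insertion (indet(v := of_nat i * Xw)) g) \<in> J"
proof -
  let ?s = "\<lambda>i. subst.insertion (indet(v := of_nat i * Xw)) g"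
  have "\<forall>i. \<exists>r. g - ?s i = (indet v - of_nat i * Xw) * r"
  proof
    fix i
    have "g - ?s i \<in> {p. indet v - of_nat i * Xw dvd p}"
      by (rule subst_congruent) (auto intro: ideal_polyringI dvd_add)
    then show "\<exists>r. g - ?s i = (indet v - of_nat i * Xw) * r"
      by (auto simp: dvd_def)
  qed
  then obtain r where r: "\<forall>i. g - ?s i = (indet v - of_nat i * Xw) * r i"
    by (rule choice[THEN exE])
  have "(\<Prod>i<n. ?s i) - (\<Prod>i<n. - ((indet v - of_nat i * Xw) * r i)) \<in> J"
  proof (rule ideal_prod_diff[OF J])
    fix i
    have "?s i - - ((indet v - of_nat i * Xw) * r i) = ?s i - - (g - ?s i)"
      by (simp only: spec[OF r])
    then show "?s i - - ((indet v - of_nat i * Xw) * r i) \<in> J"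
      using g by simp
  qed
  moreover have "(\<Prod>i<n. - ((indet v - of_nat i * Xw) * r i)) = lift_power n v * (\<Prod>i<n. - r i)"
    unfolding lift_power_def prod.distrib[symmetric] by (rule prod.cong) simp_all
  ultimately show ?thesis
    using ideal_diff_mem[OF J _ ideal_mult_right[OF J v]] by (simp only:)
qed

lemma prod_const_power:
  assumes "\<And>i. i \<in> A \<Longrightarrow> \<exists>c N. c \<noteq> 0 \<and> f i = const c * Xw ^ N"
  shows "\<exists>c N. c \<noteq> 0 \<and> prod f A = const c * (Xw :: 'k::field poly4) ^ N"
proof -
  obtain c N where *: "\<And>i. i \<in> A \<Longrightarrow> c i \<noteq> 0 \<and> f i = const (c i) * Xw ^ N i"
    using assms by metis
  show ?thesis
  proof (cases "finite A")
    case True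
    have "prod f A = const (prod c A) * Xw ^ sum N A"
      using * by (simp add: prod.distrib const_prod power_sum)
    then show ?thesis
      using * True by (metis prod_zero_iff)
  next
    case False
    then have "(1::'k) \<noteq> 0 \<and> prod f A = const 1 * Xw ^ 0"
      by simp
    then show ?thesis
      by blast
  qed
qed

text \<open>Substituting in turn all grid values for \<open>z\<close>, \<open>y\<close> and \<open>x\<close> in the linear form \<open>l\<close> and multiplying
  the results yields members of the ideal, the last one being a nonzero multiple of a power of \<open>w\<close>.\<close>

lemma power_w_mem:
  assumes J: "ideal J polyring" and l: "l \<in> forms 1" "l \<in> J"
    and F: "lift_power a Lx \<in> J" "lift_power b Ly \<in> J" "lift_power c Lz \<in> (J :: 'k::field poly4 set)"
    and ne: "\<And>i j k. i < a \<Longrightarrow> j < b \<Longrightarrow> k < c \<Longrightarrow> coords l Lw + of_nat i * coords l Lx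
      + of_nat j * coords l Ly + of_nat k * coords l Lz \<noteq> 0"
  shows "\<exists>N. Xw ^ N \<in> J"
proof -
  define e where "e x y z = const (coords l Lw) * Xw + const (coords l Lx) * x + const (coords l Ly) * y
    + const (coords l Lz) * z" for x y z :: "'k poly4"
  have "e Xx Xy Xz \<in> J"
    using l linear_form_eq[OF l(1)] by (simp add: e_def)
  from prod_substitutions_mem[OF J this F(3)]
  have "(\<Prod>k<c. e Xx Xy (of_nat k * Xw)) \<in> J"
    by (simp add: e_def)
  from prod_substitutions_mem[OF J this F(2)]
  have "(\<Prod>j<b. \<Prod>k<c. e Xx (of_nat j * Xw) (of_nat k * Xw)) \<in> J"
    by (simp add: e_def)
  from prod_substitutions_mem[OF J this F(1)]
  have mem: "(\<Prod>i<a. \<Prod>j<b. \<Prod>k<c. e (of_nat i * Xw) (of_nat j * Xw) (of_nat k * Xw)) \<in> J"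
    by (simp add: e_def)
  have "e (of_nat i * Xw) (of_nat j * Xw) (of_nat k * Xw) = const (coords l Lw + of_nat i * coords l Lx
      + of_nat j * coords l Ly + of_nat k * coords l Lz) * Xw ^ 1" for i j k
    by (simp add: e_def const_add const_mult const_of_nat algebra_simps)
  then have "\<exists>d N. d \<noteq> 0 \<and> e (of_nat i * Xw) (of_nat j * Xw) (of_nat k * Xw) = const d * Xw ^ N"
    if "i < a" "j < b" "k < c" for i j k
    using ne that by blast
  then have "\<exists>d N. d \<noteq> 0 \<and> (\<Prod>i<a. \<Prod>j<b. \<Prod>k<c. e (of_nat i * Xw) (of_nat j * Xw) (of_nat k * Xw))
      = const d * Xw ^ N"
    by (intro prod_const_power) auto
  then show ?thesis
    using mem ideal_const_cancel[OF J] by metis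
qed

lemma power_minus_lift_power:
  assumes J: "ideal J polyring" and w: "Xw \<in> (J :: 'k::field poly4 set)"
  shows "indet v ^ n - lift_power n v \<in> J"
proof -
  have "(\<Prod>i<n. indet v) - (\<Prod>i<n. (indet v - of_nat i * Xw)) \<in> J"
    by (rule ideal_prod_diff[OF J]) (simp add: ideal_mult[OF J w])
  then show ?thesis
    by (simp add: lift_power_def)
qed

text \<open>Modulo w, the (t + 1)-st power of a variable agrees with a member of \<open>J\<close>.
  So it is congruent modulo \<open>J\<close> to a multiple of w, and its \<open>N\<close>-th power
  lies in \<open>J\<close>.\<close>

lemma artinian_if_power_w:
  assumes J: "ideal J polyring" and N: "Xw ^ N \<in> (J :: 'k::field poly4 set)"
    and F: "\<And>v. v \<noteq> Lw \<Longrightarrow> lift_power (Suc t) v \<in> J"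
  shows "artinian_ring (quotient_ring J)"
proof (rule artinian_quotient_ring[OF J])
  fix v
  show "indet v ^ (Suc t * N) \<in> J"
  proof (cases "v = Lw")
    case True
    then show ?thesis
      using ideal_mult[OF J N, of "Xw ^ (t * N)"] by (simp add: power_add mult.commute)
  next
    case False
    have "ideal {p. (Xw :: 'k poly4) dvd p} polyring"
      by (auto intro: ideal_polyringI dvd_add)
    from power_minus_lift_power[OF this, of v "Suc t"]
    have "(Xw :: 'k poly4) dvd indet v ^ Suc t - lift_power (Suc t) v"
      by simp
    then obtain r :: "'k poly4" where r: "indet v ^ Suc t - lift_power (Suc t) v = Xw * r"
      by (rule dvdE)
    have "indet v ^ Suc t - Xw * r \<in> J"
      unfolding r[symmetric] using F[OF False] by simp
    then have "(indet v ^ Suc t) ^ N - (Xw * r) ^ N \<in> J"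
      by (rule ideal_power_diff[OF J])
    moreover have "(Xw * r) ^ N \<in> J"
      using ideal_mult_right[OF J N] by (simp add: power_mult_distrib)
    ultimately show ?thesis
      using ideal_diff_mem[OF J] by (simp only: power_mult)
  qed
qed

text \<open>The assumption says that \<open>l\<close> vanishes at no point (1 : i : j : k) with i, j
  or k zero. Adding a variable \<open>v\<close> to the ideal fixes its index at zero, so a power of
  w becomes a multiple of \<open>v\<close> modulo the ideal. Multiplying the three relations for x,
  y and z produces the factor xyz, which is zero in the quotient.\<close>

lemma artinian_lifted_cut:
  assumes l: "l \<in> forms 1"
    and ne: "\<And>i j k. i \<le> t \<Longrightarrow> j \<le> t \<Longrightarrow> k \<le> t \<Longrightarrow> i = 0 \<or> j = 0 \<or> k = 0 \<Longrightarrow>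
      coords l Lw + of_nat i * coords l Lx + of_nat j * coords l Ly + of_nat k * coords l Lz \<noteq> (0::'k::field)"
  shows "artinian_ring (quotient_ring (add_generator (lifted_ideal t) l))"
proof -
  let ?J = "add_generator (lifted_ideal t) l"
  have J: "ideal ?J polyring"
    by (rule ideal_add_generator)
  have J_eq: "?J = ideal_of (insert l (lifted_gens t))"
    by (simp add: lifted_ideal_eq add_generator_ideal_of)
  have F: "lift_power (Suc t) v \<in> ?J" if "v \<noteq> Lw" for v
    unfolding J_eq by (rule mem_ideal_of) (use that in \<open>cases v; simp add: lifted_gens_def\<close>)
  have G: "l \<in> ?J" "Xx * Xy * Xz \<in> ?J"
    unfolding J_eq by (auto simp: lifted_gens_def intro: mem_ideal_of)
  have *: "\<exists>N. Xw ^ N \<in> add_generator ?J (indet v)" if v: "v \<noteq> Lw" for v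
  proof -
    let ?b = "\<lambda>u. if u = v then 1 else Suc t"
    have I: "ideal (add_generator ?J (indet v)) polyring"
      by (rule ideal_add_generator)
    have mem: "lift_power (?b u) u \<in> add_generator ?J (indet v)" if "u \<noteq> Lw" for u
    proof (cases "u = v")
      case True
      then show ?thesis
        using mem_add_generator[of "indet v" ?J] by (simp add: lift_power_def)
    next
      case False
      then show ?thesis
        using subset_add_generator[of ?J "indet v"] F[OF that] by auto
    qed
    show ?thesis
    proof (rule power_w_mem[OF I l])
      show "l \<in> add_generator ?J (indet v)"
        using subset_add_generator[of ?J "indet v"] G(1) by blast
      show "lift_power (?b Lx) Lx \<in> add_generator ?J (indet v)"
        "lift_power (?b Ly) Ly \<in> add_generator ?J (indet v)"
        "lift_power (?b Lz) Lz \<in> add_generator ?J (indet v)"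
        by (rule mem, simp)+
      fix i j k
      assume ijk: "i < ?b Lx" "j < ?b Ly" "k < ?b Lz"
      then have "i \<le> t" "j \<le> t" "k \<le> t"
        by (simp_all split: if_splits)
      moreover have "i = 0 \<or> j = 0 \<or> k = 0"
        using v ijk by (cases v) simp_all
      ultimately show "coords l Lw + of_nat i * coords l Lx + of_nat j * coords l Ly
          + of_nat k * coords l Lz \<noteq> 0"
        by (rule ne)
    qed
  qed
  have "\<exists>N r. Xw ^ N - r * indet v \<in> ?J" if v: "v \<noteq> Lw" for v
  proof -
    obtain N where "Xw ^ N \<in> add_generator ?J (indet v)"
      using *[OF v] by blast
    then obtain j r where "j \<in> ?J" "Xw ^ N = j + r * indet v"
      unfolding add_generator_iff[OF J] by blast
    then show ?thesis
      by (metis add_diff_cancel_right')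
  qed
  then obtain N r where Nr: "\<And>v. v \<noteq> Lw \<Longrightarrow> Xw ^ N v - r v * indet v \<in> ?J"
    by metis
  have "Xw ^ N Lx * Xw ^ N Ly * Xw ^ N Lz - r Lx * Xx * (r Ly * Xy) * (r Lz * Xz) \<in> ?J"
    by (intro ideal_mult_diff[OF J] Nr) simp_all
  moreover have "r Lx * Xx * (r Ly * Xy) * (r Lz * Xz) = r Lx * r Ly * r Lz * (Xx * Xy * Xz)"
    by (simp add: mult_ac)
  ultimately have "Xw ^ (N Lx + N Ly + N Lz) \<in> ?J"
    using ideal_diff_mem[OF J] ideal_mult[OF J G(2)] by (metis power_add)
  then show ?thesis
    using artinian_if_power_w[OF J _ F] by blast
qed

section \<open>General hyperplane sections\<close>

interpretation pencil: coeff_hom "\<lambda>c :: 'k::field. [:c:]"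
  by standard simp_all

lemma poly_pencil:
  "poly (pencil.insertion (\<lambda>v. [:a v, b v - a v:]) p) s = evalp p (\<lambda>v. a v + s * (b v - a v :: 'k::field))"
  by (induction p rule: poly_induct_ring) simp_all

text \<open>Two nonempty open sets meet: on the affine line from \<open>a\<close> (at s = 0) to
  \<open>b\<close> (at s = 1) both polynomials restrict to nonzero univariate ones, whose product
  has finitely many roots.\<close>

lemma common_nonzero:
  assumes inf: "infinite (UNIV :: 'k::field set)" and "evalp f a \<noteq> (0::'k)" "evalp g b \<noteq> 0"
  shows "\<exists>c. evalp f c \<noteq> 0 \<and> evalp g c \<noteq> 0"
proof -
  let ?P = "pencil.insertion (\<lambda>v. [:a v, b v - a v:])"
  have "poly (?P f) 0 \<noteq> 0" "poly (?P g) 1 \<noteq> 0"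
    using assms by (simp_all add: poly_pencil)
  then have "?P f * ?P g \<noteq> 0"
    by auto
  then have "finite {s. poly (?P f * ?P g) s = 0}"
    by (rule poly_roots_finite)
  then obtain s where "poly (?P f * ?P g) s \<noteq> 0"
    using ex_new_if_finite[OF inf] by blast
  then show ?thesis
    by (auto simp: poly_pencil)
qed

lemma coords_linear: "coords (\<Sum>v\<in>UNIV. const (c v) * indet v) = (c :: letter \<Rightarrow> 'k::field)"
proof
  fix u
  have "Poly_Mapping.single v (1::nat) = Poly_Mapping.single u 1 \<longleftrightarrow> v = u" for v u :: letter
    by (metis lookup_single_eq lookup_single_not_eq zero_neq_one)
  then show "coords (\<Sum>v\<in>UNIV. const (c v) * indet v) u = c u"
    by (simp add: coords_def lookup_sum lookup_const_mult indet_def lookup_single when_def if_distrib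
        cong: if_cong)
qed

definition grid_prod :: "nat \<Rightarrow> (letter \<Rightarrow> 'a::comm_ring_1) \<Rightarrow> letter \<Rightarrow> 'a" where
  "grid_prod n P v = (\<Prod>i<n. (P v - of_nat i * P Lw))"

text \<open>The open set is the complement of \<open>D * A\<close> = 0: \<open>D\<close> guards the
  determinant and the coefficient of w, \<open>A\<close> guards the Artinian property. Each is shown
  nonzero at a form of its own, which suffices since nonempty open sets meet. \<alpha> and \<beta>
  are fixed before \<open>l\<close> varies.\<close>

lemma general_section_weak_Lefschetz:
  assumes inf: "infinite (UNIV :: 'k::field set)" and t: "t \<ge> 1"
  shows "for_general_linear_form (\<lambda>l :: 'k poly4. weak_Lefschetz (add_generator (lifted_ideal t) l))"
proof -
  note new = ex_new_if_finite[OF inf]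
  \<comment> \<open>The excluded values make 1 - i q, \<alpha> - i and \<beta> - i (\<beta> -
    \<alpha> q) nonzero for i \<le> t. If i = 1 in K, the last equals \<alpha> q, which is nonzero
    already.\<close>
  obtain q :: 'k where q: "q \<notin> insert 0 ((\<lambda>i. inverse (of_nat i)) ` {..t})"
    using new[of "insert 0 ((\<lambda>i. inverse (of_nat i)) ` {..t})"] by blast
  obtain \<alpha> :: 'k where \<alpha>: "\<alpha> \<notin> insert 0 (of_nat ` {..t})"
    using new[of "insert 0 (of_nat ` {..t})"] by blast
  obtain \<beta> :: 'k where \<beta>: "\<beta> \<notin> insert 0 ((\<lambda>i. - (of_nat i * \<alpha> * q) / (1 - of_nat i)) ` {..t})"
    using new[of "insert 0 ((\<lambda>i. - (of_nat i * \<alpha> * q) / (1 - of_nat i)) ` {..t})"] by blast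
  have "1 - of_nat i * q \<noteq> 0" if "i < Suc t" for i
  proof
    assume "1 - of_nat i * q = 0"
    then have "inverse (of_nat i) = q"
      by (intro inverse_unique) simp
    then show False
      using q that by auto
  qed
  moreover have "\<alpha> - of_nat i \<noteq> 0" if "i < Suc t" for i
    using \<alpha> that by auto
  moreover have "\<beta> - of_nat i * (\<beta> - \<alpha> * q) \<noteq> 0" if "i < Suc t" for i
  proof
    assume eq: "\<beta> - of_nat i * (\<beta> - \<alpha> * q) = 0"
    then have *: "\<beta> * (1 - of_nat i) = - (of_nat i * \<alpha> * q)"
      by (simp add: algebra_simps)
    show False
    proof (cases "of_nat i = (1::'k)")
      case True
      then show False
        using * \<alpha> q by simp
    next
      case False
      then have "\<beta> = - (of_nat i * \<alpha> * q) / (1 - of_nat i)"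
        using * by (subst eq_divide_eq) auto
      then show False
        using \<beta> that by auto
    qed
  qed
  ultimately have ne: "(\<Prod>i<Suc t. (1 - of_nat i * q)) \<noteq> 0" "(\<Prod>i<Suc t. (\<alpha> - of_nat i)) \<noteq> 0"
      "(\<Prod>i<Suc t. (\<beta> - of_nat i * (\<beta> - \<alpha> * q))) \<noteq> 0"
    by (simp_all only: prod_zero_iff finite_lessThan lessThan_iff) blast+
  have zero: "(\<Prod>i<Suc t. (1 - of_nat i)) = (0 :: 'k)"
    by (rule prod_zero) (use t in \<open>auto intro!: bexI[of _ 1]\<close>)
  \<comment> \<open>The three points for an indeterminate linear form: here the letters w, x, y, z
    stand for the coefficients of \<open>l\<close>.\<close>
  define p1 p2 p3 :: "letter \<Rightarrow> 'k poly4" where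
    "p1 = (\<lambda>v. case v of Lw \<Rightarrow> - (Xy + const \<beta> * Xz) | Lx \<Rightarrow> 0 | Ly \<Rightarrow> Xw | Lz \<Rightarrow> const \<beta> * Xw)"
    and "p2 = (\<lambda>v. case v of Lw \<Rightarrow> - (Xx + const \<alpha> * Xz) | Lx \<Rightarrow> Xw | Ly \<Rightarrow> 0 | Lz \<Rightarrow> const \<alpha> * Xw)"
    and "p3 = (\<lambda>v. case v of Lw \<Rightarrow> const \<alpha> * Xy - const \<beta> * Xx | Lx \<Rightarrow> const \<beta> * Xw
      | Ly \<Rightarrow> - const \<alpha> * Xw | Lz \<Rightarrow> 0)"
  define D where "D = Xw * (grid_prod (Suc t) p1 Ly * grid_prod (Suc t) p2 Lz * grid_prod (Suc t) p3 Lx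
    + grid_prod (Suc t) p1 Lz * grid_prod (Suc t) p2 Lx * grid_prod (Suc t) p3 Ly)"
  define A :: "'k poly4" where
    "A = (\<Prod>i<Suc t. \<Prod>j<Suc t. \<Prod>k<Suc t. (Xw + of_nat i * Xx + of_nat j * Xy + of_nat k * Xz))"
  \<comment> \<open>The coefficients of w - x - q y. Its points are (q : 0 : 1 : \<beta>), (1 : 1 :
    0 : \<alpha>) and (\<beta> - \<alpha> q : \<beta> : - \<alpha> : 0).\<close>
  define a0 where "a0 = (\<lambda>v. case v of Lw \<Rightarrow> 1 | Lx \<Rightarrow> -1 | Ly \<Rightarrow> -q | Lz \<Rightarrow> (0::'k))"
  have D0: "evalp D a0 \<noteq> 0"
  proof -
    have "evalp D a0 = (\<Prod>i<Suc t. (1 - of_nat i * q)) * (\<Prod>i<Suc t. (\<alpha> - of_nat i))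
        * (\<Prod>i<Suc t. (\<beta> - of_nat i * (\<beta> - \<alpha> * q)))
        + (\<Prod>i<Suc t. (\<beta> - of_nat i * q)) * (\<Prod>i<Suc t. (1 - of_nat i))
        * (\<Prod>i<Suc t. (- \<alpha> - of_nat i * (\<beta> - \<alpha> * q)))"
      by (simp add: D_def grid_prod_def p1_def p2_def p3_def a0_def del: prod.lessThan_Suc)
    then show ?thesis
      using ne unfolding zero mult_zero_right mult_zero_left add_0_right by (simp only: mult_eq_0_iff) blast
  qed
  have A0: "evalp A (\<lambda>v. if v = Lw then 1 else 0) \<noteq> 0"
    by (simp add: A_def del: prod.lessThan_Suc)
  define U where "U = forms 1 - {l \<in> forms 1. \<forall>f\<in>{D * A}. evalp f (coords l) = 0}"
  have "zariski_open_forms U"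
    unfolding U_def zariski_open_forms_def by blast
  moreover have "U \<noteq> {}"
  proof -
    obtain c where c: "evalp D c \<noteq> 0" "evalp A c \<noteq> 0"
      using common_nonzero[OF inf D0 A0] by blast
    have "(\<Sum>v\<in>UNIV. const (c v) * indet v) \<in> forms 1"
      by (intro forms_sum forms_const_mult forms_indet)
    then have "(\<Sum>v\<in>UNIV. const (c v) * indet v) \<in> U"
      using c by (auto simp: U_def coords_linear)
    then show ?thesis
      by blast
  qed
  moreover have "weak_Lefschetz (add_generator (lifted_ideal t) l)" if "l \<in> U" for l
  proof -
    have l: "l \<in> forms 1" and Dl: "evalp D (coords l) \<noteq> 0" and Al: "evalp A (coords l) \<noteq> 0"
      using that by (auto simp: U_def)
    interpret line l \<alpha> \<beta>
      by standard (use l Dl \<alpha> \<beta> in \<open>auto simp: D_def\<close>)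
    show ?thesis
    proof (rule weak_Lefschetz_cut[OF t])
      have "evalp (grid_prod (Suc t) p1 v) (coords l) = evalp (lift_power (Suc t) v) P1"
        "evalp (grid_prod (Suc t) p2 v) (coords l) = evalp (lift_power (Suc t) v) P2"
        "evalp (grid_prod (Suc t) p3 v) (coords l) = evalp (lift_power (Suc t) v) P3" for v
        unfolding evalp_lift_power grid_prod_def
        by (cases v; simp add: p1_def p2_def p3_def del: prod.lessThan_Suc)+
      then show "evalp (lift_power (Suc t) Ly) P1 * evalp (lift_power (Suc t) Lz) P2 * evalp (lift_power (Suc t) Lx) P3
          + evalp (lift_power (Suc t) Lz) P1 * evalp (lift_power (Suc t) Lx) P2 * evalp (lift_power (Suc t) Ly) P3 \<noteq> 0"
        using Dl by (simp add: D_def del: P_simps)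
      show "artinian_ring (quotient_ring (add_generator (lifted_ideal t) l))"
      proof (rule artinian_lifted_cut[OF l])
        fix i j k
        assume "i \<le> t" "j \<le> t" "k \<le> t"
        then show "coords l Lw + of_nat i * coords l Lx + of_nat j * coords l Ly + of_nat k * coords l Lz \<noteq> 0"
          using Al by (simp add: A_def prod_zero_iff less_Suc_eq_le Bex_def del: prod.lessThan_Suc)
      qed
    qed
  qed
  ultimately show ?thesis
    unfolding for_general_linear_form_def by blast
qed

section \<open>The hyperplane section at infinity\<close>

definition monomial_gens :: "nat \<Rightarrow> 'k::field poly4 set" where
  "monomial_gens t = {Xw, Xx ^ Suc t, Xy ^ Suc t, Xz ^ Suc t, Xx * Xy * Xz}"

lemma section_at_infinity_eq:
  "add_generator (lifted_ideal t) Xw = ideal_of (monomial_gens t :: 'k::field poly4 set)"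
proof -
  have eq: "add_generator (lifted_ideal t) (Xw :: 'k poly4) = ideal_of (insert Xw (lifted_gens t))"
    by (simp add: lifted_ideal_eq add_generator_ideal_of)
  show ?thesis
    unfolding eq
  proof (intro equalityI ideal_of_least ideal_ideal_of subsetI)
    fix s :: "'k poly4"
    let ?J = "ideal_of (monomial_gens t :: 'k poly4 set)"
    have J: "ideal ?J polyring"
      by (rule ideal_ideal_of)
    have w: "Xw \<in> ?J"
      by (rule mem_ideal_of) (simp add: monomial_gens_def)
    have "lift_power (Suc t) v \<in> ?J" if "v \<noteq> Lw" for v
    proof (rule ideal_diff_mem[OF J])
      show "lift_power (Suc t) v - indet v ^ Suc t \<in> ?J"
        by (rule ideal_diff_commute[OF J power_minus_lift_power[OF J w]])
      show "indet v ^ Suc t \<in> ?J"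
        by (rule mem_ideal_of) (use that in \<open>cases v; simp add: monomial_gens_def\<close>)
    qed
    moreover assume "s \<in> insert Xw (lifted_gens t)"
    ultimately show "s \<in> ?J"
      using w by (auto simp: lifted_gens_def monomial_gens_def intro: mem_ideal_of)
  next
    fix s :: "'k poly4"
    let ?J = "ideal_of (insert Xw (lifted_gens t) :: 'k poly4 set)"
    have J: "ideal ?J polyring"
      by (rule ideal_ideal_of)
    have w: "Xw \<in> ?J"
      by (rule mem_ideal_of) simp
    have "indet v ^ Suc t \<in> ?J" if "v \<noteq> Lw" for v
    proof (rule ideal_diff_mem[OF J power_minus_lift_power[OF J w]])
      show "lift_power (Suc t) v \<in> ?J"
        by (rule mem_ideal_of) (use that in \<open>cases v; simp add: lifted_gens_def\<close>)
    qed
    moreover have "Xx * Xy * Xz \<in> ?J"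
      by (rule mem_ideal_of) (simp add: lifted_gens_def)
    moreover assume "s \<in> monomial_gens t"
    ultimately show "s \<in> ?J"
      using w unfolding monomial_gens_def by (metis empty_iff insert_iff letter.distinct)
  qed
qed

definition killed :: "nat \<Rightarrow> (letter \<Rightarrow>\<^sub>0 nat) \<Rightarrow> bool" where
  "killed t m \<longleftrightarrow> Poly_Mapping.lookup m Lw \<ge> 1 \<or> Poly_Mapping.lookup m Lx \<ge> Suc t \<or>
     Poly_Mapping.lookup m Ly \<ge> Suc t \<or> Poly_Mapping.lookup m Lz \<ge> Suc t \<or>
     Poly_Mapping.lookup m Lx \<ge> 1 \<and> Poly_Mapping.lookup m Ly \<ge> 1 \<and> Poly_Mapping.lookup m Lz \<ge> 1"

lemma killed_single_cases:
  assumes "killed t m"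
  obtains (w) r where "Poly_Mapping.single m (c :: 'k::field) = Xw * r"
  | (power) v n where "v \<noteq> Lw" "Poly_Mapping.single m c = indet v ^ Suc t * Poly_Mapping.single n c"
      "mdeg m = Suc t + mdeg n"
  | (xyz) r where "Poly_Mapping.single m c = Xx * Xy * Xz * r"
proof -
  consider "Poly_Mapping.lookup m Lw \<ge> 1" | v where "v \<noteq> Lw" "Poly_Mapping.lookup m v \<ge> Suc t"
    | "Poly_Mapping.lookup m Lx \<ge> 1" "Poly_Mapping.lookup m Ly \<ge> 1" "Poly_Mapping.lookup m Lz \<ge> 1"
    using assms unfolding killed_def by (metis letter.distinct)
  then show thesis
  proof cases
    case 1
    show thesis
    proof (rule w)
      show "Poly_Mapping.single m c = Xw * Poly_Mapping.single (m - Poly_Mapping.single Lw 1) c"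
        using single_eq_indet_power_mult[OF 1, of c] by simp
    qed
  next
    case 2
    let ?n = "m - Poly_Mapping.single v (Suc t)"
    have "m = Poly_Mapping.single v (Suc t) + ?n"
      by (rule poly_mapping_eqI) (use 2 in \<open>auto simp: lookup_add lookup_minus lookup_single when_def\<close>)
    then have "mdeg m = Suc t + mdeg ?n"
      by (metis mdeg_add mdeg_single)
    then show thesis
      using power 2(1) single_eq_indet_power_mult[OF 2(2), of c] by blast
  next
    case 3
    let ?m1 = "m - Poly_Mapping.single Lx 1"
    let ?m2 = "?m1 - Poly_Mapping.single Ly 1"
    have y: "1 \<le> Poly_Mapping.lookup ?m1 Ly" and z: "1 \<le> Poly_Mapping.lookup ?m2 Lz"
      using 3 by (simp_all add: lookup_minus lookup_single)
    show thesis
    proof (rule xyz)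
      show "Poly_Mapping.single m c = Xx * Xy * Xz * Poly_Mapping.single (?m2 - Poly_Mapping.single Lz 1) c"
        using single_eq_indet_power_mult[OF 3(1), of c] single_eq_indet_power_mult[OF y, of c]
          single_eq_indet_power_mult[OF z, of c] by (simp add: mult.assoc)
    qed
  qed
qed

lemma section_at_infinity_iff:
  "p \<in> add_generator (lifted_ideal t) Xw \<longleftrightarrow>
     (\<forall>m. Poly_Mapping.lookup p m \<noteq> (0 :: 'k::field) \<longrightarrow> killed t m)"
proof
  let ?K = "{p :: 'k poly4. \<forall>m. Poly_Mapping.lookup p m \<noteq> 0 \<longrightarrow> killed t m}"
  have "ideal ?K polyring"
  proof (rule ideal_polyringI)
    fix a b
    assume "a \<in> ?K" "b \<in> ?K"
    then show "a + b \<in> ?K"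
      by (auto simp: lookup_add) (metis add.right_neutral)
  next
    fix r a
    assume a: "a \<in> ?K"
    have "killed t m" if m: "Poly_Mapping.lookup (r * a) m \<noteq> 0" for m
    proof -
      obtain m1 m2 where "m = m1 + m2" "m2 \<in> Poly_Mapping.keys a"
        using m keys_mult[of r a] unfolding in_keys_iff[symmetric] by blast
      then show ?thesis
        using a by (auto simp: killed_def lookup_add in_keys_iff)
    qed
    then show "r * a \<in> ?K"
      by blast
  qed simp
  moreover have "monomial_gens t \<subseteq> ?K"
    unfolding monomial_gens_def indet_power
    by (auto simp: indet_def mult_single killed_def lookup_single lookup_add when_def split: if_splits)
  ultimately have "ideal_of (monomial_gens t) \<subseteq> ?K"
    by (rule ideal_of_least)
  then show "p \<in> add_generator (lifted_ideal t) Xw \<Longrightarrow> \<forall>m. Poly_Mapping.lookup p m \<noteq> 0 \<longrightarrow> killed t m"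
    unfolding section_at_infinity_eq by blast
next
  let ?J = "ideal_of (monomial_gens t) :: 'k poly4 set"
  have J: "ideal ?J polyring"
    by (rule ideal_ideal_of)
  have gen: "g * r \<in> ?J" if "g \<in> monomial_gens t" for g r
    by (rule ideal_mult_right[OF J mem_ideal_of[OF that]])
  have single: "Poly_Mapping.single m c \<in> ?J" if "killed t m" for m c
    using that
  proof (cases rule: killed_single_cases[where c = c])
    case (w r)
    then show ?thesis
      using gen[of Xw] by (simp add: monomial_gens_def)
  next
    case (power v n)
    have "indet v ^ Suc t \<in> monomial_gens t"
      using power(1) by (cases v) (simp_all add: monomial_gens_def)
    then show ?thesis
      unfolding power(2) by (rule gen)
  next
    case (xyz r)
    then show ?thesis
      using gen[of "Xx * Xy * Xz"] by (simp add: monomial_gens_def)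
  qed
  assume p: "\<forall>m. Poly_Mapping.lookup p m \<noteq> 0 \<longrightarrow> killed t m"
  have "(\<Sum>m\<in>Poly_Mapping.keys p. Poly_Mapping.single m (Poly_Mapping.lookup p m)) \<in> ?J"
    by (rule ideal_sum[OF J]) (use p in \<open>auto simp: in_keys_iff intro: single\<close>)
  then show "p \<in> add_generator (lifted_ideal t) Xw"
    unfolding section_at_infinity_eq using poly_sum_single[of p] by simp
qed

lemma coords_Xw: "coords (Xw :: 'k::field poly4) = (\<lambda>v. if v = Lw then 1 else 0)"
proof -
  have "(\<Sum>v\<in>UNIV. const (if v = Lw then 1 else 0) * indet v) = (Xw :: 'k poly4)"
    by (simp add: sum_letters)
  then show ?thesis
    using coords_linear[of "\<lambda>v. if v = Lw then 1 else (0::'k)"] by simp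
qed

lemma artinian_section_at_infinity:
  "artinian_ring (quotient_ring (add_generator (lifted_ideal t) (Xw :: 'k::field poly4)))"
  by (rule artinian_lifted_cut) (simp_all add: coords_Xw del: One_nat_def)

text \<open>For L = x + y + z the points are (0 : 0 : 1 : -1), (0 : 1 : 0 : -1) and (0 : -1 : 1 :
  0), and the two triple products are 1 and (-1)^(t + 1). For odd t their sum is 2.\<close>

lemma section_at_infinity_weak_Lefschetz:
  assumes t: "t \<ge> 1" and "odd t" "(2 :: 'k::field) \<noteq> 0"
  shows "weak_Lefschetz (add_generator (lifted_ideal t) (Xw :: 'k poly4))"
proof -
  interpret line "Xw :: 'k poly4" "-1" "-1"
    by standard (simp_all add: coords_Xw del: One_nat_def)
  show ?thesis
  proof (rule weak_Lefschetz_cut[OF t])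
    have "even (Suc t)"
      using assms by simp
    then show "evalp (lift_power (Suc t) Ly) P1 * evalp (lift_power (Suc t) Lz) P2 * evalp (lift_power (Suc t) Lx) P3
        + evalp (lift_power (Suc t) Lz) P1 * evalp (lift_power (Suc t) Lx) P2 * evalp (lift_power (Suc t) Ly) P3 \<noteq> 0"
      using assms(3) by (simp add: evalp_lift_power coords_Xw del: prod.lessThan_Suc power_Suc)
  qed (rule artinian_section_at_infinity)
qed

section \<open>Failure of maximal rank at infinity when (-1)^t = 1 in K\<close>

primrec alt_sum :: "nat \<Rightarrow> 'a::comm_ring_1 \<Rightarrow> 'a \<Rightarrow> 'a" where
  "alt_sum 0 p q = 1"
| "alt_sum (Suc t) p q = p * alt_sum t p q + (- 1) ^ Suc t * q ^ Suc t"

text \<open>\<open>alt_sum t p q\<close> is p^t - p^(t-1) q + ... + (-1)^t q^t, and the product with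
  p + q telescopes.\<close>

lemma add_mult_alt_sum: "(p + q) * alt_sum t p q = p ^ Suc t + (- 1) ^ t * q ^ Suc t"
proof (induction t)
  case (Suc t)
  have "(p + q) * alt_sum (Suc t) p q = p * ((p + q) * alt_sum t p q) + (p + q) * ((- 1) ^ Suc t * q ^ Suc t)"
    by (simp add: algebra_simps)
  then show ?case
    unfolding Suc by (simp add: algebra_simps)
qed simp

text \<open>For t \<ge> 1 the two end terms are distinct and every other term is divisible by pq.
  Multiplied by the third variable, these inner terms become multiples of pqr.\<close>

lemma alt_sum_ends:
  assumes "t \<ge> 1"
  shows "\<exists>a. alt_sum t p q = p ^ t + (- 1) ^ t * q ^ t + p * q * a"
  using assms
proof (induction t rule: dec_induct)
  case base
  show ?case
    by (rule exI[of _ 0]) simp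
next
  case (step t)
  then obtain a s where "alt_sum t p q = p ^ t + (- 1) ^ t * q ^ t + p * q * a" "t = Suc s"
    by (metis Suc_le_D One_nat_def)
  then have "alt_sum (Suc t) p q = p ^ Suc t + (- 1) ^ Suc t * q ^ Suc t + p * q * ((- 1) ^ t * q ^ s + p * a)"
    by (simp add: algebra_simps)
  then show ?case
    by blast
qed

lemma evalp_alt_sum: "evalp (alt_sum t p q) a = alt_sum t (evalp p a) (evalp q a)"
  by (induction t) simp_all

lemma forms_alt_sum:
  assumes "p \<in> forms 1" "q \<in> forms 1"
  shows "alt_sum t p q \<in> forms t"
proof (induction t)
  case 0
  then show ?case
    using forms_const[of 1] by simp
next
  case (Suc t)
  have "p * alt_sum t p q \<in> forms (Suc t)"
    using forms_mult[OF assms(1) Suc] by simp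
  moreover have "q ^ Suc t \<in> forms (Suc t)"
    using forms_power[OF assms(2), of "Suc t"] by simp
  ultimately have "p * alt_sum t p q + const ((- 1) ^ Suc t) * q ^ Suc t \<in> forms (Suc t)"
    by (intro forms_add forms_const_mult)
  then show ?case
    by (simp add: const_power const_uminus const_mult)
qed

text \<open>The alternating sums run along the three sides of a triangle with corners p^t, q^t, r^t.
  If (-1)^t = 1, each corner occurs in two sides with coefficient one, so one copy is
  subtracted.\<close>

definition kernel_form :: "nat \<Rightarrow> 'a::comm_ring_1 \<Rightarrow> 'a \<Rightarrow> 'a \<Rightarrow> 'a" where
  "kernel_form t p q r = alt_sum t p q + alt_sum t q r + alt_sum t r p - p ^ t - q ^ t - r ^ t"

text \<open>In degree \<open>t\<close> and \<open>t + 1\<close> the monomials outside the ideal \<open>(x\<^sup>t\<^sup>+\<^sup>1, y\<^sup>t\<^sup>+\<^sup>1, z\<^sup>t\<^sup>+\<^sup>1, xyz)\<close> are the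
  vertices and edges of a cycle of length \<open>3t\<close>, and multiplication by a linear form sends a vertex to a
  combination of the two adjacent edges. Signs alternating around the cycle, which are consistent
  only if \<open>(-1)\<^sup>t = 1\<close>, give the kernel.\<close>

lemma kernel_form_mult:
  fixes p q r :: "'a::comm_ring_1"
  assumes t: "t \<ge> 1" and sign: "(- 1) ^ t = (1 :: 'a)"
  shows "\<exists>a. (p + q + r) * kernel_form t p q r = p ^ Suc t + q ^ Suc t + r ^ Suc t + p * q * r * a"
proof -
  obtain a b c where abc: "alt_sum t p q = p ^ t + q ^ t + p * q * a"
    "alt_sum t q r = q ^ t + r ^ t + q * r * b" "alt_sum t r p = r ^ t + p ^ t + r * p * c"
    using alt_sum_ends[OF t, of p q] alt_sum_ends[OF t, of q r] alt_sum_ends[OF t, of r p]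
    unfolding sign mult_1 by blast
  have "(p + q + r) * kernel_form t p q r =
      ((p + q) * alt_sum t p q + r * alt_sum t p q) + ((q + r) * alt_sum t q r + p * alt_sum t q r)
      + ((r + p) * alt_sum t r p + q * alt_sum t r p) - (p + q + r) * (p ^ t + q ^ t + r ^ t)"
    by (simp add: kernel_form_def algebra_simps)
  also have "\<dots> = p ^ Suc t + q ^ Suc t + r ^ Suc t + p * q * r * (a + b + c)"
    unfolding add_mult_alt_sum sign unfolding abc by (simp add: algebra_simps)
  finally show ?thesis
    by blast
qed

lemma kernel_form_axis:
  fixes p :: "'a::comm_ring_1"
  assumes t: "t \<ge> 1" and sign: "(- 1) ^ t = (1 :: 'a)"
  shows "kernel_form t p 0 0 = p ^ t" "kernel_form t 0 p 0 = p ^ t" "kernel_form t 0 0 p = p ^ t"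
proof -
  have "alt_sum t q 0 = q ^ t" "alt_sum t 0 q = q ^ t" for q :: 'a
    using alt_sum_ends[OF t, of q 0] alt_sum_ends[OF t, of 0 q] t sign by (auto simp: zero_power)
  then show "kernel_form t p 0 0 = p ^ t" "kernel_form t 0 p 0 = p ^ t" "kernel_form t 0 0 p = p ^ t"
    using t by (simp_all add: kernel_form_def zero_power)
qed

text \<open>A test for lying outside the ideal. In degree t the generators of degree t + 1 do not
  contribute, and the others vanish at the coordinate points of x, y and z.\<close>

lemma section_at_infinity_axis:
  assumes f: "f \<in> add_generator (lifted_ideal t) Xw" "f \<in> forms t" and u: "u \<noteq> Lw"
  shows "evalp f (\<lambda>v. if v = u then 1 else 0) = (0 :: 'k::field)"
proof -
  let ?K = "{p :: 'k poly4. evalp p (\<lambda>v. if v = u then 1 else 0) = 0}"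
  have K: "ideal ?K polyring"
    by (rule ideal_polyringI) auto
  have "hcomp t f \<in> ?K"
  proof (rule hcomp_ideal_of[OF K, where D = "{..t}" and S = "monomial_gens t"])
    fix s :: "'k poly4" and d
    assume s: "s \<in> monomial_gens t" and d: "d \<in> {..t}"
    show "hcomp d s \<in> ?K"
    proof (cases "s \<in> {Xw, Xx * Xy * Xz}")
      case True
      then have "s \<in> ?K"
        using u by (cases u) auto
      moreover have "hcomp d s = s \<or> hcomp d s = 0"
        using True hcomp_form[OF forms_indet[of Lw], of d, where 'a = 'k]
          hcomp_form[OF xyz_forms, of d, where 'a = 'k] by auto
      ultimately show ?thesis
        by auto
    next
      case False
      then obtain v where "s = indet v ^ Suc t"
        using s by (auto simp: monomial_gens_def)
      then have "s \<in> forms (Suc t)"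
        using forms_power[OF forms_indet[of v], of "Suc t"] by simp
      then show ?thesis
        using hcomp_form[of s "Suc t" d] d by simp
    qed
  qed (use f in \<open>auto simp: section_at_infinity_eq\<close>)
  then show ?thesis
    using hcomp_form[OF f(2), of t] by simp
qed

text \<open>In \<open>L * f\<close> the monomial v s^n arises only as v times s^n or as s times v
  s^(n-1), and \<open>L\<close> has no term in s.\<close>

lemma lookup_linear_mult:
  assumes L: "L \<in> forms 1" and v: "v \<noteq> s" "coords L s = 0"
  shows "Poly_Mapping.lookup (L * f) (Poly_Mapping.single v 1 + Poly_Mapping.single s n) =
    coords L v * Poly_Mapping.lookup f (Poly_Mapping.single s n :: letter \<Rightarrow>\<^sub>0 nat)"
proof -
  have none: "Poly_Mapping.lookup (indet u * f) m = 0" if "Poly_Mapping.lookup m u = 0" for u m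
  proof (induction f rule: poly_single_induct)
    case (single n c)
    have "Poly_Mapping.single u 1 + n \<noteq> m"
      using that by (auto simp: lookup_add)
    then show ?case
      by (simp add: indet_mult_single lookup_single when_def)
  qed (simp_all add: algebra_simps lookup_add)
  let ?m = "Poly_Mapping.single v 1 + Poly_Mapping.single s n"
  have zero: "coords L u * Poly_Mapping.lookup (indet u * f) ?m = 0" if "u \<noteq> v" for u
    using none[of ?m u] that v by (cases "u = s") (simp_all add: lookup_add lookup_single when_def)
  have "L * f = (\<Sum>u\<in>UNIV. const (coords L u) * (indet u * f))"
    by (subst (1) forms_1_expand[OF L]) (simp add: sum_distrib_right mult.assoc)
  then have "Poly_Mapping.lookup (L * f) ?m = (\<Sum>u\<in>UNIV. coords L u * Poly_Mapping.lookup (indet u * f) ?m)"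
    by (simp add: lookup_sum lookup_const_mult)
  also have "\<dots> = coords L v * Poly_Mapping.lookup (indet v * f) ?m"
    by (rule sum.remove[of UNIV v, THEN trans]) (use zero in \<open>simp_all add: sum.neutral\<close>)
  finally show ?thesis
    by (simp only: lookup_indet_mult)
qed

text \<open>Inserting the terms of \<open>L\<close> in x, y and z for p, q and r adapts the kernel
  to \<open>L\<close>. At the coordinate points it takes the t-th powers of their coefficients as
  values, so it lies outside the ideal unless all three vanish. In that case \<open>L\<close> is a
  multiple of w, and x^t serves.\<close>

lemma section_at_infinity_not_injective:
  fixes L :: "'k::field poly4"
  assumes t: "t \<ge> 1" and sign: "(- 1) ^ t = (1 :: 'k)" and L: "L \<in> forms 1"
  shows "\<exists>f\<in>forms t. L * f \<in> add_generator (lifted_ideal t) Xw \<and> f \<notin> add_generator (lifted_ideal t) Xw"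
proof -
  let ?J = "add_generator (lifted_ideal t) (Xw :: 'k poly4)"
  have J: "ideal ?J polyring"
    by (rule ideal_add_generator)
  have gens: "s \<in> ?J" if "s \<in> monomial_gens t" for s
    unfolding section_at_infinity_eq using that by (rule mem_ideal_of)
  let ?p = "const (coords L Lx) * Xx" and ?q = "const (coords L Ly) * Xy" and ?r = "const (coords L Lz) * Xz"
  have L_eq: "L = const (coords L Lw) * Xw + (?p + ?q + ?r)"
    using linear_form_eq[OF L] by (simp add: add_ac)
  have w: "const (coords L Lw) * Xw * f \<in> ?J" for f
    using gens[of Xw] by (intro ideal_mult_right[OF J] ideal_mult[OF J]) (simp add: monomial_gens_def)
  have sign': "(- 1) ^ t = (1 :: 'k poly4)"
    using arg_cong[OF sign, of const] by (simp add: const_power const_uminus)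
  have forms1: "?p \<in> forms 1" "?q \<in> forms 1" "?r \<in> forms 1"
    by (intro forms_const_mult forms_indet)+
  show ?thesis
  proof (cases "coords L Lx = 0 \<and> coords L Ly = 0 \<and> coords L Lz = 0")
    case True
    have "L = const (coords L Lw) * Xw"
      using L_eq True by simp
    then have "L * Xx ^ t \<in> ?J"
      using w[of "Xx ^ t"] by simp
    moreover have form: "Xx ^ t \<in> forms t"
      using forms_power[OF forms_indet, of Lx t] by simp
    moreover have "Xx ^ t \<notin> ?J"
      using section_at_infinity_axis[OF _ form, of Lx] by auto
    ultimately show ?thesis
      by blast
  next
    case False
    define f where "f = kernel_form t ?p ?q ?r"
    obtain a where a: "(?p + ?q + ?r) * f = ?p ^ Suc t + ?q ^ Suc t + ?r ^ Suc t + ?p * ?q * ?r * a"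
      using kernel_form_mult[OF t sign'] unfolding f_def by blast
    have pow: "(const c * indet v) ^ Suc t \<in> ?J" if "v \<noteq> Lw" for c v
    proof -
      have "indet v ^ Suc t \<in> ?J"
        by (rule gens) (use that in \<open>cases v; simp add: monomial_gens_def\<close>)
      then show ?thesis
        unfolding power_mult_distrib by (rule ideal_mult[OF J])
    qed
    have xyz: "Xx * Xy * Xz \<in> ?J"
      by (rule gens) (simp add: monomial_gens_def)
    have "?p * ?q * ?r * a = (const (coords L Lx) * const (coords L Ly) * const (coords L Lz) * a) * (Xx * Xy * Xz)"
      by (simp add: mult_ac)
    then have "?p * ?q * ?r * a \<in> ?J"
      by (simp only: ideal_mult[OF J xyz])
    then have "(?p + ?q + ?r) * f \<in> ?J"
      unfolding a by (intro ideal_add[OF J] pow) simp_all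
    then have "L * f \<in> ?J"
      using w[of f] by (subst L_eq) (simp only: distrib_right[of _ "?p + ?q + ?r"] ideal_add[OF J])
    moreover have form: "f \<in> forms t"
      unfolding f_def kernel_form_def
      using forms_power[OF forms1(1), of t] forms_power[OF forms1(2), of t] forms_power[OF forms1(3), of t]
      by (intro forms_diff forms_add forms_alt_sum forms1) simp_all
    moreover have "f \<notin> ?J"
    proof
      assume "f \<in> ?J"
      note axis = section_at_infinity_axis[OF this form]
      have ev: "evalp f a = kernel_form t (coords L Lx * a Lx) (coords L Ly * a Ly) (coords L Lz * a Lz)" for a
        by (simp add: f_def kernel_form_def evalp_alt_sum)
      have "coords L Lx ^ t = 0" "coords L Ly ^ t = 0" "coords L Lz ^ t = 0"
        using axis[of Lx] axis[of Ly] axis[of Lz] by (simp_all add: ev kernel_form_axis[OF t sign])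
      then show False
        using False by simp
    qed
    ultimately show ?thesis
      by blast
  qed
qed

text \<open>A variable \<open>s\<close> missing in \<open>L\<close> ties two coefficients of the
  image together. If x, y and z all occur, a linear functional vanishes on the image and on the
  ideal in degree t + 1, but not on x^t y.\<close>

lemma section_at_infinity_not_surjective:
  fixes L :: "'k::field poly4"
  assumes t: "t \<ge> 1" and sign: "(- 1) ^ t = (1 :: 'k)" and L: "L \<in> forms 1"
  shows "\<exists>g\<in>forms (t + 1). \<forall>f\<in>forms t. g - L * f \<notin> add_generator (lifted_ideal t) Xw"
proof -
  let ?J = "add_generator (lifted_ideal t) (Xw :: 'k poly4)"
  have lookup0: "Poly_Mapping.lookup p m = 0" if "p \<in> ?J" "\<not> killed t m" for p m
    using that section_at_infinity_iff[of p t] by blast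
  show ?thesis
  proof (cases "coords L Lx \<noteq> 0 \<and> coords L Ly \<noteq> 0 \<and> coords L Lz \<noteq> 0")
    \<comment> \<open>The coefficients of u s^t and v s^t in \<open>L * f\<close> are
      \<open>coords L u\<close> and \<open>coords L v\<close> times the same coefficient of
      \<open>f\<close>, so these two monomials cannot both be attained.\<close>
    case False
    then obtain s where s: "s \<noteq> Lw" "coords L s = 0"
      by auto
    obtain u v where uv: "u \<noteq> Lw" "v \<noteq> Lw" "u \<noteq> s" "v \<noteq> s" "u \<noteq> v"
      using s(1) by (cases s) (metis letter.distinct)+
    let ?m = "\<lambda>v. Poly_Mapping.single v 1 + Poly_Mapping.single s t :: letter \<Rightarrow>\<^sub>0 nat"
    have alive: "\<not> killed t (?m v)" if "v \<noteq> Lw" "v \<noteq> s" for v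
      using that s(1) t by (cases v; cases s) (auto simp: killed_def lookup_add lookup_single when_def)
    have form: "Poly_Mapping.single (?m v) 1 \<in> forms (t + 1)" for v
      by (auto simp: forms_def mdeg_add)
    have distinct: "?m u \<noteq> ?m v"
      using uv by (metis add_right_cancel lookup_single_eq lookup_single_not_eq zero_neq_one)
    have key: "Poly_Mapping.lookup g (?m x) = coords L x * Poly_Mapping.lookup f (Poly_Mapping.single s t)"
      if "g - L * f \<in> ?J" "x \<noteq> Lw" "x \<noteq> s" for g f x
      using lookup0[OF that(1) alive[OF that(2,3)]] lookup_linear_mult[OF L that(3) s(2), of f t]
      by (simp add: lookup_minus)
    show ?thesis
    proof (cases "coords L u = 0")
      case True
      show ?thesis
      proof (rule bexI[OF _ form[of u]], intro ballI notI)
        fix f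
        assume f: "Poly_Mapping.single (?m u) 1 - L * f \<in> ?J"
        show False
          using key[OF f uv(1,3)] True by simp
      qed
    next
      case False
      show ?thesis
      proof (rule bexI[OF _ form[of v]], intro ballI notI)
        fix f
        assume f: "Poly_Mapping.single (?m v) 1 - L * f \<in> ?J"
        have "coords L u * Poly_Mapping.lookup f (Poly_Mapping.single s t) = 0"
          using key[OF f uv(1,3)] distinct by (simp add: lookup_single when_def)
        then show False
          using key[OF f uv(2,4)] False by simp
      qed
    qed
  next
    case True
    define b c d where "b = coords L Lx" and "c = coords L Ly" and "d = coords L Lz"
    have bcd: "b \<noteq> 0" "c \<noteq> 0" "d \<noteq> 0"
      using True by (simp_all add: b_def c_def d_def)
    define Q1 Q2 Q3 where "Q1 = (\<lambda>v. case v of Lw \<Rightarrow> 0 | Lx \<Rightarrow> 0 | Ly \<Rightarrow> d | Lz \<Rightarrow> - c)"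
      and "Q2 = (\<lambda>v. case v of Lw \<Rightarrow> 0 | Lx \<Rightarrow> - d | Ly \<Rightarrow> 0 | Lz \<Rightarrow> b)"
      and "Q3 = (\<lambda>v. case v of Lw \<Rightarrow> 0 | Lx \<Rightarrow> c | Ly \<Rightarrow> - b | Lz \<Rightarrow> 0)"
    note Q_defs = Q1_def Q2_def Q3_def
    \<comment> \<open>The functional combines the values at the three points where the line w =
      \<open>L\<close> = 0 meets the planes x = 0, y = 0 and z = 0. The weights are a linear
      relation between the rows of the singular matrix: each pure power has opposite weighted values
      at the two points where it is nonzero, because (-a)^(t + 1) = - a^(t + 1).\<close>
    define \<Phi> where "\<Phi> p = b ^ Suc t * evalp p Q1 + c ^ Suc t * evalp p Q2 + d ^ Suc t * evalp p Q3" for p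
    have \<Phi>_add: "\<Phi> (p + q) = \<Phi> p + \<Phi> q" for p q
      by (simp add: \<Phi>_def algebra_simps)
    have neg: "(- a) ^ t = a ^ t" for a :: 'k
      by (subst power_minus) (simp only: sign mult_1)
    have \<Phi>_single: "\<Phi> (Poly_Mapping.single m k) = 0" if "killed t m" "mdeg m = Suc t" for m k
      using that(1)
    proof (cases rule: killed_single_cases[where c = k])
      case (w r)
      then show ?thesis
        by (simp add: \<Phi>_def Q_defs)
    next
      case (power v n)
      then have "n = 0"
        using that(2) by (simp add: mdeg_eq_0_iff)
      then have "Poly_Mapping.single m k = indet v ^ Suc t * const k"
        using power(2) by (simp add: const_def)
      then have "\<Phi> (Poly_Mapping.single m k) =
          (b ^ Suc t * Q1 v ^ Suc t + c ^ Suc t * Q2 v ^ Suc t + d ^ Suc t * Q3 v ^ Suc t) * k"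
        by (simp add: \<Phi>_def algebra_simps)
      also have "b ^ Suc t * Q1 v ^ Suc t + c ^ Suc t * Q2 v ^ Suc t + d ^ Suc t * Q3 v ^ Suc t = 0"
        using power(1) by (cases v) (simp_all add: Q_defs neg)
      finally show ?thesis
        by simp
    next
      case (xyz r)
      then show ?thesis
        by (simp add: \<Phi>_def Q_defs)
    qed
    have \<Phi>_J: "\<Phi> p = 0" if "p \<in> ?J" "p \<in> forms (t + 1)" for p
    proof -
      have "\<Phi> (\<Sum>m\<in>A. Poly_Mapping.single m (Poly_Mapping.lookup p m)) = 0" if "A \<subseteq> Poly_Mapping.keys p" for A
        using that
      proof (induction A rule: infinite_finite_induct)
        case (insert m A)
        then have "Poly_Mapping.lookup p m \<noteq> 0"
          by (simp add: in_keys_iff)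
        then have "killed t m" "mdeg m = Suc t"
          using \<open>p \<in> ?J\<close> \<open>p \<in> forms (t + 1)\<close> by (auto simp: section_at_infinity_iff forms_iff)
        then show ?case
          using insert by (simp add: \<Phi>_add \<Phi>_single)
      qed (simp_all add: \<Phi>_def)
      then show ?thesis
        using poly_sum_single[of p] by (metis order_refl)
    qed
    have zero: "evalp L Q1 = 0" "evalp L Q2 = 0" "evalp L Q3 = 0"
      by (subst linear_form_eq[OF L], simp add: Q_defs b_def c_def d_def)+
    have \<Phi>_L: "\<Phi> (L * f) = 0" for f
      by (simp add: \<Phi>_def zero)
    let ?g = "Xx ^ t * Xy :: 'k poly4"
    have g: "?g \<in> forms (t + 1)"
      using forms_mult[OF forms_power[OF forms_indet, of Lx t] forms_indet[of Ly]] by simp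
    have \<Phi>_g: "\<Phi> ?g \<noteq> 0"
      using bcd t by (simp add: \<Phi>_def Q_defs zero_power)
    show ?thesis
    proof (rule bexI[OF _ g], intro ballI notI)
      fix f
      assume f: "f \<in> forms t" "?g - L * f \<in> ?J"
      have "?g - L * f \<in> forms (t + 1)"
        using g forms_mult[OF L f(1)] by (intro forms_diff) simp_all
      then have "\<Phi> (?g - L * f) = 0"
        using \<Phi>_J f(2) by blast
      then have "\<Phi> ?g = 0"
        using \<Phi>_add[of "?g - L * f" "L * f"] \<Phi>_L[of f] by simp
      then show False
        using \<Phi>_g by blast
    qed
  qed
qed

text \<open>Even t and characteristic two are a single obstruction, (-1)^t = 1 in K, and it breaks
  both alternatives in the one degree t.\<close>

lemma section_at_infinity_weak_Lefschetz_iff: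
  assumes t: "t \<ge> 1"
  shows "weak_Lefschetz (add_generator (lifted_ideal t) (Xw :: 'k::field poly4)) \<longleftrightarrow>
    odd t \<and> CHAR('k) \<noteq> 2"
proof -
  have two: "(2 :: 'k) = 0 \<longleftrightarrow> CHAR('k) = 2"
  proof -
    have "(2 :: 'k) = 0 \<longleftrightarrow> CHAR('k) dvd 2"
      using of_nat_eq_0_iff_char_dvd[of 2, where 'a = 'k] by simp
    also have "\<dots> \<longleftrightarrow> CHAR('k) = 2"
      using CHAR_not_1[where 'a = 'k] two_is_prime_nat by (auto simp: prime_nat_iff)
    finally show ?thesis .
  qed
  have "\<not> weak_Lefschetz (add_generator (lifted_ideal t) (Xw :: 'k poly4))"
    if sign: "(- 1) ^ t = (1 :: 'k)"
  proof
    assume "weak_Lefschetz (add_generator (lifted_ideal t) (Xw :: 'k poly4))"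
    then obtain L :: "'k poly4" where L: "L \<in> forms 1"
      and *: "(\<forall>f\<in>forms t. L * f \<in> add_generator (lifted_ideal t) Xw \<longrightarrow> f \<in> add_generator (lifted_ideal t) Xw) \<or>
        (\<forall>g\<in>forms (t + 1). \<exists>f\<in>forms t. g - L * f \<in> add_generator (lifted_ideal t) Xw)"
      unfolding weak_Lefschetz_iff[OF ideal_add_generator] by blast
    show False
      using section_at_infinity_not_injective[OF t sign L]
        section_at_infinity_not_surjective[OF t sign L] * by blast
  qed
  moreover have "(- 1) ^ t = (1 :: 'k)" if "even t \<or> (2 :: 'k) = 0"
    using that
  proof
    assume "(2 :: 'k) = 0"
    then have "(- 1 :: 'k) = 1"
      by (metis add.inverse_unique one_add_one)
    then show ?thesis
      by (simp only: power_one)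
  qed simp
  ultimately show ?thesis
    using section_at_infinity_weak_Lefschetz[OF t, where 'k = 'k] unfolding two[symmetric] by blast
qed

section \<open>The points\<close>

text \<open>The triples serve twice: for the points (1 : i : j : k), and for the Newton basis, where
  they are the exponents of the monomials outside the ideal modulo w.\<close>

definition grid :: "nat \<Rightarrow> (nat \<times> nat \<times> nat) set" where
  "grid t = {(i, j, k). i \<le> t \<and> j \<le> t \<and> k \<le> t \<and> (i = 0 \<or> j = 0 \<or> k = 0)}"

definition grid_point :: "nat \<times> nat \<times> nat \<Rightarrow> letter \<Rightarrow> 'k::field" where
  "grid_point = (\<lambda>(i, j, k) v. case v of Lw \<Rightarrow> 1 | Lx \<Rightarrow> of_nat i | Ly \<Rightarrow> of_nat j | Lz \<Rightarrow> of_nat k)"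

definition newton :: "nat \<times> nat \<times> nat \<Rightarrow> 'k::field poly4" where
  "newton = (\<lambda>(i, j, k). lift_power i Lx * lift_power j Ly * lift_power k Lz)"

definition grid_degree :: "nat \<times> nat \<times> nat \<Rightarrow> nat" where
  "grid_degree = (\<lambda>(i, j, k). i + j + k)"

lemma grid_eq: "grid t = {..t} \<times> {..t} \<times> {..t} - {1..t} \<times> {1..t} \<times> {1..t}"
  by (auto simp: grid_def)

lemma finite_grid [simp]: "finite (grid t)"
  by (simp add: grid_eq)

lemma card_grid: "card (grid t) = 3 * (t + 1) * t + 1"
proof -
  have "card (grid t) = Suc t * (Suc t * Suc t) - t * (t * t)"
    unfolding grid_eq by (subst card_Diff_subset) (auto simp: card_cartesian_product)
  then show ?thesis
    by (simp add: algebra_simps)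
qed

lemma lift_power_Suc: "lift_power (Suc n) v = lift_power n v * (indet v - of_nat n * Xw)"
  by (simp add: lift_power_def)

lemma lift_power_dvd: "m \<le> n \<Longrightarrow> lift_power m v dvd lift_power n v"
  unfolding lift_power_def by (rule prod_dvd_prod_subset) auto

lemma ideal_lifted: "ideal (lifted_ideal t) polyring"
  by (simp add: lifted_ideal_eq ideal_ideal_of)

lemma mem_lifted_dvd:
  assumes "g \<in> lifted_gens t" "g dvd p"
  shows "p \<in> lifted_ideal t"
  using ideal_mult_right[OF ideal_lifted] mem_ideal_of[OF assms(1)] assms(2)
  by (metis dvdE lifted_ideal_eq)

text \<open>Outside the grid either an index exceeds t, so a generator divides, or all three indices
  are positive; then each factor contains its variable, as its term i = 0, and xyz divides.\<close>

lemma newton_mem: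
  assumes "\<kappa> \<notin> grid t"
  shows "(newton \<kappa> :: 'k::field poly4) \<in> lifted_ideal t"
proof -
  obtain i j k where \<kappa>: "\<kappa> = (i, j, k)"
    by (cases \<kappa>)
  consider "Suc t \<le> i" | "Suc t \<le> j" | "Suc t \<le> k" | "1 \<le> i" "1 \<le> j" "1 \<le> k"
    using assms by (force simp: \<kappa> grid_def)
  then show ?thesis
  proof cases
    case 1
    have "lift_power (Suc t) Lx dvd newton \<kappa>"
      using 1 by (simp add: newton_def \<kappa> lift_power_dvd)
    then show ?thesis
      by (rule mem_lifted_dvd[rotated]) (simp add: lifted_gens_def)
  next
    case 2
    have "lift_power (Suc t) Ly dvd newton \<kappa>"
      using 2 by (simp add: newton_def \<kappa> lift_power_dvd)
    then show ?thesis
      by (rule mem_lifted_dvd[rotated]) (simp add: lifted_gens_def)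
  next
    case 3
    have "lift_power (Suc t) Lz dvd newton \<kappa>"
      using 3 by (simp add: newton_def \<kappa> lift_power_dvd)
    then show ?thesis
      by (rule mem_lifted_dvd[rotated]) (simp add: lifted_gens_def)
  next
    case 4
    have dvd: "indet v dvd (lift_power n v :: 'k poly4)" if "1 \<le> n" for n v
      using lift_power_dvd[OF that, of v, where 'a = 'k] by (simp add: lift_power_def)
    have "Xx * Xy * Xz dvd (newton (i, j, k) :: 'k poly4)"
      unfolding newton_def prod.case by (intro mult_dvd_mono dvd 4)
    then show ?thesis
      unfolding \<kappa> by (intro mem_lifted_dvd[of "Xx * Xy * Xz"]) (simp_all add: lifted_gens_def)
  qed
qed

definition newton_comb :: "nat \<Rightarrow> nat \<Rightarrow> (nat \<times> nat \<times> nat \<Rightarrow> 'k) \<Rightarrow> 'k::field poly4" where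
  "newton_comb t d c = (\<Sum>\<kappa> | \<kappa> \<in> grid t \<and> grid_degree \<kappa> \<le> d.
     const (c \<kappa>) * (Xw ^ (d - grid_degree \<kappa>) * newton \<kappa>))"

definition newton_span :: "nat \<Rightarrow> nat \<Rightarrow> 'k::field poly4 set" where
  "newton_span t d = {f. \<exists>c. f - newton_comb t d c \<in> lifted_ideal t}"

lemma newton_spanI: "f - newton_comb t d c \<in> lifted_ideal t \<Longrightarrow> f \<in> newton_span t d"
  unfolding newton_span_def by blast

lemma newton_span_ideal: "f \<in> lifted_ideal t \<Longrightarrow> f \<in> newton_span t d"
  by (rule newton_spanI[of _ _ _ "\<lambda>_. 0"]) (simp add: newton_comb_def)

lemma newton_span_add:
  assumes "f \<in> newton_span t d" "g \<in> newton_span t d"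
  shows "f + g \<in> newton_span t d"
proof -
  obtain a b where *: "f - newton_comb t d a \<in> lifted_ideal t" "g - newton_comb t d b \<in> lifted_ideal t"
    using assms unfolding newton_span_def by blast
  have "(f + g) - newton_comb t d (\<lambda>\<kappa>. a \<kappa> + b \<kappa>) = (f - newton_comb t d a) + (g - newton_comb t d b)"
    by (simp add: newton_comb_def const_add distrib_right sum.distrib)
  then show ?thesis
    using ideal_add[OF ideal_lifted *] by (metis newton_spanI)
qed

lemma newton_span_const:
  assumes "f \<in> newton_span t d"
  shows "const k * f \<in> newton_span t d"
proof -
  obtain a where *: "f - newton_comb t d a \<in> lifted_ideal t"
    using assms unfolding newton_span_def by blast
  have "const k * f - newton_comb t d (\<lambda>\<kappa>. k * a \<kappa>) = const k * (f - newton_comb t d a)"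
    by (simp add: newton_comb_def const_mult right_diff_distrib sum_distrib_left mult.assoc)
  then show ?thesis
    using ideal_mult[OF ideal_lifted *] by (metis newton_spanI)
qed

lemma newton_span_sum:
  "(\<And>i. i \<in> A \<Longrightarrow> f i \<in> newton_span t d) \<Longrightarrow> sum f A \<in> newton_span t d"
  by (induction A rule: infinite_finite_induct)
     (auto intro: newton_span_add newton_span_ideal ideal_zero[OF ideal_lifted])

lemma newton_span_generator:
  assumes "grid_degree \<kappa> \<le> d"
  shows "Xw ^ (d - grid_degree \<kappa>) * newton \<kappa> \<in> (newton_span t d :: 'k::field poly4 set)"
proof (cases "\<kappa> \<in> grid t")
  case True
  let ?A = "{\<mu>. \<mu> \<in> grid t \<and> grid_degree \<mu> \<le> d}"
  have "newton_comb t d (\<lambda>\<mu>. if \<mu> = \<kappa> then 1 else (0 :: 'k)) =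
      (\<Sum>\<mu>\<in>?A. if \<mu> = \<kappa> then Xw ^ (d - grid_degree \<mu>) * newton \<mu> else 0)"
    unfolding newton_comb_def by (rule sum.cong) auto
  also have "\<dots> = Xw ^ (d - grid_degree \<kappa>) * newton \<kappa>"
    using True assms by simp
  finally show ?thesis
    by (intro newton_spanI[of _ _ _ "\<lambda>\<mu>. if \<mu> = \<kappa> then 1 else 0"])
      (simp add: ideal_zero[OF ideal_lifted])
next
  case False
  then show ?thesis
    by (intro newton_span_ideal ideal_mult[OF ideal_lifted] newton_mem)
qed

text \<open>The Newton recursion: x times \<open>lift_power i Lx\<close> is
  \<open>lift_power (Suc i) Lx\<close> plus i w times \<open>lift_power i Lx\<close>, and likewise
  for y and z. An index that leaves the grid does no harm, since its product lies in the
  ideal.\<close>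

lemma newton_span_step:
  assumes "f \<in> newton_span t d"
  shows "indet v * f \<in> (newton_span t (Suc d) :: 'k::field poly4 set)"
proof -
  obtain c where c: "f - newton_comb t d c \<in> lifted_ideal t"
    using assms unfolding newton_span_def by blast
  have gen: "indet v * (Xw ^ (d - grid_degree \<kappa>) * newton \<kappa>) \<in> (newton_span t (Suc d) :: 'k poly4 set)"
    if d: "grid_degree \<kappa> \<le> d" for \<kappa>
  proof -
    obtain i j k where \<kappa>: "\<kappa> = (i, j, k)"
      by (cases \<kappa>)
    have w: "Xw * Xw ^ (d - grid_degree \<kappa>) = (Xw :: 'k poly4) ^ (Suc d - grid_degree \<kappa>)"
      using d by (simp add: Suc_diff_le)
    have w': "Xw * (Xw ^ (d - grid_degree \<kappa>) * newton \<kappa>) \<in> (newton_span t (Suc d) :: 'k poly4 set)"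
      using newton_span_generator[OF le_SucI[OF d], of t] by (simp only: w mult.assoc[symmetric])
    have main: "indet v * (Xw ^ (d - grid_degree \<kappa>) * newton \<kappa>) \<in> (newton_span t (Suc d) :: 'k poly4 set)"
      if "grid_degree \<mu> = Suc (grid_degree \<kappa>)"
        and "indet v * newton \<kappa> = newton \<mu> + const a * (Xw * newton \<kappa>)" for \<mu> and a :: 'k
    proof -
      have "indet v * (Xw ^ (d - grid_degree \<kappa>) * newton \<kappa> :: 'k poly4) =
          Xw ^ (d - grid_degree \<kappa>) * (indet v * newton \<kappa>)"
        by (simp add: mult_ac)
      also have "\<dots> = Xw ^ (Suc d - grid_degree \<mu>) * newton \<mu>
          + const a * (Xw * (Xw ^ (d - grid_degree \<kappa>) * newton \<kappa>))"
        unfolding that by (simp add: algebra_simps)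
      also have "\<dots> \<in> newton_span t (Suc d)"
        using d that(1) by (intro newton_span_add newton_span_const w' newton_span_generator) simp
      finally show ?thesis .
    qed
    show ?thesis
    proof (cases v)
      case Lw
      then show ?thesis
        using w' by simp
    next
      case Lx
      show ?thesis
        by (rule main[of "(Suc i, j, k)" "of_nat i"])
           (simp_all add: grid_degree_def newton_def \<kappa> Lx lift_power_Suc const_of_nat algebra_simps)
    next
      case Ly
      show ?thesis
        by (rule main[of "(i, Suc j, k)" "of_nat j"])
           (simp_all add: grid_degree_def newton_def \<kappa> Ly lift_power_Suc const_of_nat algebra_simps)
    next
      case Lz
      show ?thesis
        by (rule main[of "(i, j, Suc k)" "of_nat k"])
           (simp_all add: grid_degree_def newton_def \<kappa> Lz lift_power_Suc const_of_nat algebra_simps)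
    qed
  qed
  have "indet v * newton_comb t d c = (\<Sum>\<kappa> | \<kappa> \<in> grid t \<and> grid_degree \<kappa> \<le> d.
      const (c \<kappa>) * (indet v * (Xw ^ (d - grid_degree \<kappa>) * newton \<kappa>)))"
    by (simp add: newton_comb_def sum_distrib_left mult.left_commute)
  also have "\<dots> \<in> newton_span t (Suc d)"
    by (intro newton_span_sum newton_span_const gen) auto
  finally have comb: "indet v * newton_comb t d c \<in> newton_span t (Suc d)" .
  show ?thesis
    using newton_span_add[OF newton_span_ideal[OF ideal_mult[OF ideal_lifted c, of "indet v"]] comb]
    by (simp add: algebra_simps)
qed

lemma forms_newton_span:
  assumes "f \<in> forms d"
  shows "f \<in> newton_span t d"
  using assms
proof (induction rule: forms_induct)
  case (const c)
  have "const c * (Xw ^ (0 - grid_degree (0, 0, 0)) * newton (0, 0, 0)) \<in> newton_span t 0"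
    by (intro newton_span_const newton_span_generator) (simp add: grid_degree_def)
  then show ?case
    by (simp add: newton_def lift_power_def)
qed (auto intro: newton_span_add newton_span_step newton_span_ideal ideal_zero[OF ideal_lifted])

lemma evalp_lifted:
  assumes "f \<in> lifted_ideal t" "\<mu> \<in> grid t"
  shows "evalp f (grid_point \<mu>) = (0 :: 'k::field)"
  using assms(1) unfolding lifted_ideal_eq
proof (rule evalp_ideal_of)
  fix s :: "'k poly4"
  obtain i j k where \<mu>: "\<mu> = (i, j, k)"
    by (cases \<mu>)
  have zero: "(\<Prod>l<Suc t. (of_nat n - of_nat l :: 'k)) = 0" if "n \<le> t" for n
    by (rule prod_zero) (use that in \<open>auto intro!: bexI[of _ n]\<close>)
  assume "s \<in> lifted_gens t"
  then show "evalp s (grid_point \<mu>) = 0"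
    using assms(2) unfolding lifted_gens_def
    by (auto simp: \<mu> grid_def grid_point_def evalp_lift_power zero intro!: bexI[of _ 0]
        simp del: prod.lessThan_Suc)
qed

lemma homogeneous_lifted_ideal: "p \<in> lifted_ideal t \<Longrightarrow> hcomp d p \<in> lifted_ideal t"
  using homogeneous_ideal_of[OF lifted_gens_forms] unfolding lifted_ideal_eq homogeneous_ideal_def
  by blast

section \<open>Evaluation at the points when 0, ..., t are distinct in K\<close>

context
  fixes t :: nat
  assumes inj: "inj_on (of_nat :: nat \<Rightarrow> 'k::field) {..t}"
begin

text \<open>The value is nonzero exactly when \<kappa> is componentwise at most \<mu>; with the
  degree condition this forces equality. It is the triangularity of the Newton basis.\<close>

lemma evalp_newton:
  assumes "\<mu> \<in> grid t" "\<kappa> \<in> grid t" "grid_degree \<mu> \<le> grid_degree \<kappa>"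
  shows "evalp (newton \<kappa>) (grid_point \<mu> :: letter \<Rightarrow> 'k) \<noteq> 0 \<longleftrightarrow> \<kappa> = \<mu>"
proof -
  obtain i j k a b c where eq: "\<mu> = (i, j, k)" "\<kappa> = (a, b, c)"
    by (cases \<mu>, cases \<kappa>)
  have ne: "(\<Prod>l<n. (of_nat m - of_nat l :: 'k)) \<noteq> 0 \<longleftrightarrow> n \<le> m" if "n \<le> t" "m \<le> t" for n m
  proof -
    have "(\<Prod>l<n. (of_nat m - of_nat l :: 'k)) \<noteq> 0 \<longleftrightarrow> (\<forall>l<n. (of_nat m :: 'k) \<noteq> of_nat l)"
      by (auto simp: prod_zero_iff)
    also have "\<dots> \<longleftrightarrow> (\<forall>l<n. m \<noteq> l)"
      using inj_on_eq_iff[OF inj] that by auto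
    finally show ?thesis
      by auto
  qed
  have "evalp (newton \<kappa>) (grid_point \<mu> :: letter \<Rightarrow> 'k) \<noteq> 0 \<longleftrightarrow> a \<le> i \<and> b \<le> j \<and> c \<le> k"
    using assms(1,2) ne[of a i] ne[of b j] ne[of c k]
    by (simp add: eq newton_def grid_point_def evalp_lift_power grid_def)
  then show ?thesis
    using assms(3) by (auto simp: eq grid_degree_def)
qed

text \<open>By induction on \<open>grid_degree \<mu>\<close>: at the point of \<mu>, terms of
  smaller degree are zero by induction and the remaining ones by triangularity, which leaves
  \<open>c \<mu>\<close> alone.\<close>

lemma vanishing_mem:
  assumes f: "f \<in> forms d" and van: "\<And>\<mu>. \<mu> \<in> grid t \<Longrightarrow> evalp f (grid_point \<mu>) = (0 :: 'k)"
  shows "f \<in> lifted_ideal t"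
proof -
  obtain c where c: "f - newton_comb t d c \<in> lifted_ideal t"
    using forms_newton_span[OF f, of t] unfolding newton_span_def by blast
  let ?A = "{\<kappa>. \<kappa> \<in> grid t \<and> grid_degree \<kappa> \<le> d}"
  have "c \<mu> = 0" if "\<mu> \<in> ?A" for \<mu>
    using that
  proof (induction "grid_degree \<mu>" arbitrary: \<mu> rule: less_induct)
    case less
    have "evalp (newton_comb t d c) (grid_point \<mu>) = 0"
      using evalp_lifted[OF c, of \<mu>] van less.prems by simp
    then have "0 = (\<Sum>\<kappa>\<in>?A. c \<kappa> * evalp (newton \<kappa>) (grid_point \<mu>))"
      by (simp add: newton_comb_def grid_point_def split_beta)
    also have "\<dots> = c \<mu> * evalp (newton \<mu>) (grid_point \<mu>)
        + (\<Sum>\<kappa>\<in>?A - {\<mu>}. c \<kappa> * evalp (newton \<kappa>) (grid_point \<mu>))"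
      by (rule sum.remove) (use less.prems in auto)
    also have "(\<Sum>\<kappa>\<in>?A - {\<mu>}. c \<kappa> * evalp (newton \<kappa>) (grid_point \<mu>)) = 0"
    proof (rule sum.neutral, rule ballI)
      fix \<kappa>
      assume \<kappa>: "\<kappa> \<in> ?A - {\<mu>}"
      show "c \<kappa> * evalp (newton \<kappa>) (grid_point \<mu>) = 0"
      proof (cases "grid_degree \<kappa> < grid_degree \<mu>")
        case True
        then show ?thesis
          using less.hyps \<kappa> by simp
      next
        case False
        then show ?thesis
          using evalp_newton[of \<mu> \<kappa>] \<kappa> less.prems by auto
      qed
    qed
    finally show ?case
      using evalp_newton[of \<mu> \<mu>] less.prems by simp
  qed
  then have "newton_comb t d c = 0"
    unfolding newton_comb_def by (intro sum.neutral) auto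
  then show ?thesis
    using c by simp
qed

lemma w_nonzerodivisor:
  assumes "Xw * f \<in> (lifted_ideal t :: 'k poly4 set)"
  shows "f \<in> lifted_ideal t"
proof (rule mem_ideal_if_hcomps[OF ideal_lifted])
  fix d
  have "Xw * hcomp d f \<in> lifted_ideal t"
    using homogeneous_lifted_ideal[OF assms, of "Suc d"] hcomp_form_mult[OF forms_indet, of "Suc d" Lw f]
    by simp
  then have "evalp (hcomp d f) (grid_point \<mu>) = 0" if "\<mu> \<in> grid t" for \<mu>
    using evalp_lifted[of _ t \<mu>] that by (force simp: grid_point_def split_beta)
  then show "hcomp d f \<in> lifted_ideal t"
    by (rule vanishing_mem[OF hcomp_in_forms])
qed

definition lagrange :: "nat \<times> nat \<times> nat \<Rightarrow> 'k poly4" where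
  "lagrange = (\<lambda>(i, j, k). (\<Prod>l\<in>{..t} - {i}. (Xx - of_nat l * Xw)) *
     (\<Prod>l\<in>{..t} - {j}. (Xy - of_nat l * Xw)) * (\<Prod>l\<in>{..t} - {k}. (Xz - of_nat l * Xw)))"

lemma evalp_lagrange:
  assumes "\<mu> \<in> grid t" "\<nu> \<in> grid t"
  shows "evalp (lagrange \<mu>) (grid_point \<nu>) \<noteq> 0 \<longleftrightarrow> \<mu> = \<nu>"
proof -
  obtain i j k a b c where eq: "\<mu> = (i, j, k)" "\<nu> = (a, b, c)"
    by (cases \<mu>, cases \<nu>)
  have ne: "(\<Prod>l\<in>{..t} - {n}. (of_nat m - of_nat l :: 'k)) \<noteq> 0 \<longleftrightarrow> n = m" if "n \<le> t" "m \<le> t" for n m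
  proof -
    have "(\<Prod>l\<in>{..t} - {n}. (of_nat m - of_nat l :: 'k)) \<noteq> 0 \<longleftrightarrow> (\<forall>l\<in>{..t} - {n}. (of_nat m :: 'k) \<noteq> of_nat l)"
      by (auto simp: prod_zero_iff)
    also have "\<dots> \<longleftrightarrow> (\<forall>l\<in>{..t} - {n}. m \<noteq> l)"
      using inj_on_eq_iff[OF inj] that by auto
    finally show ?thesis
      using that by auto
  qed
  show ?thesis
    using assms ne[of i a] ne[of j b] ne[of k c]
    by (simp add: eq lagrange_def grid_point_def grid_def)
qed

lemma lagrange_forms: "\<exists>d. lagrange \<mu> \<in> forms d"
proof -
  have lin: "(indet v - of_nat l * Xw :: 'k poly4) \<in> forms 1" for v l
    by (intro forms_diff forms_of_nat_mult forms_indet)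
  have "\<exists>d. (\<Prod>l\<in>A. (indet v - of_nat l * Xw :: 'k poly4)) \<in> forms d" for v A
    using forms_prod[of A "\<lambda>l. indet v - of_nat l * Xw" "\<lambda>_. 1", OF lin] by blast
  then show ?thesis
    unfolding lagrange_def split_beta using forms_mult by metis
qed

text \<open>If \<open>h\<close> vanished at one point, \<open>h\<close> times a form nonzero at
  exactly that point would vanish everywhere on the grid and lie in the ideal, while the form itself
  does not.\<close>

lemma nonzerodivisor_grid_point:
  assumes h: "h \<in> forms 1" and nzd: "\<And>f. h * f \<in> lifted_ideal t \<Longrightarrow> f \<in> lifted_ideal t"
    and \<mu>: "\<mu> \<in> grid t"
  shows "evalp h (grid_point \<mu> :: letter \<Rightarrow> 'k) \<noteq> 0"
proof
  assume zero: "evalp h (grid_point \<mu>) = 0"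
  obtain d where d: "lagrange \<mu> \<in> forms d"
    using lagrange_forms by blast
  have "h * lagrange \<mu> \<in> lifted_ideal t"
  proof (rule vanishing_mem[OF forms_mult[OF h d]])
    fix \<nu>
    assume "\<nu> \<in> grid t"
    then show "evalp (h * lagrange \<mu>) (grid_point \<nu>) = 0"
      using zero evalp_lagrange[OF \<mu>, of \<nu>] by auto
  qed
  then have "lagrange \<mu> \<in> lifted_ideal t"
    by (rule nzd)
  then show False
    using evalp_lifted[of "lagrange \<mu>" t \<mu>] evalp_lagrange[OF \<mu> \<mu>] \<mu> by blast
qed

end

section \<open>The socle of a hyperplane section\<close>

text \<open>For linear nonzerodivisors \<open>w\<close> and \<open>h\<close> modulo \<open>I\<close>, the relation \<open>h e \<equiv> w f\<close> modulo \<open>I\<close> is a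
  degree preserving isomorphism between the socles modulo \<open>(I, w)\<close> and modulo \<open>(I, h)\<close>.\<close>

lemma level_transfer:
  fixes I :: "'k::field poly4 set"
  assumes I: "ideal I polyring" and hom: "\<And>p d. p \<in> I \<Longrightarrow> hcomp d p \<in> I"
    and w: "w \<in> forms 1" "\<And>f. w * f \<in> I \<Longrightarrow> f \<in> I"
    and h: "h \<in> forms 1" "\<And>f. h * f \<in> I \<Longrightarrow> f \<in> I"
    and art: "artinian_ring (quotient_ring (add_generator I h))"
    and e: "\<And>i. i < 3 \<Longrightarrow> e i \<in> forms d"
    and ann: "\<And>i v. i < (3::nat) \<Longrightarrow> indet v * e i \<in> add_generator I w"
    and span: "\<And>f. (\<And>v. indet v * f \<in> add_generator I w) \<Longrightarrow>
      \<exists>c. f - (\<Sum>i<3. const (c i) * e i) \<in> add_generator I w"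
    and indep: "\<And>c i. (\<Sum>i<3. const (c i) * e i) \<in> add_generator I w \<Longrightarrow> i < 3 \<Longrightarrow> c i = 0"
  shows "level_of_type 3 (add_generator I h)"
proof -
  have Jw: "ideal (add_generator I w) polyring" and Jh: "ideal (add_generator I h) polyring"
    by (rule ideal_add_generator)+
  have Jw_iff: "p \<in> add_generator I w \<longleftrightarrow> (\<exists>r. p - r * w \<in> I)"
    and Jh_iff: "p \<in> add_generator I h \<longleftrightarrow> (\<exists>r. p - r * h \<in> I)" for p
    unfolding add_generator_iff[OF I] by (metis add_diff_cancel_right' diff_add_cancel)+
  have "\<exists>f\<in>forms d. h * e i - w * f \<in> I" if i: "i < 3" for i
  proof -
    have "h * e i = (\<Sum>v\<in>UNIV. const (coords h v) * (indet v * e i))"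
      by (subst (1) forms_1_expand[OF h(1)]) (simp add: sum_distrib_right mult.assoc)
    also have "\<dots> \<in> add_generator I w"
      by (intro ideal_sum[OF Jw] ideal_mult[OF Jw] ann i)
    finally obtain r where "h * e i - r * w \<in> I"
      unfolding Jw_iff by blast
    \<comment> \<open>Taking the component of degree d + 1 makes the cofactor of \<open>w\<close> a
      form of degree d, so the transferred socle again lies in one degree.\<close>
    from hom[OF this, of "Suc d"]
    have "h * e i - w * hcomp d r \<in> I"
      using hcomp_form[OF forms_mult[OF h(1) e[OF i]], of "Suc d"] hcomp_form_mult[OF w(1), of "Suc d" r]
      by (simp add: hcomp_diff mult.commute[of r])
    then show ?thesis
      using hcomp_in_forms by blast
  qed
  then obtain f where f: "\<And>i. i < 3 \<Longrightarrow> f i \<in> forms d" "\<And>i. i < 3 \<Longrightarrow> h * e i - w * f i \<in> I"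
    by metis
  have sum_rel: "h * (\<Sum>i<3. const (c i) * e i) - w * (\<Sum>i<3. const (c i) * f i) \<in> I" for c
  proof -
    have "h * (\<Sum>i<3. const (c i) * e i) - w * (\<Sum>i<3. const (c i) * f i) =
        (\<Sum>i<3. const (c i) * (h * e i - w * f i))"
      by (simp add: sum_distrib_left sum_subtractf[symmetric] right_diff_distrib mult.left_commute)
    also have "\<dots> \<in> I"
      by (intro ideal_sum[OF I] ideal_mult[OF I] f) simp
    finally show ?thesis .
  qed
  have ann': "indet v * f i \<in> add_generator I h" if i: "i < 3" for i v
  proof -
    obtain q where q: "indet v * e i - q * w \<in> I"
      using ann[OF i] unfolding Jw_iff by blast
    have "w * (indet v * f i - q * h) = h * (indet v * e i - q * w) - indet v * (h * e i - w * f i)"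
      by (simp add: algebra_simps)
    also have "\<dots> \<in> I"
      by (intro ideal_diff[OF I] ideal_mult[OF I] q f i)
    finally show ?thesis
      unfolding Jh_iff using w(2) by blast
  qed
  have span': "\<exists>c. g - (\<Sum>i<3. const (c i) * f i) \<in> add_generator I h"
    if g: "\<And>v. indet v * g \<in> add_generator I h" for g
  proof -
    \<comment> \<open>The inverse direction of the correspondence: \<open>w\<close> annihilates
      \<open>g\<close> modulo (I, h), and the cofactor \<open>k\<close> of \<open>h\<close> is the
      matching socle element modulo (I, w).\<close>
    have "w * g = (\<Sum>v\<in>UNIV. const (coords w v) * (indet v * g))"
      by (subst (1) forms_1_expand[OF w(1)]) (simp add: sum_distrib_right mult.assoc)
    also have "\<dots> \<in> add_generator I h"
      by (intro ideal_sum[OF Jh] ideal_mult[OF Jh] g)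
    finally obtain k where k: "w * g - k * h \<in> I"
      unfolding Jh_iff by blast
    have "indet v * k \<in> add_generator I w" for v
    proof -
      obtain q where q: "indet v * g - q * h \<in> I"
        using g[of v] unfolding Jh_iff by blast
      have "h * (indet v * k - q * w) = w * (indet v * g - q * h) - indet v * (w * g - k * h)"
        by (simp add: algebra_simps)
      also have "\<dots> \<in> I"
        by (intro ideal_diff[OF I] ideal_mult[OF I] q k)
      finally show ?thesis
        unfolding Jw_iff using h(2) by blast
    qed
    then obtain c where "k - (\<Sum>i<3. const (c i) * e i) \<in> add_generator I w"
      using span by blast
    then obtain s where s: "k - (\<Sum>i<3. const (c i) * e i) - s * w \<in> I"
      unfolding Jw_iff by blast
    have "w * (g - (\<Sum>i<3. const (c i) * f i) - s * h) = (w * g - k * h)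
        + h * (k - (\<Sum>i<3. const (c i) * e i) - s * w)
        + (h * (\<Sum>i<3. const (c i) * e i) - w * (\<Sum>i<3. const (c i) * f i))"
      by (simp add: algebra_simps)
    also have "\<dots> \<in> I"
      by (intro ideal_add[OF I] ideal_mult[OF I] k s sum_rel)
    finally show ?thesis
      unfolding Jh_iff using w(2) by blast
  qed
  have indep': "c i = 0" if c: "(\<Sum>i<3. const (c i) * f i) \<in> add_generator I h" and i: "i < 3" for c i
  proof -
    obtain q where q: "(\<Sum>i<3. const (c i) * f i) - q * h \<in> I"
      using c unfolding Jh_iff by blast
    have "h * ((\<Sum>i<3. const (c i) * e i) - q * w) =
        (h * (\<Sum>i<3. const (c i) * e i) - w * (\<Sum>i<3. const (c i) * f i))
        + w * ((\<Sum>i<3. const (c i) * f i) - q * h)"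
      by (simp add: algebra_simps)
    also have "\<dots> \<in> I"
      by (intro ideal_add[OF I] ideal_mult[OF I] q sum_rel)
    finally have "(\<Sum>i<3. const (c i) * e i) \<in> add_generator I w"
      unfolding Jw_iff using h(2) by blast
    then show ?thesis
      using indep i by blast
  qed
  have sum3: "(\<Sum>i<3. const (c i) * f i) = const (c 0) * f 0 + const (c 1) * f 1 + const (c 2) * f 2"
    for c :: "nat \<Rightarrow> 'k"
    by (simp add: numeral_3_eq_3 numeral_2_eq_2)
  show ?thesis
  proof (rule level_of_type_3I[OF Jh art f(1)[of 0] f(1)[of 1] f(1)[of 2]])
    fix g
    assume "\<And>v. indet v * g \<in> add_generator I h"
    then show "\<exists>a b c. g - (const a * f 0 + const b * f 1 + const c * f 2) \<in> add_generator I h"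
      using span'[of g] unfolding sum3 by blast
  next
    fix a b c
    assume "const a * f 0 + const b * f 1 + const c * f 2 \<in> add_generator I h"
    then have *: "(\<Sum>i<3. const ((\<lambda>i. if i = 0 then a else if i = 1 then b else c) i) * f i) \<in> add_generator I h"
      unfolding sum3 by simp
    show "a = 0 \<and> b = 0 \<and> c = 0"
      using indep'[OF *, of 0] indep'[OF *, of 1] indep'[OF *, of 2] by simp
  qed (simp_all add: ann')
qed

section \<open>The socle of the monomial section\<close>

definition socle_exponent :: "nat \<Rightarrow> nat \<Rightarrow> letter \<Rightarrow>\<^sub>0 nat" where
  "socle_exponent t i =
     (if i = 0 then Poly_Mapping.single Lx t + Poly_Mapping.single Ly t
      else if i = 1 then Poly_Mapping.single Lx t + Poly_Mapping.single Lz t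
      else Poly_Mapping.single Ly t + Poly_Mapping.single Lz t)"

lemma lookup_socle_exponent:
  "Poly_Mapping.lookup (socle_exponent t i) v =
     (case v of Lw \<Rightarrow> 0 | Lx \<Rightarrow> if i = 0 \<or> i = 1 then t else 0
      | Ly \<Rightarrow> if i \<noteq> 1 then t else 0 | Lz \<Rightarrow> if i \<noteq> 0 then t else 0)"
  by (cases v) (simp_all add: socle_exponent_def lookup_add lookup_single)

lemma not_killed_socle_exponent: "t \<ge> 1 \<Longrightarrow> \<not> killed t (socle_exponent t i)"
  by (auto simp: killed_def lookup_socle_exponent)

lemma socle_exponent_inject:
  assumes "t \<ge> 1" "i < 3" "j < 3" "socle_exponent t i = socle_exponent t j"
  shows "i = j"
  using assms(1-3) arg_cong[OF assms(4), of "\<lambda>m. Poly_Mapping.lookup m Lx"]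
    arg_cong[OF assms(4), of "\<lambda>m. Poly_Mapping.lookup m Ly"]
    arg_cong[OF assms(4), of "\<lambda>m. Poly_Mapping.lookup m Lz"]
  by (auto simp: lookup_socle_exponent split: if_splits)

text \<open>An exponent below t can only be blocked by xyz, which makes the other two positive. As
  not all three are positive, two exponents equal t and the third is zero, giving x^t y^t, x^t z^t
  or y^t z^t.\<close>

lemma socle_exponentI:
  assumes "\<And>v. killed t (Poly_Mapping.single v 1 + m)" "\<not> killed t m"
  shows "\<exists>i<3. m = socle_exponent t i"
proof -
  let ?e = "Poly_Mapping.lookup m"
  have alive: "?e Lw = 0" "?e Lx \<le> t" "?e Ly \<le> t" "?e Lz \<le> t" "?e Lx = 0 \<or> ?e Ly = 0 \<or> ?e Lz = 0"
    using assms(2) by (auto simp: killed_def)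
  have x: "?e Lx = t \<or> ?e Ly \<noteq> 0 \<and> ?e Lz \<noteq> 0"
    using assms(1)[of Lx] alive by (auto simp: killed_def lookup_add lookup_single)
  have y: "?e Ly = t \<or> ?e Lx \<noteq> 0 \<and> ?e Lz \<noteq> 0"
    using assms(1)[of Ly] alive by (auto simp: killed_def lookup_add lookup_single)
  have z: "?e Lz = t \<or> ?e Lx \<noteq> 0 \<and> ?e Ly \<noteq> 0"
    using assms(1)[of Lz] alive by (auto simp: killed_def lookup_add lookup_single)
  consider "?e Lx = t" "?e Ly = t" "?e Lz = 0" | "?e Lx = t" "?e Ly = 0" "?e Lz = t"
    | "?e Lx = 0" "?e Ly = t" "?e Lz = t"
    using alive(5) x y z by metis
  then show ?thesis
  proof cases
    case 1
    then have "m = socle_exponent t 0"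
      using alive(1) by (intro poly_mapping_eqI) (simp add: lookup_socle_exponent split: letter.split)
    then show ?thesis
      by (intro exI[of _ 0]) simp
  next
    case 2
    then have "m = socle_exponent t 1"
      using alive(1) by (intro poly_mapping_eqI) (simp add: lookup_socle_exponent split: letter.split)
    then show ?thesis
      by (intro exI[of _ 1]) simp
  next
    case 3
    then have "m = socle_exponent t 2"
      using alive(1) by (intro poly_mapping_eqI) (simp add: lookup_socle_exponent split: letter.split)
    then show ?thesis
      by (intro exI[of _ 2]) simp
  qed
qed

lemma lookup_socle_comb:
  assumes "t \<ge> 1"
  shows "Poly_Mapping.lookup (\<Sum>i<3. const (c i) * Poly_Mapping.single (socle_exponent t i) (1 :: 'k::field)) m =
    (\<Sum>i<3. if socle_exponent t i = m then c i else 0)"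
  by (simp add: lookup_sum lookup_const_mult lookup_single when_def if_distrib cong: if_cong)

lemma lookup_socle_comb_exponent:
  assumes t: "t \<ge> 1" and i: "i < 3"
  shows "Poly_Mapping.lookup (\<Sum>i<3. const (c i) * Poly_Mapping.single (socle_exponent t i) (1 :: 'k::field))
    (socle_exponent t i) = c i"
proof -
  have "(\<Sum>j<3. if socle_exponent t j = socle_exponent t i then c j else 0) = (\<Sum>j<3. if j = i then c j else 0)"
    by (rule sum.cong) (use socle_exponent_inject[OF t _ i] in auto)
  then show ?thesis
    using i by (simp add: lookup_socle_comb[OF t])
qed

text \<open>Comparison with w: modulo (I, w) the socle is read off coefficient by coefficient. Its
  three generators have degree 2t, which becomes the socle degree for every
  \<open>h\<close>.\<close>

lemma level_section:
  fixes h :: "'k::field poly4"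
  assumes inj: "inj_on (of_nat :: nat \<Rightarrow> 'k) {..t}" and t: "t \<ge> 1"
    and h: "h \<in> forms 1" and nzd: "\<And>f. h * f \<in> lifted_ideal t \<Longrightarrow> f \<in> lifted_ideal t"
  shows "level_of_type 3 (add_generator (lifted_ideal t) h)"
proof (rule level_transfer[OF ideal_lifted homogeneous_lifted_ideal forms_indet w_nonzerodivisor[OF inj] h nzd,
      where e = "\<lambda>i. Poly_Mapping.single (socle_exponent t i) 1"])
  let ?J = "add_generator (lifted_ideal t) (Xw :: 'k poly4)"
  show "artinian_ring (quotient_ring (add_generator (lifted_ideal t) h))"
  proof (rule artinian_lifted_cut[OF h])
    fix i j k
    assume "i \<le> t" "j \<le> t" "k \<le> t" "i = 0 \<or> j = 0 \<or> k = 0"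
    then have "evalp h (grid_point (i, j, k)) \<noteq> 0"
      using nonzerodivisor_grid_point[OF inj h nzd] by (simp add: grid_def)
    moreover have "evalp h (grid_point (i, j, k)) = coords h Lw + of_nat i * coords h Lx
        + of_nat j * coords h Ly + of_nat k * coords h Lz"
      using arg_cong[OF linear_form_eq[OF h], of "\<lambda>p. evalp p (grid_point (i, j, k))"]
      by (simp add: grid_point_def mult.commute)
    ultimately show "coords h Lw + of_nat i * coords h Lx + of_nat j * coords h Ly + of_nat k * coords h Lz \<noteq> 0"
      by simp
  qed
  show "Poly_Mapping.single (socle_exponent t i) 1 \<in> (forms (2 * t) :: 'k poly4 set)" for i
    by (auto simp: forms_def mdeg_UNIV sum_letters lookup_socle_exponent)
  show "indet v * Poly_Mapping.single (socle_exponent t i) 1 \<in> ?J" for v i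
  proof -
    have "killed t (Poly_Mapping.single v 1 + socle_exponent t i)"
      using t by (cases v) (simp_all add: killed_def lookup_add lookup_single lookup_socle_exponent)
    then show ?thesis
      unfolding section_at_infinity_iff indet_mult_single by (simp add: lookup_single when_def)
  qed
  show "\<exists>c. f - (\<Sum>i<3. const (c i) * Poly_Mapping.single (socle_exponent t i) 1) \<in> ?J"
    if f: "\<And>v. indet v * f \<in> ?J" for f
  proof
    let ?c = "\<lambda>i. Poly_Mapping.lookup f (socle_exponent t i)"
    show "f - (\<Sum>i<3. const (?c i) * Poly_Mapping.single (socle_exponent t i) 1) \<in> ?J"
      unfolding section_at_infinity_iff
    proof (intro allI impI)
      fix m
      assume ne: "Poly_Mapping.lookup (f - (\<Sum>i<3. const (?c i) * Poly_Mapping.single (socle_exponent t i) 1)) m \<noteq> 0"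
      show "killed t m"
      proof (cases "\<exists>i<3. m = socle_exponent t i")
        case True
        then show ?thesis
          using ne lookup_socle_comb_exponent[OF t, of _ ?c] by (auto simp: lookup_minus)
      next
        case False
        then have "Poly_Mapping.lookup (\<Sum>i<3. const (?c i) * Poly_Mapping.single (socle_exponent t i) 1) m = 0"
          unfolding lookup_socle_comb[OF t] by (intro sum.neutral) auto
        then have "Poly_Mapping.lookup f m \<noteq> 0"
          using ne by (simp add: lookup_minus)
        then have "killed t (Poly_Mapping.single v 1 + m)" for v
          using f[of v] unfolding section_at_infinity_iff by (metis lookup_indet_mult)
        then show ?thesis
          using socle_exponentI False by blast
      qed
    qed
  qed
  show "c i = 0" if "(\<Sum>i<3. const (c i) * Poly_Mapping.single (socle_exponent t i) 1) \<in> ?J" "i < 3" for c i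
    using that(1) lookup_socle_comb_exponent[OF t that(2), of c] not_killed_socle_exponent[OF t]
    unfolding section_at_infinity_iff by metis
qed

section \<open>The projective points and their vanishing ideal\<close>

lemma evalp_scale:
  assumes "f \<in> forms d"
  shows "evalp f (\<lambda>v. c * a v) = c ^ d * (evalp f a :: 'k::field)"
  using assms by (induction rule: forms_induct) (simp_all add: algebra_simps)

lemma equiv_proportional: "equiv (UNIV - {\<lambda>_. 0}) (proportional :: ((letter \<Rightarrow> 'k::field) \<times> _) set)"
proof (rule equivI)
  show "proportional \<subseteq> (UNIV - {\<lambda>_. 0 :: 'k}) \<times> (UNIV - {\<lambda>_. 0})"
    by (auto simp: proportional_def)
  show "refl_on (UNIV - {\<lambda>_. 0 :: 'k}) proportional"
    by (rule refl_onI) (auto simp: proportional_def intro!: exI[of _ 1])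
  show "sym (proportional :: ((letter \<Rightarrow> 'k) \<times> _) set)"
  proof (rule symI)
    fix a b :: "letter \<Rightarrow> 'k"
    assume "(a, b) \<in> proportional"
    then obtain c where "a \<noteq> (\<lambda>_. 0)" "b \<noteq> (\<lambda>_. 0)" "c \<noteq> 0" "b = (\<lambda>v. c * a v)"
      by (auto simp: proportional_def)
    moreover from this have "a = (\<lambda>v. inverse c * b v)"
      by (simp add: mult.assoc[symmetric])
    ultimately show "(b, a) \<in> proportional"
      unfolding proportional_def using nonzero_imp_inverse_nonzero by blast
  qed
  show "trans (proportional :: ((letter \<Rightarrow> 'k) \<times> _) set)"
  proof (rule transI)
    fix a b d :: "letter \<Rightarrow> 'k"
    assume "(a, b) \<in> proportional" "(b, d) \<in> proportional"
    then obtain c c' where "a \<noteq> (\<lambda>_. 0)" "d \<noteq> (\<lambda>_. 0)" "c \<noteq> 0" "b = (\<lambda>v. c * a v)" "c' \<noteq> 0" "d = (\<lambda>v. c' * b v)"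
      by (auto simp: proportional_def)
    moreover from this have "d = (\<lambda>v. (c' * c) * a v)"
      by (simp add: mult.assoc)
    moreover have "c' * c \<noteq> 0"
      using \<open>c \<noteq> 0\<close> \<open>c' \<noteq> 0\<close> by simp
    ultimately show "(a, d) \<in> proportional"
      unfolding proportional_def by blast
  qed
qed

lemma vanishes_at_class:
  assumes "f \<in> forms d" "a \<noteq> (\<lambda>_. 0 :: 'k::field)"
  shows "vanishes_at f (proportional `` {a}) \<longleftrightarrow> evalp f a = 0"
proof
  assume "vanishes_at f (proportional `` {a})"
  then show "evalp f a = 0"
    using equiv_class_self[OF equiv_proportional, of a] assms(2) by (auto simp: vanishes_at_def)
next
  assume "evalp f a = 0"
  then show "vanishes_at f (proportional `` {a})"
    using evalp_scale[OF assms(1)] by (auto simp: vanishes_at_def proportional_def)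
qed

definition grid_class :: "nat \<times> nat \<times> nat \<Rightarrow> (letter \<Rightarrow> 'k::field) set" where
  "grid_class \<mu> = proportional `` {grid_point \<mu>}"

lemma grid_point_w: "grid_point \<mu> Lw = 1"
  by (simp add: grid_point_def split_beta)

lemma grid_point_nonzero: "grid_point \<mu> \<noteq> (\<lambda>_. 0 :: 'k::field)"
  using grid_point_w[of \<mu>, where 'a = 'k] by force

context
  fixes t :: nat
  assumes inj: "inj_on (of_nat :: nat \<Rightarrow> 'k::field) {..t}"
begin

lemma inj_on_grid_class: "inj_on (grid_class :: _ \<Rightarrow> (letter \<Rightarrow> 'k) set) (grid t)"
proof (rule inj_onI)
  fix \<mu> \<nu>
  assume mem: "\<mu> \<in> grid t" "\<nu> \<in> grid t" and "grid_class \<mu> = (grid_class \<nu> :: (letter \<Rightarrow> 'k) set)"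
  then have "(grid_point \<mu>, grid_point \<nu> :: letter \<Rightarrow> 'k) \<in> proportional"
    unfolding grid_class_def
    using eq_equiv_class[OF _ equiv_proportional] grid_point_nonzero by blast
  then obtain c :: 'k where c: "grid_point \<nu> = (\<lambda>v. c * grid_point \<mu> v)"
    by (auto simp: proportional_def)
  then have "c = 1"
    using grid_point_w[of \<mu>, where 'a = 'k] grid_point_w[of \<nu>, where 'a = 'k] by simp
  then have eq: "grid_point \<nu> v = (grid_point \<mu> v :: 'k)" for v
    using c by simp
  show "\<mu> = \<nu>"
    using eq[of Lx] eq[of Ly] eq[of Lz] mem inj_on_eq_iff[OF inj]
    by (auto simp: grid_point_def grid_def split_beta prod_eq_iff)
qed

text \<open>At a point of the locus each of x, y, z is i w for some i \<le> t, so w is nonzero and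
  dividing by it gives integer coordinates. Distinctness of 0, ..., t in K turns xyz = 0 into the
  vanishing of an index.\<close>

lemma zero_locus_lifted: "zero_locus (lifted_ideal t) = (grid_class ` grid t :: (letter \<Rightarrow> 'k) set set)"
proof (intro equalityI subsetI)
  fix P :: "(letter \<Rightarrow> 'k) set"
  assume "P \<in> grid_class ` grid t"
  then obtain \<mu> where \<mu>: "\<mu> \<in> grid t" "P = grid_class \<mu>"
    by blast
  have "P \<in> proj3"
    unfolding proj3_def \<mu>(2) grid_class_def by (intro quotientI) (simp add: grid_point_nonzero)
  then show "P \<in> zero_locus (lifted_ideal t)"
    using evalp_lifted[OF _ \<mu>(1)] vanishes_at_class[OF _ grid_point_nonzero]
    unfolding zero_locus_def \<mu>(2) grid_class_def by blast
next
  fix P :: "(letter \<Rightarrow> 'k) set"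
  assume P: "P \<in> zero_locus (lifted_ideal t)"
  then obtain a where a: "a \<noteq> (\<lambda>_. 0)" "P = proportional `` {a}"
    unfolding zero_locus_def proj3_def quotient_def by blast
  have ev: "evalp f a = 0" if f: "f \<in> lifted_gens t" for f
  proof -
    obtain d where d: "f \<in> forms d"
      using f lifted_gens_forms by blast
    moreover have "f \<in> lifted_ideal t"
      unfolding lifted_ideal_eq using f by (rule mem_ideal_of)
    ultimately have "vanishes_at f P"
      using P unfolding zero_locus_def by blast
    then show ?thesis
      using vanishes_at_class[OF d a(1)] a(2) by blast
  qed
  have root: "\<exists>i\<le>t. a v = of_nat i * a Lw" if "v \<noteq> Lw" for v
  proof -
    have "evalp (lift_power (Suc t) v) a = 0"
      by (rule ev) (use that in \<open>cases v; simp add: lifted_gens_def\<close>)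
    then show ?thesis
      unfolding evalp_lift_power by (auto simp: prod_zero_iff less_Suc_eq_le simp del: prod.lessThan_Suc)
  qed
  obtain i j k where ijk: "i \<le> t" "a Lx = of_nat i * a Lw" "j \<le> t" "a Ly = of_nat j * a Lw"
      "k \<le> t" "a Lz = of_nat k * a Lw"
    using root[of Lx] root[of Ly] root[of Lz] by auto
  have w: "a Lw \<noteq> 0"
  proof
    assume "a Lw = 0"
    then have "a v = 0" for v
      using ijk by (cases v) simp_all
    then show False
      using a(1) by blast
  qed
  have "a Lx * a Ly * a Lz = 0"
    using ev[of "Xx * Xy * Xz"] by (simp add: lifted_gens_def)
  then have "(of_nat i :: 'k) = of_nat 0 \<or> (of_nat j :: 'k) = of_nat 0 \<or> (of_nat k :: 'k) = of_nat 0"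
    using ijk w by auto
  then have "i = 0 \<or> j = 0 \<or> k = 0"
    using inj_on_eq_iff[OF inj] ijk by blast
  then have mem: "(i, j, k) \<in> grid t"
    using ijk by (simp add: grid_def)
  have "a = (\<lambda>v. a Lw * grid_point (i, j, k) v)"
  proof
    fix v
    show "a v = a Lw * grid_point (i, j, k) v"
      using ijk by (cases v) (simp_all add: grid_point_def)
  qed
  then have "(grid_point (i, j, k), a) \<in> proportional"
    using w a(1) grid_point_nonzero unfolding proportional_def by blast
  then have "P = grid_class (i, j, k)"
    unfolding a(2) grid_class_def using equiv_class_eq[OF equiv_proportional] by metis
  then show "P \<in> grid_class ` grid t"
    using mem by blast
qed

lemma vanishing_ideal_grid: "vanishing_ideal (grid_class ` grid t) = (lifted_ideal t :: 'k poly4 set)"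
proof -
  let ?V = "{f :: 'k poly4. f \<in> (\<Union>d. forms d) \<and> (\<forall>P\<in>grid_class ` grid t. vanishes_at f P)}"
  have V_iff: "f \<in> ?V \<longleftrightarrow> (\<forall>\<mu>\<in>grid t. evalp f (grid_point \<mu>) = 0)" if "f \<in> forms d" for f :: "'k poly4" and d
    using vanishes_at_class[OF that grid_point_nonzero] that by (auto simp: grid_class_def)
  have "?V \<subseteq> lifted_ideal t"
  proof
    fix f
    assume f: "f \<in> ?V"
    then obtain d where d: "f \<in> forms d"
      by blast
    then have "\<forall>\<mu>\<in>grid t. evalp f (grid_point \<mu>) = 0"
      using f V_iff by blast
    then show "f \<in> lifted_ideal t"
      by (intro vanishing_mem[OF inj d]) simp
  qed
  then have "vanishing_ideal (grid_class ` grid t) \<subseteq> (lifted_ideal t :: 'k poly4 set)"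
    unfolding vanishing_ideal_def by (rule ideal_of_least[OF ideal_lifted])
  moreover have "lifted_gens t \<subseteq> ?V"
  proof
    fix s :: "'k poly4"
    assume s: "s \<in> lifted_gens t"
    then obtain d where d: "s \<in> forms d"
      using lifted_gens_forms by blast
    have "s \<in> lifted_ideal t"
      unfolding lifted_ideal_eq using s by (rule mem_ideal_of)
    then show "s \<in> ?V"
      unfolding V_iff[OF d] by (intro ballI evalp_lifted)
  qed
  then have "lifted_ideal t \<subseteq> (vanishing_ideal (grid_class ` grid t) :: 'k poly4 set)"
    unfolding lifted_ideal_eq vanishing_ideal_def by (rule ideal_of_mono)
  ultimately show ?thesis
    by blast
qed

end

text \<open>The characteristic divides no positive difference of two numbers up to t. All arguments
  about the points use the assumption on the characteristic in this form.\<close>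

lemma inj_on_of_nat_field:
  assumes "CHAR('k::field) = 0 \<or> CHAR('k) > t"
  shows "inj_on (of_nat :: nat \<Rightarrow> 'k) {..t}"
proof -
  have *: "i = j" if eq: "(of_nat i :: 'k) = of_nat j" and "i \<le> j" "j \<le> t" for i j
  proof -
    have "(of_nat (j - i) :: 'k) = 0"
      using eq \<open>i \<le> j\<close> by (simp add: of_nat_diff)
    then have "CHAR('k) dvd j - i"
      by (simp add: of_nat_eq_0_iff_char_dvd)
    then show ?thesis
      using assms that by (auto dest: dvd_imp_le)
  qed
  show ?thesis
  proof (rule inj_onI)
    fix i j
    assume "i \<in> {..t}" "j \<in> {..t}" "(of_nat i :: 'k) = of_nat j"
    then show "i = j"
      using *[of i j] *[of j i] by (cases "i \<le> j") auto
  qed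
qed

theorem corollary3p8:
  fixes t :: nat
  assumes "infinite (UNIV :: 'k::field set)"
    and "t \<ge> 1"
  shows
    "(CHAR('k) = 0 \<or> CHAR('k) > t \<longrightarrow>
        (\<exists>S. defines_points (lifted_ideal t :: 'k poly4 set) S \<and>
             card S = 3 * (t + 1) * t + 1 \<and> level_points 3 S)) \<and>
     for_general_linear_form
        (\<lambda>l :: 'k poly4. weak_Lefschetz (add_generator (lifted_ideal t) l)) \<and>
     artinian_ring (quotient_ring (add_generator (lifted_ideal t) (indet Lw :: 'k poly4))) \<and>
     (weak_Lefschetz (add_generator (lifted_ideal t) (indet Lw :: 'k poly4)) \<longleftrightarrow>
        odd t \<and> CHAR('k) \<noteq> 2)"
proof (intro conjI impI)
  assume "CHAR('k) = 0 \<or> CHAR('k) > t"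
  then have inj: "inj_on (of_nat :: nat \<Rightarrow> 'k) {..t}"
    by (rule inj_on_of_nat_field)
  let ?S = "grid_class ` grid t :: (letter \<Rightarrow> 'k) set set"
  have "defines_points (lifted_ideal t) ?S"
    unfolding defines_points_def
    by (simp add: zero_locus_lifted[OF inj] vanishing_ideal_grid[OF inj])
  moreover have "card ?S = 3 * (t + 1) * t + 1"
    by (simp add: card_image[OF inj_on_grid_class[OF inj]] card_grid)
  moreover have "level_points 3 ?S"
    unfolding level_points_def vanishing_ideal_grid[OF inj]
    using level_section[OF inj assms(2)] nonzerodivisor_mod_iff[OF ideal_lifted] by blast
  ultimately show "\<exists>S. defines_points (lifted_ideal t :: 'k poly4 set) S \<and>
      card S = 3 * (t + 1) * t + 1 \<and> level_points 3 S"
    by blast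
qed (rule general_section_weak_Lefschetz[OF assms] artinian_section_at_infinity
      section_at_infinity_weak_Lefschetz_iff[OF assms(2)])+

end
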